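(* Let $\mathcal{K}$ be a collection of posets, each $\mathcal{C}$ in $\mathcal{K}$ equipped with a subcanonical Grothendieck topology $J_{\mathcal{C}}$, and let $\mathcal{H}$ be a collection of posets, each equipped with the trivial Grothendieck topology. Let $f:\mathcal{K}\to\mathcal{H}$ and $g:\mathcal{H}\to\mathcal{K}$ be functions inverse to each other up to isomorphism, and suppose that for each $\mathcal{C}$ in $\mathcal{K}$ there is a categorical equivalence $\mathbf{Sh}(\mathcal{C},J_{\mathcal{C}})\simeq[f(\mathcal{C})^{\mathrm{op}},\mathbf{Set}]$. Let $U$ be an invariant property of families of elements of frames such that all the topologies $J_{\mathcal{C}}$ are $U$-induced and such that, for any $\mathcal{C}$ in $\mathcal{K}$ and any family $\mathcal{F}$ of principal $J_{\mathcal{C}}$-ideals on $\mathcal{C}$, $\mathcal{F}$ has a refinement satisfying $U$ if and only if it has a refinement satisfying $U$ made of principal $J_{\mathcal{C}}$-ideals. Let $\mathrm{Ext}(\mathcal{K})$ be the category whose objects are the posets isomorphic to a poset in $\mathcal{K}$ (with transported topology) and whose arrows $\mathcal{C}\to\mathcal{C}'$ are the monotone maps $h$ which are morphisms of sites $(\mathcal{C},J_{\mathcal{C}})\to(\mathcal{C}',J_{\mathcal{C}'})$ such that the frame homomorphism $A(h):\mathrm{Id}_{J_{\mathcal{C}}}(\mathcal{C})\to\mathrm{Id}_{J_{\mathcal{C}'}}(\mathcal{C}')$ preserves arbitrary infima. Let $\mathrm{Ext}(\mathcal{H})$ be the category whose objects are the posets isomorphic to a poset in $\mathcal{H}$ and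 whose arrows $\mathcal{D}\to\mathcal{D}'$ are the monotone maps $h$ such that the frame homomorphism $h^{-1}:\mathrm{Id}(\mathcal{D}')\to\mathrm{Id}(\mathcal{D})$ sends $U$-compact elements to $U$-compact elements. Let $D:\mathrm{Ext}(\mathcal{K})^{\mathrm{op}}\to\mathrm{Ext}(\mathcal{H})$ be the functor sending $\mathcal{C}$ to the poset of supercompact elements of $\mathrm{Id}_{J_{\mathcal{C}}}(\mathcal{C})$ and $h:\mathcal{C}\to\mathcal{C}'$ to the restriction to supercompact elements of the left adjoint $A(h)_!:\mathrm{Id}_{J_{\mathcal{C}'}}(\mathcal{C}')\to\mathrm{Id}_{J_{\mathcal{C}}}(\mathcal{C})$ of $A(h)$. Let $E:\mathrm{Ext}(\mathcal{H})\to\mathrm{Ext}(\mathcal{K})^{\mathrm{op}}$ be the functor sending $\mathcal{D}$ to the poset of $U$-compact elements of $\mathrm{Id}(\mathcal{D})$ and $h:\mathcal{D}\to\mathcal{D}'$ to the restriction of $h^{-1}$ to the subsets of $U$-compact elements. Then $D$ and $E$ are categorical inverses to each other and hence define a duality between $\mathrm{Ext}(\mathcal{K})$ and $\mathrm{Ext}(\mathcal{H})$.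
   Context: Posets are regarded as categories. $\mathrm{Id}(\mathcal{D})$ is the frame of lower sets of $\mathcal{D}$. A $J$-ideal on $\mathcal{C}$ is a lower set $I$ such that whenever all elements of a $J$-covering sieve on $c$ lie in $I$, also $c\in I$; $\mathrm{Id}_J(\mathcal{C})$ is the frame of $J$-ideals ordered by inclusion. The principal $J$-ideal of $c$ is the smallest $J$-ideal containing $c$ (equal to $\{d\mid d\le c\}$ if $J$ is subcanonical). $J$ is subcanonical if each $c$ is the supremum of every $J$-covering sieve on it. A morphism of sites $h:(\mathcal{C},J)\to(\mathcal{C}',J')$ between posets is a monotone map such that: for every $d\in\mathcal{C}'$ there is $c$ with $d\le h(c)$; whenever $d\le h(c),h(c')$ there is $c''\le c,c'$ with $d\le h(c'')$; and the image of each $J$-covering sieve generates a $J'$-covering sieve. For such $h$, $A(h)$ sends a $J$-ideal $I$ to the smallest $J'$-ideal containing $h(I)$. A family $\{b_j\}$ in a frame refines $\{a_i\}$ if each $b_j\le a_i$ for some $i$ and $\bigvee_jb_j=\bigvee_ia_i$. An invariant property of families of elements of frames is one stable under frame isomorphism (equivalently, a topos-theoretic invariant property of families of subterminal objects). An element $l$ of a frame is $U$-compact if every family with join $l$ has a refinement satisfying $U$; it is supercompact if whenever $l=\bigvee_{i\in I}a_i$ ($I$ possibly empty) some $a_i$ equals $l$. $U$-induced: let $P$ be an invariant property of embeddings $B_L\hookrightarrow L$ of a basis $B_L$ of a frame $L$ (a subset of which every element of $L$ is a join) which holds for all canonical embeddings $\mathcal{C}\hookrightarrow\mathrm{Id}_{J_{\mathcal{C}}}(\mathcal{C})$,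 $c\mapsto\{d\mid d\le c\}$, $\mathcal{C}$ in $\mathcal{K}$. $J_{\mathcal{C}}$ is $U$-induced relative to $P$ if for every frame $L$ and every monotone embedding $i:\mathcal{C}\hookrightarrow L$ whose image is a basis of $L$, satisfying $P$ and sending $J_{\mathcal{C}}$-covering sieves to covering families in $L$, the following holds for every family $\mathcal{A}$ of elements of $\mathcal{C}$: there exists $c\in\mathcal{C}$ with $a\le c$ for all $a\in\mathcal{A}$ such that the sieve on $c$ generated by $\mathcal{A}$ is $J_{\mathcal{C}}$-covering if and only if $i(\mathcal{A})$ has a refinement in $L$ satisfying $U$ made of elements $i(c')$, $c'\in\mathcal{C}$. $J_{\mathcal{C}}$ is $U$-induced if it is so relative to some such $P$.
   Formalization: That E is a functor does not follow: for an arrow h of Ext(H), the restriction of h^{-1} to U-compact elements may fail the two filtering conditions of a morphism of sites. These conditions are added as a hypothesis; they are necessary for the conclusion. *)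

theory Defs
  imports "HOL-Algebra.Galois_Connection" "HOL-Library.FuncSet"
begin

section \<open>Categories, functors, equivalences\<close>

text \<open>
  Hom-sets need not be disjoint, so composition takes the three objects as arguments:
  \<open>cmp \<A> A B C g f\<close> is the composite of \<open>f : A \<rightarrow> B\<close> and \<open>g : B \<rightarrow> C\<close>.
\<close>

record ('o, 'm) cat =
  ob :: "'o set"
  arr :: "'o \<Rightarrow> 'o \<Rightarrow> 'm set"
  idt :: "'o \<Rightarrow> 'm"
  cmp :: "'o \<Rightarrow> 'o \<Rightarrow> 'o \<Rightarrow> 'm \<Rightarrow> 'm \<Rightarrow> 'm"

definition category :: "('o, 'm) cat \<Rightarrow> bool" where
  "category \<A> \<longleftrightarrow>
     (\<forall>A\<in>ob \<A>. idt \<A> A \<in> arr \<A> A A) \<and>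
     (\<forall>A\<in>ob \<A>. \<forall>B\<in>ob \<A>. \<forall>C\<in>ob \<A>. \<forall>f\<in>arr \<A> A B. \<forall>g\<in>arr \<A> B C.
        cmp \<A> A B C g f \<in> arr \<A> A C) \<and>
     (\<forall>A\<in>ob \<A>. \<forall>B\<in>ob \<A>. \<forall>f\<in>arr \<A> A B.
        cmp \<A> A A B f (idt \<A> A) = f \<and> cmp \<A> A B B (idt \<A> B) f = f) \<and>
     (\<forall>A\<in>ob \<A>. \<forall>B\<in>ob \<A>. \<forall>C\<in>ob \<A>. \<forall>D\<in>ob \<A>.
        \<forall>f\<in>arr \<A> A B. \<forall>g\<in>arr \<A> B C. \<forall>h\<in>arr \<A> C D.
        cmp \<A> A C D h (cmp \<A> A B C g f) = cmp \<A> A B D (cmp \<A> B C D h g) f)"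

definition op_cat :: "('o, 'm) cat \<Rightarrow> ('o, 'm) cat" where
  "op_cat \<A> = \<lparr>ob = ob \<A>, arr = (\<lambda>A B. arr \<A> B A), idt = idt \<A>,
               cmp = (\<lambda>A B C g f. cmp \<A> C B A f g)\<rparr>"

record ('o, 'm, 'p, 'n) funct =
  fob :: "'o \<Rightarrow> 'p"
  farr :: "'o \<Rightarrow> 'o \<Rightarrow> 'm \<Rightarrow> 'n"

definition is_functor :: "('o, 'm) cat \<Rightarrow> ('p, 'n) cat \<Rightarrow> ('o, 'm, 'p, 'n) funct \<Rightarrow> bool" where
  "is_functor \<A> \<B> F \<longleftrightarrow>
     category \<A> \<and> category \<B> \<and>
     (\<forall>A\<in>ob \<A>. fob F A \<in> ob \<B>) \<and>
     (\<forall>A\<in>ob \<A>. \<forall>B\<in>ob \<A>. \<forall>f\<in>arr \<A> A B. farr F A B f \<in> arr \<B> (fob F A) (fob F B)) \<and>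
     (\<forall>A\<in>ob \<A>. farr F A A (idt \<A> A) = idt \<B> (fob F A)) \<and>
     (\<forall>A\<in>ob \<A>. \<forall>B\<in>ob \<A>. \<forall>C\<in>ob \<A>. \<forall>f\<in>arr \<A> A B. \<forall>g\<in>arr \<A> B C.
        farr F A C (cmp \<A> A B C g f) =
        cmp \<B> (fob F A) (fob F B) (fob F C) (farr F B C g) (farr F A B f))"

definition id_funct :: "('o, 'm, 'o, 'm) funct" where
  "id_funct = \<lparr>fob = (\<lambda>A. A), farr = (\<lambda>A B f. f)\<rparr>"

definition comp_funct ::
  "('p, 'n, 'q, 'k) funct \<Rightarrow> ('o, 'm, 'p, 'n) funct \<Rightarrow> ('o, 'm, 'q, 'k) funct" where
  "comp_funct G F = \<lparr>fob = (\<lambda>A. fob G (fob F A)),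
                     farr = (\<lambda>A B f. farr G (fob F A) (fob F B) (farr F A B f))\<rparr>"

definition is_iso :: "('o, 'm) cat \<Rightarrow> 'o \<Rightarrow> 'o \<Rightarrow> 'm \<Rightarrow> bool" where
  "is_iso \<A> A B f \<longleftrightarrow> f \<in> arr \<A> A B \<and>
     (\<exists>g\<in>arr \<A> B A. cmp \<A> A B A g f = idt \<A> A \<and> cmp \<A> B A B f g = idt \<A> B)"

definition natural_iso ::
  "('o, 'm) cat \<Rightarrow> ('p, 'n) cat \<Rightarrow> ('o, 'm, 'p, 'n) funct \<Rightarrow> ('o, 'm, 'p, 'n) funct
    \<Rightarrow> ('o \<Rightarrow> 'n) \<Rightarrow> bool" where
  "natural_iso \<A> \<B> F G \<eta> \<longleftrightarrow>
     (\<forall>A\<in>ob \<A>. is_iso \<B> (fob F A) (fob G A) (\<eta> A)) \<and>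
     (\<forall>A\<in>ob \<A>. \<forall>B\<in>ob \<A>. \<forall>f\<in>arr \<A> A B.
        cmp \<B> (fob F A) (fob F B) (fob G B) (\<eta> B) (farr F A B f) =
        cmp \<B> (fob F A) (fob G A) (fob G B) (farr G A B f) (\<eta> A))"

definition categorical_inverses ::
  "('o, 'm) cat \<Rightarrow> ('p, 'n) cat \<Rightarrow> ('o, 'm, 'p, 'n) funct \<Rightarrow> ('p, 'n, 'o, 'm) funct \<Rightarrow> bool" where
  "categorical_inverses \<A> \<B> F G \<longleftrightarrow>
     is_functor \<A> \<B> F \<and> is_functor \<B> \<A> G \<and>
     (\<exists>\<eta>. natural_iso \<A> \<A> id_funct (comp_funct G F) \<eta>) \<and>
     (\<exists>\<epsilon>. natural_iso \<B> \<B> (comp_funct F G) id_funct \<epsilon>)"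

definition equivalent_categories :: "('o, 'm) cat \<Rightarrow> ('p, 'n) cat \<Rightarrow> bool" where
  "equivalent_categories \<A> \<B> \<longleftrightarrow> (\<exists>F G. categorical_inverses \<A> \<B> F G)"

section \<open>Posets and sites\<close>

text \<open>
  Posets are \<^locale>\<open>partial_order\<close>s of HOL-Algebra.  A topology \<open>J\<close> on a poset assigns to each
  element the set of its covering sieves; its values outside the carrier are irrelevant.
\<close>

definition poset_iso :: "'a gorder \<Rightarrow> 'b gorder \<Rightarrow> ('a \<Rightarrow> 'b) \<Rightarrow> bool" where
  "poset_iso P Q \<phi> \<longleftrightarrow> partial_order P \<and> partial_order Q \<and>
     bij_betw \<phi> (carrier P) (carrier Q) \<and>
     (\<forall>x\<in>carrier P. \<forall>y\<in>carrier P. x \<sqsubseteq>\<^bsub>P\<^esub> y \<longleftrightarrow> \<phi> x \<sqsubseteq>\<^bsub>Q\<^esub> \<phi> y)"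

definition isomorphic_posets :: "'a gorder \<Rightarrow> 'b gorder \<Rightarrow> bool" where
  "isomorphic_posets P Q \<longleftrightarrow> (\<exists>\<phi>. poset_iso P Q \<phi>)"

definition lower_set :: "'a gorder \<Rightarrow> 'a set \<Rightarrow> bool" where
  "lower_set C I \<longleftrightarrow> I \<subseteq> carrier C \<and> (\<forall>x\<in>I. \<forall>y\<in>carrier C. y \<sqsubseteq>\<^bsub>C\<^esub> x \<longrightarrow> y \<in> I)"

definition down :: "'a gorder \<Rightarrow> 'a \<Rightarrow> 'a set" where
  "down C c = {d \<in> carrier C. d \<sqsubseteq>\<^bsub>C\<^esub> c}"

definition is_sieve :: "'a gorder \<Rightarrow> 'a \<Rightarrow> 'a set \<Rightarrow> bool" where
  "is_sieve C c S \<longleftrightarrow> lower_set C S \<and> S \<subseteq> down C c"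

definition gen_sieve :: "'a gorder \<Rightarrow> 'a set \<Rightarrow> 'a set" where
  "gen_sieve C A = {d \<in> carrier C. \<exists>a\<in>A. d \<sqsubseteq>\<^bsub>C\<^esub> a}"

definition grothendieck_topology :: "'a gorder \<Rightarrow> ('a \<Rightarrow> 'a set set) \<Rightarrow> bool" where
  "grothendieck_topology C J \<longleftrightarrow>
     (\<forall>c\<in>carrier C. \<forall>S\<in>J c. is_sieve C c S) \<and>
     (\<forall>c\<in>carrier C. down C c \<in> J c) \<and>
     (\<forall>c\<in>carrier C. \<forall>S\<in>J c. \<forall>d\<in>down C c. S \<inter> down C d \<in> J d) \<and>
     (\<forall>c\<in>carrier C. \<forall>S\<in>J c. \<forall>R. is_sieve C c R \<and> (\<forall>d\<in>S. R \<inter> down C d \<in> J d) \<longrightarrow> R \<in> J c)"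

definition subcanonical :: "'a gorder \<Rightarrow> ('a \<Rightarrow> 'a set set) \<Rightarrow> bool" where
  "subcanonical C J \<longleftrightarrow> (\<forall>c\<in>carrier C. \<forall>S\<in>J c. is_lub C c S)"

definition site_iso ::
  "'a gorder \<Rightarrow> ('a \<Rightarrow> 'a set set) \<Rightarrow> 'b gorder \<Rightarrow> ('b \<Rightarrow> 'b set set) \<Rightarrow> ('a \<Rightarrow> 'b) \<Rightarrow> bool" where
  "site_iso C J C' J' \<phi> \<longleftrightarrow> poset_iso C C' \<phi> \<and>
     (\<forall>c\<in>carrier C. \<forall>S\<subseteq>carrier C. S \<in> J c \<longleftrightarrow> \<phi> ` S \<in> J' (\<phi> c))"

definition lower_set_frame :: "'a gorder \<Rightarrow> 'a set gorder" where
  "lower_set_frame D = \<lparr>carrier = {I. lower_set D I}, eq = (=), le = (\<subseteq>)\<rparr>"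

definition J_ideal :: "'a gorder \<Rightarrow> ('a \<Rightarrow> 'a set set) \<Rightarrow> 'a set \<Rightarrow> bool" where
  "J_ideal C J I \<longleftrightarrow> lower_set C I \<and> (\<forall>c\<in>carrier C. \<forall>S\<in>J c. S \<subseteq> I \<longrightarrow> c \<in> I)"

definition J_ideal_frame :: "'a gorder \<Rightarrow> ('a \<Rightarrow> 'a set set) \<Rightarrow> 'a set gorder" where
  "J_ideal_frame C J = \<lparr>carrier = {I. J_ideal C J I}, eq = (=), le = (\<subseteq>)\<rparr>"

definition gen_J_ideal :: "'a gorder \<Rightarrow> ('a \<Rightarrow> 'a set set) \<Rightarrow> 'a set \<Rightarrow> 'a set" where
  "gen_J_ideal C J X = \<Inter>{I. J_ideal C J I \<and> X \<subseteq> I}"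

definition principal_J_ideals :: "'a gorder \<Rightarrow> ('a \<Rightarrow> 'a set set) \<Rightarrow> 'a set set" where
  "principal_J_ideals C J = (\<lambda>c. gen_J_ideal C J {c}) ` carrier C"

definition filtering :: "'a gorder \<Rightarrow> 'b gorder \<Rightarrow> ('a \<Rightarrow> 'b) \<Rightarrow> bool" where
  "filtering C C' h \<longleftrightarrow>
     (\<forall>d\<in>carrier C'. \<exists>c\<in>carrier C. d \<sqsubseteq>\<^bsub>C'\<^esub> h c) \<and>
     (\<forall>d\<in>carrier C'. \<forall>c\<in>carrier C. \<forall>c'\<in>carrier C. d \<sqsubseteq>\<^bsub>C'\<^esub> h c \<and> d \<sqsubseteq>\<^bsub>C'\<^esub> h c' \<longrightarrow>
        (\<exists>c''\<in>carrier C. c'' \<sqsubseteq>\<^bsub>C\<^esub> c \<and> c'' \<sqsubseteq>\<^bsub>C\<^esub> c' \<and> d \<sqsubseteq>\<^bsub>C'\<^esub> h c''))"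

definition site_morphism ::
  "'a gorder \<Rightarrow> ('a \<Rightarrow> 'a set set) \<Rightarrow> 'b gorder \<Rightarrow> ('b \<Rightarrow> 'b set set) \<Rightarrow> ('a \<Rightarrow> 'b) \<Rightarrow> bool" where
  "site_morphism C J C' J' h \<longleftrightarrow>
     h \<in> carrier C \<rightarrow> carrier C' \<and> isotone C C' h \<and> filtering C C' h \<and>
     (\<forall>c\<in>carrier C. \<forall>S\<in>J c. gen_sieve C' (h ` S) \<in> J' (h c))"

text \<open>The frame homomorphism \<open>A(h)\<close> and its left adjoint \<open>A(h)\<^sub>!\<close>; the latter is determined by the
  adjunction on the carrier of \<open>J_ideal_frame C' J'\<close> whenever it exists.\<close>

definition A_map :: "'b gorder \<Rightarrow> ('b \<Rightarrow> 'b set set) \<Rightarrow> ('a \<Rightarrow> 'b) \<Rightarrow> 'a set \<Rightarrow> 'b set" where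
  "A_map C' J' h I = gen_J_ideal C' J' (h ` I)"

definition A_shriek ::
  "'a gorder \<Rightarrow> ('a \<Rightarrow> 'a set set) \<Rightarrow> 'b gorder \<Rightarrow> ('b \<Rightarrow> 'b set set) \<Rightarrow> ('a \<Rightarrow> 'b)
    \<Rightarrow> 'b set \<Rightarrow> 'a set" where
  "A_shriek C J C' J' h = (SOME l. galois_connection
     \<lparr>orderA = J_ideal_frame C' J', orderB = J_ideal_frame C J, lower = l, upper = A_map C' J' h\<rparr>)"

definition inv_image_map :: "'a gorder \<Rightarrow> ('a \<Rightarrow> 'b) \<Rightarrow> 'b set \<Rightarrow> 'a set" where
  "inv_image_map D h I = {d \<in> carrier D. h d \<in> I}"

section \<open>Presheaves and sheaves of sets on a poset\<close>

text \<open>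
  \<open>'s\<close> is the universe of the category of sets: its objects are the sets of elements of \<open>'s\<close>.
  \<open>res F c d\<close> is the restriction map \<open>F(c) \<rightarrow> F(d)\<close> for \<open>d \<sqsubseteq> c\<close>.
\<close>

record ('a, 's) presheaf =
  sec :: "'a \<Rightarrow> 's set"
  res :: "'a \<Rightarrow> 'a \<Rightarrow> 's \<Rightarrow> 's"

definition is_presheaf :: "'a gorder \<Rightarrow> ('a, 's) presheaf \<Rightarrow> bool" where
  "is_presheaf C F \<longleftrightarrow>
     (\<forall>c\<in>carrier C. \<forall>d\<in>down C c. res F c d \<in> sec F c \<rightarrow> sec F d) \<and>
     (\<forall>c\<in>carrier C. \<forall>x\<in>sec F c. res F c c x = x) \<and>
     (\<forall>c\<in>carrier C. \<forall>d\<in>down C c. \<forall>e\<in>down C d. \<forall>x\<in>sec F c.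
        res F d e (res F c d x) = res F c e x)"

definition matching_family ::
  "'a gorder \<Rightarrow> ('a, 's) presheaf \<Rightarrow> 'a set \<Rightarrow> ('a \<Rightarrow> 's) \<Rightarrow> bool" where
  "matching_family C F S x \<longleftrightarrow>
     (\<forall>d\<in>S. x d \<in> sec F d) \<and> (\<forall>d\<in>S. \<forall>e\<in>down C d. res F d e (x d) = x e)"

definition is_sheaf :: "'a gorder \<Rightarrow> ('a \<Rightarrow> 'a set set) \<Rightarrow> ('a, 's) presheaf \<Rightarrow> bool" where
  "is_sheaf C J F \<longleftrightarrow> is_presheaf C F \<and>
     (\<forall>c\<in>carrier C. \<forall>S\<in>J c. \<forall>x. matching_family C F S x \<longrightarrow>
        (\<exists>!s. s \<in> sec F c \<and> (\<forall>d\<in>S. res F c d s = x d)))"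

definition presheaf_hom ::
  "'a gorder \<Rightarrow> ('a, 's) presheaf \<Rightarrow> ('a, 's) presheaf \<Rightarrow> ('a \<Rightarrow> 's \<Rightarrow> 's) set" where
  "presheaf_hom C F G = {\<alpha> \<in> (\<Pi>\<^sub>E c\<in>carrier C. sec F c \<rightarrow>\<^sub>E sec G c).
     \<forall>c\<in>carrier C. \<forall>d\<in>down C c. \<forall>x\<in>sec F c. \<alpha> d (res F c d x) = res G c d (\<alpha> c x)}"

definition presheaf_cat ::
  "'s itself \<Rightarrow> 'a gorder \<Rightarrow> (('a, 's) presheaf, 'a \<Rightarrow> 's \<Rightarrow> 's) cat" where
  "presheaf_cat _ C =
     \<lparr>ob = {F. is_presheaf C F},
      arr = presheaf_hom C,
      idt = (\<lambda>F. \<lambda>c\<in>carrier C. \<lambda>x\<in>sec F c. x),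
      cmp = (\<lambda>F G H \<beta> \<alpha>. \<lambda>c\<in>carrier C. compose (sec F c) (\<beta> c) (\<alpha> c))\<rparr>"

definition sheaf_cat ::
  "'s itself \<Rightarrow> 'a gorder \<Rightarrow> ('a \<Rightarrow> 'a set set) \<Rightarrow> (('a, 's) presheaf, 'a \<Rightarrow> 's \<Rightarrow> 's) cat" where
  "sheaf_cat T C J = (presheaf_cat T C)\<lparr>ob := {F. is_sheaf C J F}\<rparr>"

section \<open>Invariants of families of elements of frames\<close>

text \<open>
  Families are taken as sets of elements: refinements, joins and hence all notions below depend
  on an indexed family only through its set of values.
\<close>

definition is_frame :: "'b gorder \<Rightarrow> bool" where
  "is_frame L \<longleftrightarrow> complete_lattice L \<and>
     (\<forall>x\<in>carrier L. \<forall>A\<subseteq>carrier L. x \<sqinter>\<^bsub>L\<^esub> \<Squnion>\<^bsub>L\<^esub> A = \<Squnion>\<^bsub>L\<^esub> ((\<lambda>a. x \<sqinter>\<^bsub>L\<^esub> a) ` A))"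

definition refines :: "'b gorder \<Rightarrow> 'b set \<Rightarrow> 'b set \<Rightarrow> bool" where
  "refines L B A \<longleftrightarrow> B \<subseteq> carrier L \<and> (\<forall>b\<in>B. \<exists>a\<in>A. b \<sqsubseteq>\<^bsub>L\<^esub> a) \<and> \<Squnion>\<^bsub>L\<^esub> B = \<Squnion>\<^bsub>L\<^esub> A"

definition invariant_of_families :: "('b gorder \<Rightarrow> 'b set \<Rightarrow> bool) \<Rightarrow> bool" where
  "invariant_of_families U \<longleftrightarrow>
     (\<forall>L M \<phi> A. is_frame L \<and> is_frame M \<and> poset_iso L M \<phi> \<and> A \<subseteq> carrier L \<longrightarrow>
        (U L A \<longleftrightarrow> U M (\<phi> ` A)))"

definition U_compact :: "('b gorder \<Rightarrow> 'b set \<Rightarrow> bool) \<Rightarrow> 'b gorder \<Rightarrow> 'b \<Rightarrow> bool" where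
  "U_compact U L l \<longleftrightarrow> l \<in> carrier L \<and>
     (\<forall>A\<subseteq>carrier L. \<Squnion>\<^bsub>L\<^esub> A = l \<longrightarrow> (\<exists>B. refines L B A \<and> U L B))"

definition supercompact :: "'b gorder \<Rightarrow> 'b \<Rightarrow> bool" where
  "supercompact L l \<longleftrightarrow> l \<in> carrier L \<and> (\<forall>A\<subseteq>carrier L. \<Squnion>\<^bsub>L\<^esub> A = l \<longrightarrow> l \<in> A)"

definition is_basis :: "'b gorder \<Rightarrow> 'b set \<Rightarrow> bool" where
  "is_basis L B \<longleftrightarrow> B \<subseteq> carrier L \<and> (\<forall>l\<in>carrier L. \<exists>A\<subseteq>B. \<Squnion>\<^bsub>L\<^esub> A = l)"

definition invariant_of_bases :: "('b gorder \<Rightarrow> 'b set \<Rightarrow> bool) \<Rightarrow> bool" where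
  "invariant_of_bases P \<longleftrightarrow>
     (\<forall>L M \<phi> B. is_frame L \<and> is_frame M \<and> poset_iso L M \<phi> \<and> is_basis L B \<longrightarrow>
        (P L B \<longleftrightarrow> P M (\<phi> ` B)))"

text \<open>
  Every frame with a basis isomorphic to a poset on \<open>'a\<close> has an isomorphic copy whose elements
  are of type \<open>'a set\<close> (send an element to the set of basis elements below it), so that frames
  on \<open>'a set\<close> suffice for the quantification over all frames.
\<close>

definition U_induced_rel ::
  "('a set gorder \<Rightarrow> 'a set set \<Rightarrow> bool) \<Rightarrow> ('a set gorder \<Rightarrow> 'a set set \<Rightarrow> bool)
    \<Rightarrow> 'a gorder \<Rightarrow> ('a \<Rightarrow> 'a set set) \<Rightarrow> bool" where
  "U_induced_rel U P C J \<longleftrightarrow>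
     (\<forall>L i. is_frame L \<and> i \<in> carrier C \<rightarrow> carrier L \<and>
            (\<forall>c\<in>carrier C. \<forall>d\<in>carrier C. i c \<sqsubseteq>\<^bsub>L\<^esub> i d \<longleftrightarrow> c \<sqsubseteq>\<^bsub>C\<^esub> d) \<and>
            is_basis L (i ` carrier C) \<and> P L (i ` carrier C) \<and>
            (\<forall>c\<in>carrier C. \<forall>S\<in>J c. \<Squnion>\<^bsub>L\<^esub> (i ` S) = i c) \<longrightarrow>
        (\<forall>A\<subseteq>carrier C.
           (\<exists>c\<in>carrier C. (\<forall>a\<in>A. a \<sqsubseteq>\<^bsub>C\<^esub> c) \<and> gen_sieve C A \<in> J c) \<longleftrightarrow>
           (\<exists>B\<subseteq>i ` carrier C. refines L B (i ` A) \<and> U L B)))"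

definition U_induced ::
  "'a gorder set \<Rightarrow> ('a gorder \<Rightarrow> 'a \<Rightarrow> 'a set set) \<Rightarrow> ('a set gorder \<Rightarrow> 'a set set \<Rightarrow> bool)
    \<Rightarrow> 'a gorder \<Rightarrow> bool" where
  "U_induced \<K> J U C \<longleftrightarrow>
     (\<exists>P. invariant_of_bases P \<and>
          (\<forall>C'\<in>\<K>. P (J_ideal_frame C' (J C')) (down C' ` carrier C')) \<and>
          U_induced_rel U P C (J C))"

section \<open>The categories \<open>Ext(\<K>)\<close> and \<open>Ext(\<H>)\<close>\<close>

text \<open>
  An object of \<open>Ext(\<K>)\<close> is a poset together with its transported topology.  Arrows are
  functions that are \<^const>\<open>undefined\<close> outside the carrier of their domain.
\<close>

type_synonym 'a site = "'a gorder \<times> ('a \<Rightarrow> 'a set set)"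

definition ExtK_ob :: "'a gorder set \<Rightarrow> ('a gorder \<Rightarrow> 'a \<Rightarrow> 'a set set) \<Rightarrow> 'a site set" where
  "ExtK_ob \<K> J = {(C, J\<^sub>C). partial_order C \<and> grothendieck_topology C J\<^sub>C \<and>
                    (\<exists>C\<^sub>0\<in>\<K>. \<exists>\<phi>. site_iso C J\<^sub>C C\<^sub>0 (J C\<^sub>0) \<phi>)}"

definition ExtK_arr :: "'a site \<Rightarrow> 'a site \<Rightarrow> ('a \<Rightarrow> 'a) set" where
  "ExtK_arr = (\<lambda>(C, J) (C', J').
     {h \<in> carrier C \<rightarrow>\<^sub>E carrier C'. site_morphism C J C' J' h \<and>
        inf_pres (J_ideal_frame C J) (J_ideal_frame C' J') (A_map C' J' h)})"

definition ExtK ::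
  "'a gorder set \<Rightarrow> ('a gorder \<Rightarrow> 'a \<Rightarrow> 'a set set) \<Rightarrow> ('a site, 'a \<Rightarrow> 'a) cat" where
  "ExtK \<K> J = \<lparr>ob = ExtK_ob \<K> J, arr = ExtK_arr,
                idt = (\<lambda>C. \<lambda>x\<in>carrier (fst C). x),
                cmp = (\<lambda>A B C g f. compose (carrier (fst A)) g f)\<rparr>"

definition ExtH ::
  "'a gorder set \<Rightarrow> ('a set gorder \<Rightarrow> 'a set set \<Rightarrow> bool) \<Rightarrow> ('a gorder, 'a \<Rightarrow> 'a) cat" where
  "ExtH \<H> U =
     \<lparr>ob = {D. \<exists>D\<^sub>0\<in>\<H>. isomorphic_posets D D\<^sub>0},
      arr = (\<lambda>D D'. {h \<in> carrier D \<rightarrow>\<^sub>E carrier D'. isotone D D' h \<and>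
               (\<forall>u. U_compact U (lower_set_frame D') u \<longrightarrow>
                    U_compact U (lower_set_frame D) (inv_image_map D h u))}),
      idt = (\<lambda>D. \<lambda>x\<in>carrier D. x),
      cmp = (\<lambda>A B C g f. compose (carrier A) g f)\<rparr>"

section \<open>The functors \<open>D\<close> and \<open>E\<close>\<close>

text \<open>
  \<open>D(C)\<close> and \<open>E(D)\<close> consist of sets of elements of \<open>'a\<close>, whereas the objects of \<^const>\<open>ExtK\<close> and
  \<^const>\<open>ExtH\<close> have their elements in \<open>'a\<close>.  They are therefore replaced by isomorphic copies on
  \<open>'a\<close>, and maps between them are conjugated by the chosen isomorphisms.  These definitions are
  meaningful only if such copies exist.
\<close>

definition copy :: "'a set gorder \<Rightarrow> 'a gorder" where
  "copy P = (SOME Q. isomorphic_posets Q P)"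

definition copy_iso :: "'a set gorder \<Rightarrow> 'a \<Rightarrow> 'a set" where
  "copy_iso P = (SOME \<phi>. poset_iso (copy P) P \<phi>)"

definition copy_map :: "'a set gorder \<Rightarrow> 'a set gorder \<Rightarrow> ('a set \<Rightarrow> 'a set) \<Rightarrow> 'a \<Rightarrow> 'a" where
  "copy_map P Q h = (\<lambda>x\<in>carrier (copy P).
     inv_into (carrier (copy Q)) (copy_iso Q) (h (copy_iso P x)))"

definition supercompact_poset :: "'a site \<Rightarrow> 'a set gorder" where
  "supercompact_poset = (\<lambda>(C, J).
     (J_ideal_frame C J)\<lparr>carrier := {I. supercompact (J_ideal_frame C J) I}\<rparr>)"

definition U_compact_poset ::
  "('a set gorder \<Rightarrow> 'a set set \<Rightarrow> bool) \<Rightarrow> 'a gorder \<Rightarrow> 'a set gorder" where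
  "U_compact_poset U D =
     (lower_set_frame D)\<lparr>carrier := {I. U_compact U (lower_set_frame D) I}\<rparr>"

text \<open>
  The topology carried by the poset of \<open>U\<close>-compact elements: the one induced by the frame
  \<open>Id(D)\<close>, whose covering sieves on \<open>u\<close> are those with join \<open>u\<close> in \<open>Id(D)\<close>.
\<close>

definition U_compact_topology ::
  "('a set gorder \<Rightarrow> 'a set set \<Rightarrow> bool) \<Rightarrow> 'a gorder \<Rightarrow> 'a set \<Rightarrow> 'a set set set" where
  "U_compact_topology U D u =
     {S. is_sieve (U_compact_poset U D) u S \<and> \<Squnion>\<^bsub>lower_set_frame D\<^esub> S = u}"

definition functor_D :: "('a site, 'a \<Rightarrow> 'a, 'a gorder, 'a \<Rightarrow> 'a) funct" where
  "functor_D =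
     \<lparr>fob = (\<lambda>C. copy (supercompact_poset C)),
      farr = (\<lambda>C' C h. copy_map (supercompact_poset C') (supercompact_poset C)
                (A_shriek (fst C) (snd C) (fst C') (snd C') h))\<rparr>"

definition functor_E ::
  "('a set gorder \<Rightarrow> 'a set set \<Rightarrow> bool) \<Rightarrow> ('a gorder, 'a \<Rightarrow> 'a, 'a site, 'a \<Rightarrow> 'a) funct" where
  "functor_E U =
     \<lparr>fob = (\<lambda>D. let P = U_compact_poset U D in
               (copy P, \<lambda>x. {S. S \<subseteq> carrier (copy P) \<and>
                                copy_iso P ` S \<in> U_compact_topology U D (copy_iso P x)})),
      farr = (\<lambda>D D' h. copy_map (U_compact_poset U D') (U_compact_poset U D)
                (inv_image_map D h))\<rparr>"

end

theory Submission
  imports Defs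
begin

text \<open>
  Let \<open>C\<close> be a poset in \<open>\<K>\<close> and \<open>D = f(C)\<close>.  The subterminal objects of \<open>Sh(C, J)\<close> are the
  \<open>J\<close>-ideals of \<open>C\<close>, those of the presheaves on \<open>D\<close> are the lower sets of \<open>D\<close>, and an equivalence
  of categories preserves them.  So the hypothesis on sheaves provides an isomorphism of frames between
  \<open>Id\<^sub>J(C)\<close> and \<open>Id(D)\<close> (\<open>isomorphic_J_ideal_frames\<close>).

  Both posets can be recovered inside this one frame by invariant properties of elements.  The
  elements of \<open>D\<close> are the supercompact elements, because every lower set is the union of the
  principal lower sets of its elements (\<open>supercompact_lower_set_iff\<close>).  The elements of \<open>C\<close> are the
  \<open>U\<close>-compact elements: as \<open>J\<close> is \<open>U\<close>-induced, a lower set of \<open>C\<close> covers one of its upper bounds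
  if and only if its principal ideals have a refinement satisfying \<open>U\<close>
  (\<open>U_compact_iff_principal\<close>).  The topology of \<open>C\<close> is recovered as well, since a sieve covers \<open>c\<close> if and
  only if its join in the frame is the principal ideal of \<open>c\<close> (\<open>cover_iff\<close>).

  The same holds for arrows.  Fix isomorphisms \<open>\<theta>\<close> and \<open>\<theta>'\<close> of this kind for \<open>(C, D)\<close> and for
  \<open>(C', D')\<close>, and call \<open>h : C' \<rightarrow> C\<close> and \<open>k : D \<rightarrow> D'\<close> mates if \<open>\<theta>\<close> and \<open>\<theta>'\<close> identify
  \<open>A(h)\<close> with \<open>k\<^sup>-\<^sup>1\<close>.  Each arrow has exactly one mate.  If \<open>A(h)\<close> preserves infima then, as it
  always preserves suprema, it corresponds to a map of lower sets preserving all unions and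
  intersections, and such a map is the inverse image along a unique monotone \<open>k\<close>
  (\<open>complete_hom_eq_inv_image\<close>); \<open>k\<^sup>-\<^sup>1\<close> preserves \<open>U\<close>-compact elements since \<open>A(h)\<close> takes the
  principal ideal of \<open>c\<close> to that of \<open>h(c)\<close>.  Conversely, if \<open>k\<^sup>-\<^sup>1\<close> preserves \<open>U\<close>-compact
  elements, then it restricts to a map \<open>h\<close> of sites, for which the filtering condition is assumed and
  preservation of covers is preservation of unions (\<open>mate_left\<close>).

  Finally the functors \<open>D\<close> and \<open>E\<close> send arrows to their mates, for suitable choices of \<open>\<theta>\<close>, and mates compose.
  That they are inverse to each other is then formal (\<open>categorical_inverses_if_mates\<close>): both sides of
  every equation to be checked have the same mate.
\<close>

section \<open>Lower sets and ideals for a topology\<close>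

lemma po_refl: "partial_order C \<Longrightarrow> x \<in> carrier C \<Longrightarrow> x \<sqsubseteq>\<^bsub>C\<^esub> x"
  by (simp add: partial_order.axioms(1) weak_partial_order.le_refl)

lemma po_trans:
  "partial_order C \<Longrightarrow> x \<sqsubseteq>\<^bsub>C\<^esub> y \<Longrightarrow> y \<sqsubseteq>\<^bsub>C\<^esub> z \<Longrightarrow> x \<in> carrier C \<Longrightarrow> y \<in> carrier C \<Longrightarrow> z \<in> carrier C
    \<Longrightarrow> x \<sqsubseteq>\<^bsub>C\<^esub> z"
  by (meson partial_order.axioms(1) weak_partial_order.le_trans)

lemma po_antisym:
  "partial_order C \<Longrightarrow> x \<sqsubseteq>\<^bsub>C\<^esub> y \<Longrightarrow> y \<sqsubseteq>\<^bsub>C\<^esub> x \<Longrightarrow> x \<in> carrier C \<Longrightarrow> y \<in> carrier C \<Longrightarrow> x = y"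
  by (rule partial_order.le_antisym)

lemma partial_order_subset_order: "partial_order \<lparr>carrier = A, eq = (=), le = (\<subseteq>)\<rparr>"
  by unfold_locales auto

lemma lower_setD: "lower_set C I \<Longrightarrow> x \<in> I \<Longrightarrow> y \<in> carrier C \<Longrightarrow> y \<sqsubseteq>\<^bsub>C\<^esub> x \<Longrightarrow> y \<in> I"
  by (auto simp: lower_set_def)

lemma lower_set_subset_carrier: "lower_set C I \<Longrightarrow> I \<subseteq> carrier C"
  by (simp add: lower_set_def)

lemma lower_set_carrierD: "lower_set C I \<Longrightarrow> x \<in> I \<Longrightarrow> x \<in> carrier C"
  by (auto simp: lower_set_def)

lemma lower_set_Union: "(\<And>A. A \<in> \<A> \<Longrightarrow> lower_set C A) \<Longrightarrow> lower_set C (\<Union>\<A>)"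
  by (fastforce simp: lower_set_def)

lemma mem_down: "x \<in> down C c \<longleftrightarrow> x \<in> carrier C \<and> x \<sqsubseteq>\<^bsub>C\<^esub> c"
  by (auto simp: down_def)

lemma self_mem_down: "partial_order C \<Longrightarrow> c \<in> carrier C \<Longrightarrow> c \<in> down C c"
  by (simp add: mem_down po_refl)

lemma lower_set_down: "partial_order C \<Longrightarrow> c \<in> carrier C \<Longrightarrow> lower_set C (down C c)"
  by (auto simp: lower_set_def mem_down intro: po_trans)

lemma down_subset_iff:
  "partial_order C \<Longrightarrow> lower_set C I \<Longrightarrow> c \<in> carrier C \<Longrightarrow> down C c \<subseteq> I \<longleftrightarrow> c \<in> I"
  by (meson lower_setD mem_down self_mem_down subset_iff)

lemma down_subset_down_iff:
  "partial_order C \<Longrightarrow> c \<in> carrier C \<Longrightarrow> d \<in> carrier C \<Longrightarrow> down C c \<subseteq> down C d \<longleftrightarrow> c \<sqsubseteq>\<^bsub>C\<^esub> d"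
  by (simp add: down_subset_iff lower_set_down mem_down)

lemma down_inject:
  "partial_order C \<Longrightarrow> c \<in> carrier C \<Longrightarrow> d \<in> carrier C \<Longrightarrow> down C c = down C d \<longleftrightarrow> c = d"
  by (metis down_subset_down_iff order_refl po_antisym)

lemma J_ideal_lower: "J_ideal C J I \<Longrightarrow> lower_set C I"
  by (simp add: J_ideal_def)

lemma J_ideal_subset_carrier: "J_ideal C J I \<Longrightarrow> I \<subseteq> carrier C"
  by (simp add: J_ideal_def lower_set_def)

lemma J_idealD: "J_ideal C J I \<Longrightarrow> c \<in> carrier C \<Longrightarrow> S \<in> J c \<Longrightarrow> S \<subseteq> I \<Longrightarrow> c \<in> I"
  by (auto simp: J_ideal_def)

lemma J_ideal_Inter:
  "(\<And>I. I \<in> \<A> \<Longrightarrow> J_ideal C J I) \<Longrightarrow> J_ideal C J (carrier C \<inter> \<Inter>\<A>)"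
  unfolding J_ideal_def lower_set_def by blast

lemma J_ideal_carrier: "J_ideal C J (carrier C)"
  by (auto simp: J_ideal_def lower_set_def)

lemma gen_J_ideal_subset_iff:
  "J_ideal C J I \<Longrightarrow> gen_J_ideal C J X \<subseteq> I \<longleftrightarrow> X \<subseteq> I"
  unfolding gen_J_ideal_def by blast

lemma gen_J_ideal_superset: "X \<subseteq> gen_J_ideal C J X"
  unfolding gen_J_ideal_def by blast

lemma J_ideal_gen: "X \<subseteq> carrier C \<Longrightarrow> J_ideal C J (gen_J_ideal C J X)"
proof -
  assume X: "X \<subseteq> carrier C"
  then have "gen_J_ideal C J X = carrier C \<inter> \<Inter>{I. J_ideal C J I \<and> X \<subseteq> I}"
    unfolding gen_J_ideal_def using J_ideal_carrier by blast
  moreover have "J_ideal C J (carrier C \<inter> \<Inter>{I. J_ideal C J I \<and> X \<subseteq> I})"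
    by (rule J_ideal_Inter) simp
  ultimately show ?thesis by simp
qed

lemma gen_J_ideal_eqI:
  assumes "X \<subseteq> carrier C" "J_ideal C J K" "\<And>I. J_ideal C J I \<Longrightarrow> X \<subseteq> I \<longleftrightarrow> K \<subseteq> I"
  shows "gen_J_ideal C J X = K"
proof (rule subset_antisym)
  show "gen_J_ideal C J X \<subseteq> K" using assms(2,3) by (simp add: gen_J_ideal_subset_iff)
  show "K \<subseteq> gen_J_ideal C J X"
    using assms(3)[OF J_ideal_gen[OF assms(1)]] gen_J_ideal_superset[of X C J] by simp
qed

lemma gen_J_ideal_ideal: "J_ideal C J I \<Longrightarrow> gen_J_ideal C J I = I"
  unfolding gen_J_ideal_def by blast

lemma J_ideal_frame_simps [simp]:
  "carrier (J_ideal_frame C J) = {I. J_ideal C J I}"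
  "le (J_ideal_frame C J) = (\<subseteq>)"
  "eq (J_ideal_frame C J) = (=)"
  by (simp_all add: J_ideal_frame_def)

lemma lower_set_frame_simps [simp]:
  "carrier (lower_set_frame D) = {V. lower_set D V}"
  "le (lower_set_frame D) = (\<subseteq>)"
  "eq (lower_set_frame D) = (=)"
  by (simp_all add: lower_set_frame_def)

lemma partial_order_J_ideal_frame: "partial_order (J_ideal_frame C J)"
  unfolding J_ideal_frame_def by (rule partial_order_subset_order)

lemma lub_J_ideal_frame:
  assumes "\<And>I. I \<in> \<A> \<Longrightarrow> J_ideal C J I"
  shows "is_lub (J_ideal_frame C J) (gen_J_ideal C J (\<Union>\<A>)) \<A>"
proof -
  have "lower_set C (\<Union>\<A>)" by (rule lower_set_Union) (rule J_ideal_lower[OF assms])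
  then have "\<Union>\<A> \<subseteq> carrier C" by (simp add: lower_set_def)
  then have "J_ideal C J (gen_J_ideal C J (\<Union>\<A>))" by (rule J_ideal_gen)
  moreover have "I \<subseteq> gen_J_ideal C J (\<Union>\<A>)" if "I \<in> \<A>" for I
    using gen_J_ideal_superset[of "\<Union>\<A>" C J] that by blast
  ultimately show ?thesis
    unfolding least_def Upper_def by (auto simp: gen_J_ideal_subset_iff Sup_le_iff assms)
qed

lemma glb_J_ideal_frame:
  assumes "\<And>I. I \<in> \<A> \<Longrightarrow> J_ideal C J I"
  shows "is_glb (J_ideal_frame C J) (carrier C \<inter> \<Inter>\<A>) \<A>"
proof -
  have "J_ideal C J (carrier C \<inter> \<Inter>\<A>)" using assms by (rule J_ideal_Inter)
  then show ?thesis
    using J_ideal_lower[of C J] lower_set_carrierD[of C]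
    by (intro greatest_LowerI) (auto simp: assms Lower_def)
qed

lemma (in partial_order) sup_eqI: "is_lub L x A \<Longrightarrow> \<Squnion>A = x"
  unfolding sup_def by (metis least_unique someI)

lemma (in partial_order) inf_eqI: "is_glb L x A \<Longrightarrow> \<Sqinter>A = x"
  unfolding inf_def by (metis greatest_unique someI)

lemma sup_J_ideal_frame:
  "\<A> \<subseteq> {I. J_ideal C J I} \<Longrightarrow> \<Squnion>\<^bsub>J_ideal_frame C J\<^esub> \<A> = gen_J_ideal C J (\<Union>\<A>)"
  by (rule partial_order.sup_eqI[OF partial_order_J_ideal_frame lub_J_ideal_frame]) auto

lemma inf_J_ideal_frame:
  "\<A> \<subseteq> {I. J_ideal C J I} \<Longrightarrow> \<Sqinter>\<^bsub>J_ideal_frame C J\<^esub> \<A> = carrier C \<inter> \<Inter>\<A>"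
  by (rule partial_order.inf_eqI[OF partial_order_J_ideal_frame glb_J_ideal_frame]) auto

lemma complete_lattice_J_ideal_frame: "complete_lattice (J_ideal_frame C J)"
proof -
  interpret partial_order "J_ideal_frame C J" by (rule partial_order_J_ideal_frame)
  show ?thesis
  proof unfold_locales
    fix A assume A: "A \<subseteq> carrier (J_ideal_frame C J)"
    show "\<exists>s. is_lub (J_ideal_frame C J) s A" by (rule exI, rule lub_J_ideal_frame) (use A in auto)
    show "\<exists>s. is_glb (J_ideal_frame C J) s A" by (rule exI, rule glb_J_ideal_frame) (use A in auto)
  qed
qed

lemma lower_set_gen_sieve:
  assumes "partial_order C" "X \<subseteq> carrier C"
  shows "lower_set C (gen_sieve C X)"
  unfolding lower_set_def gen_sieve_def
proof (safe, goal_cases)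
  case (1 x y a)
  then show ?case using assms po_trans[of C y x a] by blast
qed

lemma gen_sieve_superset: "partial_order C \<Longrightarrow> X \<subseteq> carrier C \<Longrightarrow> X \<subseteq> gen_sieve C X"
  unfolding gen_sieve_def using po_refl[of C] by blast

lemma gen_sieve_subset_iff:
  assumes "partial_order C" "X \<subseteq> carrier C" "lower_set C I"
  shows "gen_sieve C X \<subseteq> I \<longleftrightarrow> X \<subseteq> I"
  using gen_sieve_superset[OF assms(1,2)] lower_setD[OF assms(3)]
  by (auto simp: gen_sieve_def)

lemma gen_sieve_lower:
  assumes "partial_order C" "lower_set C R"
  shows "gen_sieve C R = R"
  using gen_sieve_superset[of C R] gen_sieve_subset_iff[of C R R] assms
  by (simp add: lower_set_def subset_antisym)

lemma gen_J_ideal_gen_sieve: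
  assumes "partial_order C" "X \<subseteq> carrier C"
  shows "gen_J_ideal C J (gen_sieve C X) = gen_J_ideal C J X"
proof (rule gen_J_ideal_eqI)
  show "gen_sieve C X \<subseteq> carrier C" by (auto simp: gen_sieve_def)
  show "J_ideal C J (gen_J_ideal C J X)" using assms(2) by (rule J_ideal_gen)
  fix I assume I: "J_ideal C J I"
  show "gen_sieve C X \<subseteq> I \<longleftrightarrow> gen_J_ideal C J X \<subseteq> I"
    by (simp add: gen_sieve_subset_iff[OF assms J_ideal_lower[OF I]] gen_J_ideal_subset_iff[OF I])
qed

locale site =
  fixes C :: "'a gorder" and J :: "'a \<Rightarrow> 'a set set"
  assumes po: "partial_order C" and topology: "grothendieck_topology C J"
begin

lemma cover_sieve: "c \<in> carrier C \<Longrightarrow> S \<in> J c \<Longrightarrow> lower_set C S \<and> S \<subseteq> down C c"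
  using topology by (simp add: grothendieck_topology_def is_sieve_def)

lemma cover_stable: "c \<in> carrier C \<Longrightarrow> S \<in> J c \<Longrightarrow> d \<in> carrier C \<Longrightarrow> d \<sqsubseteq>\<^bsub>C\<^esub> c \<Longrightarrow> S \<inter> down C d \<in> J d"
  using topology by (simp add: grothendieck_topology_def mem_down)

lemma cover_local:
  assumes "c \<in> carrier C" "S \<in> J c" "lower_set C R" "R \<subseteq> down C c"
    and "\<And>d. d \<in> S \<Longrightarrow> R \<inter> down C d \<in> J d"
  shows "R \<in> J c"
proof -
  have "\<forall>c\<in>carrier C. \<forall>S\<in>J c. \<forall>R. is_sieve C c R \<and> (\<forall>d\<in>S. R \<inter> down C d \<in> J d) \<longrightarrow> R \<in> J c"
    using topology unfolding grothendieck_topology_def by (elim conjE)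
  from this[rule_format, OF assms(1,2)] show ?thesis using assms(3-5) by (simp add: is_sieve_def)
qed

lemma cover_maximal: "c \<in> carrier C \<Longrightarrow> down C c \<in> J c"
  using topology by (simp add: grothendieck_topology_def)

text \<open>Stability and local character of a topology say exactly that the elements covered by a fixed
  lower set form an ideal, so closing under covers takes a single step.\<close>

lemma mem_gen_J_ideal_iff:
  assumes R: "lower_set C R" and c: "c \<in> carrier C"
  shows "c \<in> gen_J_ideal C J R \<longleftrightarrow> R \<inter> down C c \<in> J c"
proof
  define K where "K = {c \<in> carrier C. R \<inter> down C c \<in> J c}"
  have low: "lower_set C K"
    unfolding lower_set_def
  proof (intro conjI ballI impI)
    fix x y assume xy: "x \<in> K" "y \<in> carrier C" "y \<sqsubseteq>\<^bsub>C\<^esub> x"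
    then have "R \<inter> down C x \<inter> down C y \<in> J y" using cover_stable by (auto simp: K_def)
    moreover have "R \<inter> down C x \<inter> down C y = R \<inter> down C y"
      using xy by (auto simp: mem_down K_def intro: po_trans[OF po])
    ultimately show "y \<in> K" using xy by (simp add: K_def)
  qed (auto simp: K_def)
  have "J_ideal C J K"
    unfolding J_ideal_def
  proof (intro conjI ballI impI low)
    fix x S assume x: "x \<in> carrier C" "S \<in> J x" "S \<subseteq> K"
    have "R \<inter> down C x \<in> J x"
    proof (rule cover_local[OF x(1,2)])
      show "lower_set C (R \<inter> down C x)"
        using R lower_set_down[OF po x(1)] by (auto simp: lower_set_def)
      fix d assume d: "d \<in> S"
      then have dK: "d \<in> K" "d \<in> down C x" using x cover_sieve by auto
      moreover have "R \<inter> down C x \<inter> down C d = R \<inter> down C d"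
        using dK x by (auto simp: mem_down intro: po_trans[OF po])
      ultimately show "R \<inter> down C x \<inter> down C d \<in> J d" by (simp add: K_def)
    qed auto
    then show "x \<in> K" using x by (simp add: K_def)
  qed
  moreover have "R \<subseteq> K"
  proof
    fix x assume x: "x \<in> R"
    then have "R \<inter> down C x = down C x" using R by (auto simp: mem_down lower_set_def)
    then show "x \<in> K" using x R by (auto simp: K_def cover_maximal lower_set_def)
  qed
  ultimately have "gen_J_ideal C J R \<subseteq> K" by (simp add: gen_J_ideal_subset_iff)
  then show "c \<in> gen_J_ideal C J R \<Longrightarrow> R \<inter> down C c \<in> J c" by (auto simp: K_def)
next
  assume "R \<inter> down C c \<in> J c"
  moreover have "R \<inter> down C c \<subseteq> gen_J_ideal C J R" using gen_J_ideal_superset[of R] by blast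
  moreover have "J_ideal C J (gen_J_ideal C J R)" using R by (simp add: J_ideal_gen lower_set_def)
  ultimately show "c \<in> gen_J_ideal C J R" using J_idealD[OF _ c] by blast
qed

text \<open>Distributivity is stability of covers in disguise: for \<open>c\<close> in the ideal \<open>I\<close>, the elements of
  \<open>\<Union>\<A>\<close> below \<open>c\<close> lie in \<open>I\<close>, so that \<open>\<A>\<close> covers \<open>c\<close> if and only if its
  trace on \<open>I\<close> does.\<close>

lemma is_frame_J_ideal_frame: "is_frame (J_ideal_frame C J)"
  unfolding is_frame_def
proof (intro conjI ballI allI impI complete_lattice_J_ideal_frame)
  fix I \<A> assume IA: "I \<in> carrier (J_ideal_frame C J)" "\<A> \<subseteq> carrier (J_ideal_frame C J)"
  have I: "J_ideal C J I" using IA by simp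
  have A: "J_ideal C J K" if "K \<in> \<A>" for K using IA that by auto
  have lowI: "lower_set C I" using I by (rule J_ideal_lower)
  have subI: "I \<subseteq> carrier C" using lowI by (simp add: lower_set_def)
  have glb: "carrier C \<inter> \<Inter>{I, K} = I \<inter> K" for K using subI by auto
  have meet_in: "J_ideal C J (I \<inter> K)" if "J_ideal C J K" for K
    using J_ideal_Inter[of "{I, K}" C J] I that by (simp only: glb) auto
  have meet: "I \<sqinter>\<^bsub>J_ideal_frame C J\<^esub> K = I \<inter> K" if "J_ideal C J K" for K
    unfolding meet_def using inf_J_ideal_frame[of "{I, K}" C J] I that by (simp only: glb) auto
  have lowA: "lower_set C (\<Union>\<A>)" by (rule lower_set_Union) (rule J_ideal_lower[OF A])
  have lowIA: "lower_set C (I \<inter> \<Union>\<A>)"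
    using lowI lowA unfolding lower_set_def by blast
  have genA: "J_ideal C J (gen_J_ideal C J (\<Union>\<A>))"
    using lowA by (simp add: J_ideal_gen lower_set_def)
  have "I \<inter> gen_J_ideal C J (\<Union>\<A>) = gen_J_ideal C J (I \<inter> \<Union>\<A>)"
  proof (rule Set.set_eqI)
    fix c
    show "c \<in> I \<inter> gen_J_ideal C J (\<Union>\<A>) \<longleftrightarrow> c \<in> gen_J_ideal C J (I \<inter> \<Union>\<A>)"
    proof (cases "c \<in> I")
      case True
      then have c: "c \<in> carrier C" using subI by blast
      have "down C c \<subseteq> I" using True down_subset_iff[OF po lowI c] by simp
      then have "I \<inter> \<Union>\<A> \<inter> down C c = \<Union>\<A> \<inter> down C c" by blast
      then show ?thesis
        using True mem_gen_J_ideal_iff[OF lowA c] mem_gen_J_ideal_iff[OF lowIA c] by simp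
    next
      case False
      have "gen_J_ideal C J (I \<inter> \<Union>\<A>) \<subseteq> I" using I by (simp add: gen_J_ideal_subset_iff)
      then show ?thesis using False by blast
    qed
  qed
  moreover have image: "(\<lambda>a. I \<sqinter>\<^bsub>J_ideal_frame C J\<^esub> a) ` \<A> = (\<lambda>a. I \<inter> a) ` \<A>"
    by (rule image_cong[OF refl]) (rule meet[OF A])
  moreover have "\<Squnion>\<^bsub>J_ideal_frame C J\<^esub> ((\<lambda>a. I \<inter> a) ` \<A>) = gen_J_ideal C J (I \<inter> \<Union>\<A>)"
    by (subst sup_J_ideal_frame) (auto simp: meet_in A Int_UN_distrib)
  moreover have "\<Squnion>\<^bsub>J_ideal_frame C J\<^esub> \<A> = gen_J_ideal C J (\<Union>\<A>)"
    by (rule sup_J_ideal_frame) (auto simp: A)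
  ultimately show "I \<sqinter>\<^bsub>J_ideal_frame C J\<^esub> \<Squnion>\<^bsub>J_ideal_frame C J\<^esub> \<A> =
      \<Squnion>\<^bsub>J_ideal_frame C J\<^esub> ((\<lambda>a. I \<sqinter>\<^bsub>J_ideal_frame C J\<^esub> a) ` \<A>)"
    using meet[OF genA] by simp
qed

end

locale subcanonical_site = site +
  assumes subcanonical: "subcanonical C J"
begin

lemma J_ideal_down:
  assumes c: "c \<in> carrier C"
  shows "J_ideal C J (down C c)"
  unfolding J_ideal_def
proof (intro conjI ballI impI lower_set_down[OF po c])
  fix d S assume d: "d \<in> carrier C" "S \<in> J d" "S \<subseteq> down C c"
  then have "is_lub C d S" using subcanonical by (simp add: subcanonical_def)
  moreover have "c \<in> Upper C S" using d c by (auto simp: Upper_def mem_down)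
  ultimately show "d \<in> down C c" using d by (auto simp: least_def mem_down)
qed

lemma gen_J_ideal_singleton: "c \<in> carrier C \<Longrightarrow> gen_J_ideal C J {c} = down C c"
  by (rule gen_J_ideal_eqI) (auto simp: J_ideal_down down_subset_iff[OF po] J_ideal_lower)

lemma gen_J_ideal_down_image:
  assumes "X \<subseteq> carrier C"
  shows "gen_J_ideal C J (\<Union>(down C ` X)) = gen_J_ideal C J X"
proof (rule gen_J_ideal_eqI)
  show "\<Union>(down C ` X) \<subseteq> carrier C" by (auto simp: mem_down)
  show "J_ideal C J (gen_J_ideal C J X)" using assms by (rule J_ideal_gen)
  fix I assume I: "J_ideal C J I"
  show "\<Union>(down C ` X) \<subseteq> I \<longleftrightarrow> gen_J_ideal C J X \<subseteq> I"
    using assms down_subset_iff[OF po J_ideal_lower[OF I]]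
    by (simp add: gen_J_ideal_subset_iff[OF I] UN_subset_iff) blast
qed

lemma sup_down_image:
  "X \<subseteq> carrier C \<Longrightarrow> \<Squnion>\<^bsub>J_ideal_frame C J\<^esub> (down C ` X) = gen_J_ideal C J X"
  by (subst sup_J_ideal_frame) (auto simp: J_ideal_down gen_J_ideal_down_image)

lemma gen_cover:
  assumes "c \<in> carrier C" "S \<in> J c"
  shows "gen_J_ideal C J S = down C c"
proof -
  have S: "lower_set C S" "S \<subseteq> down C c" using cover_sieve assms by auto
  then have "c \<in> gen_J_ideal C J S" using assms by (simp add: mem_gen_J_ideal_iff Int_absorb2)
  moreover have "J_ideal C J (gen_J_ideal C J S)" using S by (simp add: J_ideal_gen lower_set_def)
  ultimately have "down C c \<subseteq> gen_J_ideal C J S"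
    using down_subset_iff[OF po J_ideal_lower] assms(1) by blast
  then show ?thesis using S assms by (simp add: gen_J_ideal_subset_iff J_ideal_down subset_antisym)
qed

text \<open>The topology can thus be read off from the embedding of the site into its frame of ideals.\<close>

lemma cover_iff:
  assumes "c \<in> carrier C" "lower_set C S"
  shows "S \<in> J c \<longleftrightarrow> gen_J_ideal C J S = down C c"
proof
  assume "gen_J_ideal C J S = down C c"
  then have "S \<subseteq> down C c" "c \<in> gen_J_ideal C J S"
    using gen_J_ideal_superset[of S C J] self_mem_down[OF po] assms by auto
  then show "S \<in> J c" using assms by (simp add: mem_gen_J_ideal_iff Int_absorb2)
qed (simp add: assms gen_cover)

end

text \<open>Lower sets are the ideals of the trivial topology; what is proved about ideals therefore
  specialises to them.\<close>

definition trivial_topology :: "'a gorder \<Rightarrow> 'a \<Rightarrow> 'a set set" where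
  "trivial_topology D d = {down D d}"

lemma trivial_site: "partial_order D \<Longrightarrow> subcanonical_site D (trivial_topology D)"
proof (intro subcanonical_site.intro site.intro subcanonical_site_axioms.intro)
  assume po: "partial_order D"
  show "grothendieck_topology D (trivial_topology D)"
    unfolding grothendieck_topology_def is_sieve_def trivial_topology_def
  proof (intro conjI ballI allI impI)
    fix c S d assume "c \<in> carrier D" "S \<in> {down D c}" "d \<in> down D c"
    then show "S \<inter> down D d \<in> {down D d}" by (auto simp: mem_down intro: po_trans[OF po])
  next
    fix c S R
    assume c: "c \<in> carrier D" "S \<in> {down D c}"
      and R: "(lower_set D R \<and> R \<subseteq> down D c) \<and> (\<forall>d\<in>S. R \<inter> down D d \<in> {down D d})"
    then have "R \<inter> down D c = down D c" using self_mem_down[OF po] by auto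
    then show "R \<in> {down D c}" using R by auto
  qed (auto simp: lower_set_down[OF po])
  show "subcanonical D (trivial_topology D)"
    unfolding subcanonical_def trivial_topology_def least_def Upper_def
    by (auto simp: mem_down po_refl[OF po])
qed

lemma J_ideal_trivial: "partial_order D \<Longrightarrow> J_ideal D (trivial_topology D) = lower_set D"
  by (auto simp: fun_eq_iff J_ideal_def trivial_topology_def dest: self_mem_down)

lemma lower_set_frame_eq:
  "partial_order D \<Longrightarrow> lower_set_frame D = J_ideal_frame D (trivial_topology D)"
  by (simp add: lower_set_frame_def J_ideal_frame_def J_ideal_trivial)

lemma partial_order_lower_set_frame: "partial_order (lower_set_frame D)"
  unfolding lower_set_frame_def by (rule partial_order_subset_order)

lemma is_frame_lower_set_frame: "partial_order D \<Longrightarrow> is_frame (lower_set_frame D)"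
  using site.is_frame_J_ideal_frame[OF subcanonical_site.axioms(1)[OF trivial_site]]
  by (simp add: lower_set_frame_eq)

lemma sup_lower_set_frame:
  assumes "\<A> \<subseteq> {V. lower_set D V}"
  shows "\<Squnion>\<^bsub>lower_set_frame D\<^esub> \<A> = \<Union>\<A>"
proof (rule partial_order.sup_eqI[OF partial_order_lower_set_frame])
  have "lower_set D (\<Union>\<A>)" using assms by (auto intro!: lower_set_Union)
  then show "is_lub (lower_set_frame D) (\<Union>\<A>) \<A>" using assms by (auto simp: least_def Upper_def)
qed

lemma inf_lower_set_frame:
  assumes "partial_order D" "\<A> \<subseteq> {V. lower_set D V}"
  shows "\<Sqinter>\<^bsub>lower_set_frame D\<^esub> \<A> = carrier D \<inter> \<Inter>\<A>"
  using assms by (simp add: lower_set_frame_eq inf_J_ideal_frame J_ideal_trivial)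

lemma lower_set_eq_Union_down:
  assumes "partial_order D" "lower_set D V"
  shows "V = \<Union>(down D ` V)"
proof
  show "V \<subseteq> \<Union>(down D ` V)"
    using self_mem_down[OF assms(1) lower_set_carrierD[OF assms(2)]] by blast
  show "\<Union>(down D ` V) \<subseteq> V"
    using down_subset_iff[OF assms lower_set_carrierD[OF assms(2)]] by (simp add: UN_subset_iff)
qed

text \<open>Every lower set is the union of the principal lower sets of its elements, so a supercompact one is
  among them; and a union that contains \<open>d\<close> has a member that contains \<open>down D d\<close>.\<close>

lemma supercompact_lower_set_iff:
  assumes po: "partial_order D"
  shows "supercompact (lower_set_frame D) V \<longleftrightarrow> (\<exists>d\<in>carrier D. V = down D d)"
proof
  assume V: "supercompact (lower_set_frame D) V"
  then have low: "lower_set D V" by (simp add: supercompact_def)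
  then have sub: "down D ` V \<subseteq> {V. lower_set D V}"
    using lower_set_down[OF po] lower_set_carrierD[OF low] by blast
  then have "\<Squnion>\<^bsub>lower_set_frame D\<^esub> (down D ` V) = V"
    using lower_set_eq_Union_down[OF po low] by (simp add: sup_lower_set_frame)
  then have "V \<in> down D ` V" using V sub by (simp add: supercompact_def)
  then show "\<exists>d\<in>carrier D. V = down D d" using low by (auto simp: lower_set_def)
next
  assume "\<exists>d\<in>carrier D. V = down D d"
  then obtain d where d: "d \<in> carrier D" "V = down D d" by blast
  show "supercompact (lower_set_frame D) V"
    unfolding supercompact_def
  proof (intro conjI allI impI)
    show "V \<in> carrier (lower_set_frame D)" using d lower_set_down[OF po] by simp
    fix \<A> assume A: "\<A> \<subseteq> carrier (lower_set_frame D)" "\<Squnion>\<^bsub>lower_set_frame D\<^esub> \<A> = V"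
    then have U: "\<Union>\<A> = V" by (simp add: sup_lower_set_frame)
    then obtain W where W: "W \<in> \<A>" "d \<in> W" using d self_mem_down[OF po] by blast
    moreover have "lower_set D W" using A W by auto
    ultimately have "down D d \<subseteq> W" using d(1) by (simp add: down_subset_iff[OF po])
    then show "V \<in> \<A>" using W U d by (metis Union_upper subset_antisym)
  qed
qed

section \<open>Isomorphisms of posets\<close>

lemma poset_isoI:
  assumes "partial_order P" "partial_order Q" "\<phi> ` carrier P = carrier Q"
    and "\<And>x y. x \<in> carrier P \<Longrightarrow> y \<in> carrier P \<Longrightarrow> x \<sqsubseteq>\<^bsub>P\<^esub> y \<longleftrightarrow> \<phi> x \<sqsubseteq>\<^bsub>Q\<^esub> \<phi> y"
  shows "poset_iso P Q \<phi>"
proof -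
  have "inj_on \<phi> (carrier P)"
  proof (rule inj_onI)
    fix x y assume xy: "x \<in> carrier P" "y \<in> carrier P" "\<phi> x = \<phi> y"
    moreover have "\<phi> x \<in> carrier Q" "\<phi> y \<in> carrier Q" using xy assms(3) by auto
    ultimately have "x \<sqsubseteq>\<^bsub>P\<^esub> y" "y \<sqsubseteq>\<^bsub>P\<^esub> x" using po_refl[OF assms(2)] assms(4) by metis+
    then show "x = y" using xy po_antisym[OF assms(1)] by blast
  qed
  then show ?thesis using assms by (simp add: poset_iso_def bij_betw_def)
qed

lemma poset_iso_po: "poset_iso P Q \<phi> \<Longrightarrow> partial_order P \<and> partial_order Q"
  by (simp add: poset_iso_def)

lemma poset_iso_image: "poset_iso P Q \<phi> \<Longrightarrow> \<phi> ` carrier P = carrier Q"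
  by (simp add: poset_iso_def bij_betw_def)

lemma poset_iso_closed: "poset_iso P Q \<phi> \<Longrightarrow> x \<in> carrier P \<Longrightarrow> \<phi> x \<in> carrier Q"
  using poset_iso_image by blast

lemma poset_iso_surj: "poset_iso P Q \<phi> \<Longrightarrow> y \<in> carrier Q \<Longrightarrow> \<exists>x\<in>carrier P. y = \<phi> x"
  using poset_iso_image by blast

lemma poset_iso_inj: "poset_iso P Q \<phi> \<Longrightarrow> inj_on \<phi> (carrier P)"
  by (simp add: poset_iso_def bij_betw_def)

lemma poset_iso_eq_iff:
  "poset_iso P Q \<phi> \<Longrightarrow> x \<in> carrier P \<Longrightarrow> y \<in> carrier P \<Longrightarrow> \<phi> x = \<phi> y \<longleftrightarrow> x = y"
  using poset_iso_inj inj_on_eq_iff by metis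

lemma poset_iso_le_iff:
  "poset_iso P Q \<phi> \<Longrightarrow> x \<in> carrier P \<Longrightarrow> y \<in> carrier P \<Longrightarrow> \<phi> x \<sqsubseteq>\<^bsub>Q\<^esub> \<phi> y \<longleftrightarrow> x \<sqsubseteq>\<^bsub>P\<^esub> y"
  by (simp add: poset_iso_def)

lemma poset_iso_image_mem_iff:
  assumes "poset_iso P Q \<phi>" "S \<subseteq> carrier P" "x \<in> carrier P"
  shows "\<phi> x \<in> \<phi> ` S \<longleftrightarrow> x \<in> S"
  using assms by (simp add: inj_on_image_mem_iff[OF poset_iso_inj])

lemma poset_iso_image_subset_iff:
  assumes "poset_iso P Q \<phi>" "S \<subseteq> carrier P" "T \<subseteq> carrier P"
  shows "\<phi> ` S \<subseteq> \<phi> ` T \<longleftrightarrow> S \<subseteq> T"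
  using poset_iso_image_mem_iff[OF assms(1,3)] assms(2) by (fastforce simp: subset_iff)

lemma poset_iso_inv_into:
  assumes "poset_iso P Q \<phi>"
  shows "poset_iso Q P (inv_into (carrier P) \<phi>)"
proof (rule poset_isoI)
  show "inv_into (carrier P) \<phi> ` carrier Q = carrier P"
    using bij_betw_inv_into[of \<phi> "carrier P" "carrier Q"] assms
    by (simp add: poset_iso_def bij_betw_def)
  fix x y assume "x \<in> carrier Q" "y \<in> carrier Q"
  then obtain a b where "x = \<phi> a" "y = \<phi> b" "a \<in> carrier P" "b \<in> carrier P"
    using poset_iso_surj[OF assms] by metis
  then show "x \<sqsubseteq>\<^bsub>Q\<^esub> y \<longleftrightarrow> inv_into (carrier P) \<phi> x \<sqsubseteq>\<^bsub>P\<^esub> inv_into (carrier P) \<phi> y"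
    using poset_iso_le_iff[OF assms] poset_iso_inj[OF assms] by simp
qed (use poset_iso_po[OF assms] in auto)

lemma poset_iso_trans:
  assumes "poset_iso P Q \<phi>" "poset_iso Q R \<psi>"
  shows "poset_iso P R (\<lambda>x. \<psi> (\<phi> x))"
proof (rule poset_isoI)
  show "(\<lambda>x. \<psi> (\<phi> x)) ` carrier P = carrier R"
    using poset_iso_image[OF assms(1)] poset_iso_image[OF assms(2)] by (metis image_image)
  fix x y assume "x \<in> carrier P" "y \<in> carrier P"
  then show "x \<sqsubseteq>\<^bsub>P\<^esub> y \<longleftrightarrow> \<psi> (\<phi> x) \<sqsubseteq>\<^bsub>R\<^esub> \<psi> (\<phi> y)"
    using poset_iso_le_iff[OF assms(1)] poset_iso_le_iff[OF assms(2)] poset_iso_closed[OF assms(1)]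
    by simp
qed (use poset_iso_po[OF assms(1)] poset_iso_po[OF assms(2)] in auto)

lemma isomorphic_posetsI: "poset_iso P Q \<phi> \<Longrightarrow> isomorphic_posets P Q"
  unfolding isomorphic_posets_def by blast

lemma isomorphic_posets_sym: "isomorphic_posets P Q \<Longrightarrow> isomorphic_posets Q P"
  unfolding isomorphic_posets_def using poset_iso_inv_into by blast

lemma isomorphic_posets_trans:
  "isomorphic_posets P Q \<Longrightarrow> isomorphic_posets Q R \<Longrightarrow> isomorphic_posets P R"
  unfolding isomorphic_posets_def using poset_iso_trans by blast

lemma complete_lattice_sup_closed:
  assumes "complete_lattice L" "A \<subseteq> carrier L"
  shows "\<Squnion>\<^bsub>L\<^esub> A \<in> carrier L"
proof -
  interpret complete_lattice L by (rule assms(1))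
  show ?thesis using assms(2) by (rule sup_closed)
qed

lemma poset_iso_lub:
  assumes iso: "poset_iso L M \<phi>" and A: "A \<subseteq> carrier L" and lub: "is_lub L x A"
  shows "is_lub M (\<phi> x) (\<phi> ` A)"
proof (rule least_UpperI)
  have x: "x \<in> carrier L" using lub by (auto simp: least_def Upper_def)
  show "\<phi> x \<in> carrier M" using x by (rule poset_iso_closed[OF iso])
  show "\<phi> ` A \<subseteq> carrier M" using A poset_iso_closed[OF iso] by blast
  fix y assume "y \<in> \<phi> ` A"
  then obtain a where "y = \<phi> a" "a \<in> A" by blast
  then show "y \<sqsubseteq>\<^bsub>M\<^esub> \<phi> x"
    using x lub A poset_iso_le_iff[OF iso, of a x] by (auto simp: least_def Upper_def)
next
  have x: "x \<in> carrier L" using lub by (auto simp: least_def Upper_def)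
  fix y assume y: "y \<in> Upper M (\<phi> ` A)"
  then obtain z where z: "y = \<phi> z" "z \<in> carrier L"
    using poset_iso_surj[OF iso, of y] by (auto simp: Upper_def)
  have "a \<sqsubseteq>\<^bsub>L\<^esub> z" if "a \<in> A" for a
    using y z that A poset_iso_le_iff[OF iso, of a z] poset_iso_closed[OF iso, of a] by (auto simp: Upper_def)
  then have "x \<sqsubseteq>\<^bsub>L\<^esub> z" using lub z by (auto simp: least_def Upper_def)
  then show "\<phi> x \<sqsubseteq>\<^bsub>M\<^esub> y" using x z poset_iso_le_iff[OF iso] by simp
qed

lemma poset_iso_glb:
  assumes iso: "poset_iso L M \<phi>" and A: "A \<subseteq> carrier L" and glb: "is_glb L x A"
  shows "is_glb M (\<phi> x) (\<phi> ` A)"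
proof -
  have "poset_iso (inv_gorder L) (inv_gorder M) \<phi>"
    using iso by (simp add: poset_iso_def partial_order.dual_order)
  from poset_iso_lub[OF this, of A x] A glb show ?thesis by simp
qed

lemma poset_iso_sup:
  assumes iso: "poset_iso L M \<phi>" and L: "complete_lattice L" and A: "A \<subseteq> carrier L"
  shows "\<phi> (\<Squnion>\<^bsub>L\<^esub> A) = \<Squnion>\<^bsub>M\<^esub> (\<phi> ` A)"
proof -
  obtain x where x: "is_lub L x A" using complete_lattice.sup_exists[OF L A] by blast
  have "\<Squnion>\<^bsub>L\<^esub> A = x" by (rule partial_order.sup_eqI[OF conjunct1[OF poset_iso_po[OF iso]] x])
  moreover have "\<Squnion>\<^bsub>M\<^esub> (\<phi> ` A) = \<phi> x"
    by (rule partial_order.sup_eqI[OF conjunct2[OF poset_iso_po[OF iso]] poset_iso_lub[OF iso A x]])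
  ultimately show ?thesis by simp
qed

lemma poset_iso_inf:
  assumes iso: "poset_iso L M \<phi>" and L: "complete_lattice L" and A: "A \<subseteq> carrier L"
  shows "\<phi> (\<Sqinter>\<^bsub>L\<^esub> A) = \<Sqinter>\<^bsub>M\<^esub> (\<phi> ` A)"
proof -
  obtain x where x: "is_glb L x A" using complete_lattice.inf_exists[OF L A] by blast
  have "\<Sqinter>\<^bsub>L\<^esub> A = x" by (rule partial_order.inf_eqI[OF conjunct1[OF poset_iso_po[OF iso]] x])
  moreover have "\<Sqinter>\<^bsub>M\<^esub> (\<phi> ` A) = \<phi> x"
    by (rule partial_order.inf_eqI[OF conjunct2[OF poset_iso_po[OF iso]] poset_iso_glb[OF iso A x]])
  ultimately show ?thesis by simp
qed

lemma poset_iso_subset_image: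
  assumes iso: "poset_iso P Q \<phi>" and B: "B \<subseteq> carrier Q"
  obtains A where "A \<subseteq> carrier P" "B = \<phi> ` A"
  using B poset_iso_image[OF iso] by (metis subset_imageE)

lemma supercompact_iso:
  assumes iso: "poset_iso L M \<phi>" and L: "complete_lattice L" and l: "supercompact L l"
  shows "supercompact M (\<phi> l)"
  unfolding supercompact_def
proof (intro conjI allI impI)
  have lc: "l \<in> carrier L" using l by (simp add: supercompact_def)
  show "\<phi> l \<in> carrier M" using lc by (rule poset_iso_closed[OF iso])
  fix B assume B: "B \<subseteq> carrier M" "\<Squnion>\<^bsub>M\<^esub> B = \<phi> l"
  obtain A where A: "A \<subseteq> carrier L" "B = \<phi> ` A" using poset_iso_subset_image[OF iso B(1)] .
  then have "\<Squnion>\<^bsub>L\<^esub> A = l"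
    using B poset_iso_sup[OF iso L A(1)] poset_iso_eq_iff[OF iso complete_lattice_sup_closed[OF L A(1)] lc]
    by simp
  then show "\<phi> l \<in> B" using l A by (simp add: supercompact_def)
qed

lemma poset_iso_Collect_image:
  assumes iso: "poset_iso L M \<phi>" and Q: "\<And>v. Q v \<Longrightarrow> v \<in> carrier M"
    and to: "\<And>u. P u \<Longrightarrow> Q (\<phi> u)" and inverse: "\<And>v. Q v \<Longrightarrow> P (inv_into (carrier L) \<phi> v)"
  shows "{v. Q v} = \<phi> ` {u. P u}"
proof
  show "\<phi> ` {u. P u} \<subseteq> {v. Q v}" using to by blast
  show "{v. Q v} \<subseteq> \<phi> ` {u. P u}"
  proof
    fix v assume "v \<in> {v. Q v}"
    then have "P (inv_into (carrier L) \<phi> v)" "\<phi> (inv_into (carrier L) \<phi> v) = v"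
      using inverse Q poset_iso_image[OF iso] by (simp_all add: f_inv_into_f)
    then show "v \<in> \<phi> ` {u. P u}" by force
  qed
qed

lemma supercompact_image:
  assumes iso: "poset_iso L M \<phi>" and "complete_lattice L" "complete_lattice M"
  shows "{v. supercompact M v} = \<phi> ` {u. supercompact L u}"
  by (rule poset_iso_Collect_image[OF iso])
     (simp add: supercompact_def, erule supercompact_iso[OF assms(1,2)],
      erule supercompact_iso[OF poset_iso_inv_into[OF iso] assms(3)])

lemma U_compact_iso:
  assumes U: "invariant_of_families U" and LM: "is_frame L" "is_frame M"
    and iso: "poset_iso L M \<phi>" and l: "U_compact U L l"
  shows "U_compact U M (\<phi> l)"
  unfolding U_compact_def
proof (intro conjI allI impI)
  have lc: "l \<in> carrier L" using l by (simp add: U_compact_def)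
  have L: "complete_lattice L" using LM by (simp add: is_frame_def)
  show "\<phi> l \<in> carrier M" using lc by (rule poset_iso_closed[OF iso])
  fix B assume B: "B \<subseteq> carrier M" "\<Squnion>\<^bsub>M\<^esub> B = \<phi> l"
  obtain A where A: "A \<subseteq> carrier L" "B = \<phi> ` A" using poset_iso_subset_image[OF iso B(1)] .
  have "\<Squnion>\<^bsub>L\<^esub> A \<in> carrier L" using complete_lattice_sup_closed[OF L A(1)] .
  then have "\<Squnion>\<^bsub>L\<^esub> A = l"
    using B A poset_iso_sup[OF iso L A(1)] poset_iso_eq_iff[OF iso _ lc] by simp
  then obtain R where R: "refines L R A" "U L R" using l A by (auto simp: U_compact_def)
  have Rc: "R \<subseteq> carrier L" using R by (simp add: refines_def)
  have "refines M (\<phi> ` R) B"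
    unfolding refines_def
  proof (intro conjI ballI)
    show "\<phi> ` R \<subseteq> carrier M" using Rc poset_iso_closed[OF iso] by blast
    show "\<Squnion>\<^bsub>M\<^esub> (\<phi> ` R) = \<Squnion>\<^bsub>M\<^esub> B"
      using R A poset_iso_sup[OF iso L Rc] poset_iso_sup[OF iso L A(1)] by (simp add: refines_def)
    fix b assume "b \<in> \<phi> ` R"
    then obtain r where r: "b = \<phi> r" "r \<in> R" by blast
    then obtain a where a: "a \<in> A" "r \<sqsubseteq>\<^bsub>L\<^esub> a" using R by (auto simp: refines_def)
    then have "\<phi> r \<sqsubseteq>\<^bsub>M\<^esub> \<phi> a" using r Rc A poset_iso_le_iff[OF iso, of r a] by auto
    then show "\<exists>a\<in>B. b \<sqsubseteq>\<^bsub>M\<^esub> a" using r a A by blast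
  qed
  moreover have "U M (\<phi> ` R)" using U R LM iso Rc by (simp add: invariant_of_families_def)
  ultimately show "\<exists>R. refines M R B \<and> U M R" by blast
qed

lemma U_compact_image:
  assumes U: "invariant_of_families U" and LM: "is_frame L" "is_frame M" and iso: "poset_iso L M \<phi>"
  shows "{v. U_compact U M v} = \<phi> ` {u. U_compact U L u}"
proof (rule poset_iso_Collect_image[OF iso])
  show "v \<in> carrier M" if "U_compact U M v" for v using that by (simp add: U_compact_def)
qed (erule U_compact_iso[OF U LM iso], erule U_compact_iso[OF U LM(2,1) poset_iso_inv_into[OF iso]])

lemma inv_image_lower_set:
  "isotone D D' h \<Longrightarrow> h \<in> carrier D \<rightarrow> carrier D' \<Longrightarrow> lower_set D' V \<Longrightarrow> lower_set D (inv_image_map D h V)"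
  unfolding isotone_def lower_set_def inv_image_map_def by blast

lemma poset_iso_image_down:
  assumes iso: "poset_iso P Q \<phi>" and x: "x \<in> carrier P"
  shows "\<phi> ` down P x = down Q (\<phi> x)"
proof
  show "\<phi> ` down P x \<subseteq> down Q (\<phi> x)"
    using poset_iso_closed[OF iso] poset_iso_le_iff[OF iso] x by (auto simp: mem_down)
  show "down Q (\<phi> x) \<subseteq> \<phi> ` down P x"
  proof
    fix y assume y: "y \<in> down Q (\<phi> x)"
    then obtain z where "y = \<phi> z" "z \<in> carrier P"
      using poset_iso_surj[OF iso, of y] by (auto simp: mem_down)
    then show "y \<in> \<phi> ` down P x" using y x poset_iso_le_iff[OF iso] by (auto simp: mem_down)
  qed
qed

lemma poset_iso_lower_set_image_iff:
  assumes iso: "poset_iso P Q \<phi>" and S: "S \<subseteq> carrier P"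
  shows "lower_set Q (\<phi> ` S) \<longleftrightarrow> lower_set P S"
proof
  assume low: "lower_set Q (\<phi> ` S)"
  show "lower_set P S"
    unfolding lower_set_def
  proof (intro conjI ballI impI S)
    fix x y assume xy: "x \<in> S" "y \<in> carrier P" "y \<sqsubseteq>\<^bsub>P\<^esub> x"
    then have "\<phi> y \<in> \<phi> ` S"
      using S lower_setD[OF low, of "\<phi> x" "\<phi> y"] poset_iso_closed[OF iso] poset_iso_le_iff[OF iso, of y x] by blast
    then show "y \<in> S" using S xy poset_iso_image_mem_iff[OF iso] by simp
  qed
next
  assume low: "lower_set P S"
  show "lower_set Q (\<phi> ` S)"
    unfolding lower_set_def
  proof (intro conjI ballI impI)
    show "\<phi> ` S \<subseteq> carrier Q" using S poset_iso_closed[OF iso] by blast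
    fix x y assume xy: "x \<in> \<phi> ` S" "y \<in> carrier Q" "y \<sqsubseteq>\<^bsub>Q\<^esub> x"
    obtain a where a: "x = \<phi> a" "a \<in> S" using xy by blast
    obtain b where b: "y = \<phi> b" "b \<in> carrier P" using poset_iso_surj[OF iso xy(2)] by blast
    have "a \<in> carrier P" using a S by blast
    then have "b \<sqsubseteq>\<^bsub>P\<^esub> a" using xy a b poset_iso_le_iff[OF iso, of b a] by simp
    then show "y \<in> \<phi> ` S" using a b lower_setD[OF low] by blast
  qed
qed

lemma lower_set_frame_iso:
  assumes iso: "poset_iso D D' \<alpha>"
  shows "poset_iso (lower_set_frame D') (lower_set_frame D) (inv_image_map D \<alpha>)"
proof (rule poset_isoI)
  have iso_tone: "isotone D D' \<alpha>" "\<alpha> \<in> carrier D \<rightarrow> carrier D'"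
    using poset_iso_po[OF iso] poset_iso_le_iff[OF iso] poset_iso_closed[OF iso]
    by (simp_all add: isotone_def partial_order.axioms(1))
  have image: "\<alpha> ` inv_image_map D \<alpha> V = V" if V: "V \<subseteq> carrier D'" for V
  proof
    show "V \<subseteq> \<alpha> ` inv_image_map D \<alpha> V"
    proof
      fix y assume y: "y \<in> V"
      then obtain x where "x \<in> carrier D" "y = \<alpha> x" using V poset_iso_surj[OF iso, of y] by blast
      then show "y \<in> \<alpha> ` inv_image_map D \<alpha> V" using y by (simp add: inv_image_map_def)
    qed
  qed (auto simp: inv_image_map_def)
  show "inv_image_map D \<alpha> ` carrier (lower_set_frame D') = carrier (lower_set_frame D)"
  proof
    show "inv_image_map D \<alpha> ` carrier (lower_set_frame D') \<subseteq> carrier (lower_set_frame D)"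
      using inv_image_lower_set[OF iso_tone] by auto
    show "carrier (lower_set_frame D) \<subseteq> inv_image_map D \<alpha> ` carrier (lower_set_frame D')"
    proof
      fix V assume "V \<in> carrier (lower_set_frame D)"
      then have V: "lower_set D V" "V \<subseteq> carrier D" by (auto simp: lower_set_def)
      then have "lower_set D' (\<alpha> ` V)" using poset_iso_lower_set_image_iff[OF iso] by simp
      moreover have "V = inv_image_map D \<alpha> (\<alpha> ` V)"
        using V(2) poset_iso_image_mem_iff[OF iso V(2)] unfolding inv_image_map_def by blast
      ultimately show "V \<in> inv_image_map D \<alpha> ` carrier (lower_set_frame D')" by auto
    qed
  qed
  fix V W assume "V \<in> carrier (lower_set_frame D')" "W \<in> carrier (lower_set_frame D')"
  then have "V \<subseteq> carrier D'" "W \<subseteq> carrier D'" by (auto simp: lower_set_def)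
  then have "inv_image_map D \<alpha> V \<subseteq> inv_image_map D \<alpha> W \<Longrightarrow> V \<subseteq> W"
    using image image_mono by metis
  then show "V \<sqsubseteq>\<^bsub>lower_set_frame D'\<^esub> W \<longleftrightarrow>
      inv_image_map D \<alpha> V \<sqsubseteq>\<^bsub>lower_set_frame D\<^esub> inv_image_map D \<alpha> W"
    by (auto simp: inv_image_map_def)
qed (rule partial_order_lower_set_frame)+

lemma isomorphic_lower_set_frames:
  "isomorphic_posets D D' \<Longrightarrow> isomorphic_posets (lower_set_frame D) (lower_set_frame D')"
  unfolding isomorphic_posets_def using lower_set_frame_iso poset_iso_inv_into by metis

lemma J_ideal_frame_iso:
  assumes site: "site_iso C J C' J' \<phi>"
    and J: "\<And>c S. c \<in> carrier C \<Longrightarrow> S \<in> J c \<Longrightarrow> S \<subseteq> carrier C"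
    and J': "\<And>c S. c \<in> carrier C' \<Longrightarrow> S \<in> J' c \<Longrightarrow> S \<subseteq> carrier C'"
  shows "poset_iso (J_ideal_frame C J) (J_ideal_frame C' J') ((`) \<phi>)"
proof (rule poset_isoI)
  have iso: "poset_iso C C' \<phi>" using site by (simp add: site_iso_def)
  have cover: "S \<in> J c \<longleftrightarrow> \<phi> ` S \<in> J' (\<phi> c)" if "c \<in> carrier C" "S \<subseteq> carrier C" for c S
    using site that by (simp add: site_iso_def)
  have subset_iff: "\<phi> ` S \<subseteq> \<phi> ` I \<longleftrightarrow> S \<subseteq> I" if "S \<subseteq> carrier C" "I \<subseteq> carrier C" for S I
    using that by (rule poset_iso_image_subset_iff[OF iso])
  have ideal: "J_ideal C' J' (\<phi> ` I) \<longleftrightarrow> J_ideal C J I" if I: "I \<subseteq> carrier C" for I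
  proof -
    have "(\<forall>c\<in>carrier C'. \<forall>S\<in>J' c. S \<subseteq> \<phi> ` I \<longrightarrow> c \<in> \<phi> ` I) \<longleftrightarrow>
          (\<forall>c\<in>carrier C. \<forall>S\<in>J c. S \<subseteq> I \<longrightarrow> c \<in> I)" (is "?l \<longleftrightarrow> ?r")
    proof
      assume l: ?l
      show ?r
      proof (intro ballI impI)
        fix c S assume c: "c \<in> carrier C" "S \<in> J c" "S \<subseteq> I"
        then have "\<phi> ` S \<in> J' (\<phi> c)" using cover J by blast
        moreover have "\<phi> ` S \<subseteq> \<phi> ` I" using c(3) by (rule image_mono)
        ultimately have "\<phi> c \<in> \<phi> ` I" using l poset_iso_closed[OF iso c(1)] by blast
        then show "c \<in> I" using I c poset_iso_image_mem_iff[OF iso] by simp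
      qed
    next
      assume r: ?r
      show ?l
      proof (intro ballI impI)
        fix c S assume c: "c \<in> carrier C'" "S \<in> J' c" "S \<subseteq> \<phi> ` I"
        obtain a where a: "c = \<phi> a" "a \<in> carrier C" using poset_iso_surj[OF iso c(1)] by blast
        obtain T where T: "T \<subseteq> I" "S = \<phi> ` T" using c(3) by (metis subset_imageE)
        have "T \<subseteq> carrier C" using T I by blast
        then have "T \<in> J a" using cover[of a T] a T c(2) by simp
        then have "a \<in> I" using r a T by blast
        then show "c \<in> \<phi> ` I" using a by blast
      qed
    qed
    then show ?thesis unfolding J_ideal_def by (simp add: poset_iso_lower_set_image_iff[OF iso I])
  qed
  show "(`) \<phi> ` carrier (J_ideal_frame C J) = carrier (J_ideal_frame C' J')"
  proof
    show "(`) \<phi> ` carrier (J_ideal_frame C J) \<subseteq> carrier (J_ideal_frame C' J')"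
      using ideal[OF J_ideal_subset_carrier] by auto
    show "carrier (J_ideal_frame C' J') \<subseteq> (`) \<phi> ` carrier (J_ideal_frame C J)"
    proof
      fix K assume K: "K \<in> carrier (J_ideal_frame C' J')"
      then have "K \<subseteq> carrier C'" by (auto simp: J_ideal_def lower_set_def)
      from poset_iso_subset_image[OF iso this] obtain I where I: "I \<subseteq> carrier C" "K = \<phi> ` I" .
      then show "K \<in> (`) \<phi> ` carrier (J_ideal_frame C J)" using K ideal by simp
    qed
  qed
  fix I K assume "I \<in> carrier (J_ideal_frame C J)" "K \<in> carrier (J_ideal_frame C J)"
  then show "I \<sqsubseteq>\<^bsub>J_ideal_frame C J\<^esub> K \<longleftrightarrow> \<phi> ` I \<sqsubseteq>\<^bsub>J_ideal_frame C' J'\<^esub> \<phi> ` K"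
    using subset_iff[of I K] by (simp add: J_ideal_def lower_set_def)
qed (rule partial_order_J_ideal_frame)+

text \<open>This and the next lemma carry the structure of the sites in \<open>\<K>\<close> over to the objects of \<open>Ext(\<K>)\<close>, and
  to the posets of \<open>U\<close>-compact elements.\<close>

lemma site_iso_topology:
  assumes site_iso: "site_iso Q J' C J \<beta>" and site: "site C J"
    and J': "\<And>x S. x \<in> carrier Q \<Longrightarrow> S \<in> J' x \<Longrightarrow> S \<subseteq> carrier Q"
  shows "grothendieck_topology Q J'"
proof -
  interpret site C J by (rule site)
  have iso: "poset_iso Q C \<beta>" using site_iso by (simp add: site_iso_def)
  note closed = poset_iso_closed[OF iso]
  have cover: "S \<in> J' x \<longleftrightarrow> \<beta> ` S \<in> J (\<beta> x)" if "x \<in> carrier Q" "S \<subseteq> carrier Q" for x S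
    using site_iso that by (simp add: site_iso_def)
  have image_Int: "\<beta> ` (S \<inter> T) = \<beta> ` S \<inter> \<beta> ` T" if "S \<subseteq> carrier Q" "T \<subseteq> carrier Q" for S T
    using that poset_iso_inj[OF iso] by (meson inj_on_image_Int)
  have down: "down Q x \<subseteq> carrier Q" for x by (auto simp: mem_down)
  have sub: "\<beta> ` S \<subseteq> down C (\<beta> x) \<longleftrightarrow> S \<subseteq> down Q x" if "S \<subseteq> carrier Q" "x \<in> carrier Q" for S x
    using poset_iso_image_subset_iff[OF iso that(1) down[of x]] poset_iso_image_down[OF iso that(2)] by simp
  show ?thesis
    unfolding grothendieck_topology_def
  proof (intro conjI ballI allI impI)
    fix c S assume c: "c \<in> carrier Q" "S \<in> J' c"
    have Sc: "S \<subseteq> carrier Q" by (rule J'[OF c])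
    show "is_sieve Q c S"
      using cover_sieve[OF closed[OF c(1)], of "\<beta> ` S"] sub[OF Sc c(1)] cover[OF c(1) Sc] c(2)
        poset_iso_lower_set_image_iff[OF iso Sc]
      by (simp add: is_sieve_def)
  next
    fix c assume c: "c \<in> carrier Q"
    show "down Q c \<in> J' c"
      using poset_iso_image_down[OF iso c] cover_maximal[OF closed[OF c]] cover[OF c down] by simp
  next
    fix c S d assume c: "c \<in> carrier Q" "S \<in> J' c" "d \<in> down Q c"
    then have d: "d \<in> carrier Q" "\<beta> d \<sqsubseteq>\<^bsub>C\<^esub> \<beta> c" using poset_iso_le_iff[OF iso] by (auto simp: mem_down)
    have Sc: "S \<subseteq> carrier Q" by (rule J'[OF c(1,2)])
    have "\<beta> ` (S \<inter> down Q d) = \<beta> ` S \<inter> down C (\<beta> d)"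
      using image_Int[OF Sc down] poset_iso_image_down[OF iso d(1)] by simp
    also have "\<dots> \<in> J (\<beta> d)"
      using c(2) cover[OF c(1) Sc] d(2) cover_stable[OF closed[OF c(1)] _ closed[OF d(1)]] by simp
    finally show "S \<inter> down Q d \<in> J' d" using cover[OF d(1), of "S \<inter> down Q d"] Sc by blast
  next
    fix c S R assume c: "c \<in> carrier Q" "S \<in> J' c"
      and R: "is_sieve Q c R \<and> (\<forall>d\<in>S. R \<inter> down Q d \<in> J' d)"
    have Rc: "R \<subseteq> carrier Q" using R by (auto simp: is_sieve_def lower_set_def)
    have Sc: "S \<subseteq> carrier Q" by (rule J'[OF c])
    have "\<beta> ` R \<in> J (\<beta> c)"
    proof (rule cover_local[OF closed[OF c(1)]])
      show "\<beta> ` S \<in> J (\<beta> c)" using c cover[OF c(1) Sc] by simp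
      show "lower_set C (\<beta> ` R)" using R Rc poset_iso_lower_set_image_iff[OF iso] by (simp add: is_sieve_def)
      show "\<beta> ` R \<subseteq> down C (\<beta> c)" using R Rc c sub by (simp add: is_sieve_def)
      fix e assume "e \<in> \<beta> ` S"
      then obtain d where d: "e = \<beta> d" "d \<in> S" by blast
      have dc: "d \<in> carrier Q" using d Sc by blast
      have "\<beta> ` R \<inter> down C e = \<beta> ` (R \<inter> down Q d)"
        using d image_Int[OF Rc down] poset_iso_image_down[OF iso dc] by simp
      moreover have "R \<inter> down Q d \<in> J' d" using R d by blast
      ultimately show "\<beta> ` R \<inter> down C e \<in> J e"
        using cover[OF dc, of "R \<inter> down Q d"] Rc d(1) by auto
    qed
    then show "R \<in> J' c" using cover[OF c(1) Rc] by simp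
  qed
qed

lemma site_iso_subcanonical:
  assumes site_iso: "site_iso Q J' C J \<beta>" and C: "subcanonical C J"
    and J': "\<And>x S. x \<in> carrier Q \<Longrightarrow> S \<in> J' x \<Longrightarrow> S \<subseteq> carrier Q"
  shows "subcanonical Q J'"
  unfolding subcanonical_def
proof (intro ballI)
  have iso: "poset_iso Q C \<beta>" using site_iso by (simp add: site_iso_def)
  fix c S assume c: "c \<in> carrier Q" "S \<in> J' c"
  have Sc: "S \<subseteq> carrier Q" by (rule J'[OF c])
  have "\<beta> ` S \<in> J (\<beta> c)" using site_iso c Sc by (simp add: site_iso_def)
  then have lub: "is_lub C (\<beta> c) (\<beta> ` S)"
    using C poset_iso_closed[OF iso c(1)] by (simp add: subcanonical_def)
  have "\<beta> ` S \<subseteq> carrier C" using Sc poset_iso_closed[OF iso] by blast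
  from poset_iso_lub[OF poset_iso_inv_into[OF iso] this lub]
  show "is_lub Q c S" using poset_iso_inj[OF iso] c(1) Sc by (simp add: inv_into_image_cancel)
qed

section \<open>Equivalences of categories\<close>

lemma cat_id: "category \<A> \<Longrightarrow> A \<in> ob \<A> \<Longrightarrow> idt \<A> A \<in> arr \<A> A A"
  unfolding category_def by blast

lemma cat_comp:
  "category \<A> \<Longrightarrow> A \<in> ob \<A> \<Longrightarrow> B \<in> ob \<A> \<Longrightarrow> C \<in> ob \<A> \<Longrightarrow> f \<in> arr \<A> A B \<Longrightarrow> g \<in> arr \<A> B C
    \<Longrightarrow> cmp \<A> A B C g f \<in> arr \<A> A C"
  unfolding category_def by blast

lemma cat_id_right:
  "category \<A> \<Longrightarrow> A \<in> ob \<A> \<Longrightarrow> B \<in> ob \<A> \<Longrightarrow> f \<in> arr \<A> A B \<Longrightarrow> cmp \<A> A A B f (idt \<A> A) = f"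
  unfolding category_def by blast

lemma cat_id_left:
  "category \<A> \<Longrightarrow> A \<in> ob \<A> \<Longrightarrow> B \<in> ob \<A> \<Longrightarrow> f \<in> arr \<A> A B \<Longrightarrow> cmp \<A> A B B (idt \<A> B) f = f"
  unfolding category_def by blast

lemma cat_assoc:
  "category \<A> \<Longrightarrow> A \<in> ob \<A> \<Longrightarrow> B \<in> ob \<A> \<Longrightarrow> C \<in> ob \<A> \<Longrightarrow> D \<in> ob \<A>
    \<Longrightarrow> f \<in> arr \<A> A B \<Longrightarrow> g \<in> arr \<A> B C \<Longrightarrow> h \<in> arr \<A> C D
    \<Longrightarrow> cmp \<A> A C D h (cmp \<A> A B C g f) = cmp \<A> A B D (cmp \<A> B C D h g) f"
  unfolding category_def by blast

lemma op_cat_simps [simp]: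
  "ob (op_cat \<A>) = ob \<A>" "arr (op_cat \<A>) A B = arr \<A> B A" "idt (op_cat \<A>) = idt \<A>"
  "cmp (op_cat \<A>) A B C g f = cmp \<A> C B A f g"
  by (simp_all add: op_cat_def)

lemma category_op: "category \<A> \<Longrightarrow> category (op_cat \<A>)"
  unfolding category_def[of "op_cat \<A>"]
  by (simp add: cat_id cat_comp cat_id_left cat_id_right cat_assoc)

lemma id_funct_simps [simp]: "fob id_funct A = A" "farr id_funct A B f = f"
  by (simp_all add: id_funct_def)

lemma comp_funct_simps [simp]:
  "fob (comp_funct G F) A = fob G (fob F A)"
  "farr (comp_funct G F) A B f = farr G (fob F A) (fob F B) (farr F A B f)"
  by (simp_all add: comp_funct_def)

text \<open>
  Some objects of \<open>\<A>\<close> are paired with objects of \<open>\<B>\<close>, possibly in several ways recorded by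
  the parameters \<open>s\<close>, \<open>t\<close>, \<open>u\<close>, and the arrows between the two members of paired objects are
  matched one to one, compatibly with identities and composition.
\<close>

locale correspondence =
  fixes \<A> :: "('o, 'm) cat" and \<B> :: "('p, 'n) cat"
    and paired :: "'o \<Rightarrow> 'p \<Rightarrow> 't \<Rightarrow> bool"
    and mates :: "'o \<Rightarrow> 'p \<Rightarrow> 't \<Rightarrow> 'o \<Rightarrow> 'p \<Rightarrow> 't \<Rightarrow> 'm \<Rightarrow> 'n \<Rightarrow> bool"
  assumes cat: "category \<A>" "category \<B>"
    and paired_ob: "\<And>X D s. paired X D s \<Longrightarrow> X \<in> ob \<A> \<and> D \<in> ob \<B>"
    and mates_arr: "\<And>X D s X' D' t f g. mates X D s X' D' t f g \<Longrightarrow> f \<in> arr \<A> X X' \<and> g \<in> arr \<B> D D'"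
    and mates_id: "\<And>X D s. paired X D s \<Longrightarrow> mates X D s X D s (idt \<A> X) (idt \<B> D)"
    and mates_comp: "\<And>X D s X' D' t X'' D'' u f g f' g'.
          paired X D s \<Longrightarrow> paired X' D' t \<Longrightarrow> paired X'' D'' u \<Longrightarrow>
          mates X D s X' D' t f g \<Longrightarrow> mates X' D' t X'' D'' u f' g' \<Longrightarrow>
          mates X D s X'' D'' u (cmp \<A> X X' X'' f' f) (cmp \<B> D D' D'' g' g)"
    and ex_left: "\<And>X D s X' D' t g. paired X D s \<Longrightarrow> paired X' D' t \<Longrightarrow> g \<in> arr \<B> D D' \<Longrightarrow>
          \<exists>f. mates X D s X' D' t f g"
    and ex_right: "\<And>X D s X' D' t f. paired X D s \<Longrightarrow> paired X' D' t \<Longrightarrow> f \<in> arr \<A> X X' \<Longrightarrow>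
          \<exists>g. mates X D s X' D' t f g"
    and unique_left: "\<And>X D s X' D' t f f' g. paired X D s \<Longrightarrow> paired X' D' t \<Longrightarrow>
          mates X D s X' D' t f g \<Longrightarrow> mates X D s X' D' t f' g \<Longrightarrow> f = f'"
    and unique_right: "\<And>X D s X' D' t f g g'. paired X D s \<Longrightarrow> paired X' D' t \<Longrightarrow>
          mates X D s X' D' t f g \<Longrightarrow> mates X D s X' D' t f g' \<Longrightarrow> g = g'"
begin

text \<open>The situation is symmetric, so that what holds for functors out of \<open>\<A>\<close> also holds for functors
  out of \<open>\<B>\<close>.\<close>

lemma flip: "correspondence \<B> \<A> (\<lambda>D X. paired X D) (\<lambda>D X s D' X' t g f. mates X D s X' D' t f g)"
proof (rule correspondence.intro)
  fix X D s X' D' t X'' D'' u f g f' g'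
  assume "paired X D s" "paired X' D' t" "paired X'' D'' u" "mates X D s X' D' t f g"
    "mates X' D' t X'' D'' u f' g'"
  then show "mates X D s X'' D'' u (cmp \<A> X X' X'' f' f) (cmp \<B> D D' D'' g' g)" by (rule mates_comp)
next
  fix X D s X' D' t f f' g
  assume "paired X D s" "paired X' D' t" "mates X D s X' D' t f g" "mates X D s X' D' t f' g"
  then show "f = f'" by (rule unique_left)
next
  fix X D s X' D' t f g g'
  assume "paired X D s" "paired X' D' t" "mates X D s X' D' t f g" "mates X D s X' D' t f g'"
  then show "g = g'" by (rule unique_right)
qed (use cat paired_ob mates_arr mates_id ex_left ex_right in auto)

lemma functor_if_mates:
  assumes F_ob: "\<And>X. X \<in> ob \<A> \<Longrightarrow> paired X (fob F X) (p X)"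
    and F_arr: "\<And>X X' f. X \<in> ob \<A> \<Longrightarrow> X' \<in> ob \<A> \<Longrightarrow> f \<in> arr \<A> X X' \<Longrightarrow>
          mates X (fob F X) (p X) X' (fob F X') (p X') f (farr F X X' f)"
  shows "is_functor \<A> \<B> F"
  unfolding is_functor_def
proof (intro conjI ballI cat)
  fix A assume A: "A \<in> ob \<A>"
  show "fob F A \<in> ob \<B>" using paired_ob[OF F_ob[OF A]] by blast
  show "farr F A A (idt \<A> A) = idt \<B> (fob F A)"
    by (rule unique_right[OF F_ob[OF A] F_ob[OF A] F_arr[OF A A cat_id[OF cat(1) A]] mates_id[OF F_ob[OF A]]])
next
  fix A B f assume "A \<in> ob \<A>" "B \<in> ob \<A>" "f \<in> arr \<A> A B"
  then show "farr F A B f \<in> arr \<B> (fob F A) (fob F B)" using F_arr mates_arr by blast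
next
  fix A B C f g
  assume A: "A \<in> ob \<A>" and B: "B \<in> ob \<A>" and C: "C \<in> ob \<A>"
    and f: "f \<in> arr \<A> A B" and g: "g \<in> arr \<A> B C"
  show "farr F A C (cmp \<A> A B C g f) =
      cmp \<B> (fob F A) (fob F B) (fob F C) (farr F B C g) (farr F A B f)"
    by (rule unique_right[OF F_ob[OF A] F_ob[OF C] F_arr[OF A C cat_comp[OF cat(1) A B C f g]]
          mates_comp[OF F_ob[OF A] F_ob[OF B] F_ob[OF C] F_arr[OF A B f] F_arr[OF B C g]]])
qed

text \<open>The identity also has a mate in the opposite direction; the two composites are mates of identities
  and therefore identities.\<close>

lemma is_iso_mate_of_identity:
  assumes s: "paired X D s" and t: "paired X' D t" and f: "mates X D s X' D t f (idt \<B> D)"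
  shows "is_iso \<A> X X' f"
proof -
  have D: "D \<in> ob \<B>" using paired_ob[OF s] by blast
  obtain f' where f': "mates X' D t X D s f' (idt \<B> D)"
    using ex_left[OF t s cat_id[OF cat(2) D]] by blast
  have idid: "cmp \<B> D D D (idt \<B> D) (idt \<B> D) = idt \<B> D"
    by (rule cat_id_left[OF cat(2) D D cat_id[OF cat(2) D]])
  have "cmp \<A> X X' X f' f = idt \<A> X"
    using unique_left[OF s s mates_comp[OF s t s f f', unfolded idid] mates_id[OF s]] .
  moreover have "cmp \<A> X' X X' f f' = idt \<A> X'"
    using unique_left[OF t t mates_comp[OF t s t f' f, unfolded idid] mates_id[OF t]] .
  ultimately show ?thesis using mates_arr[OF f] mates_arr[OF f'] unfolding is_iso_def by blast
qed

text \<open>Two functors into \<open>\<A>\<close> with the same mates in \<open>\<B>\<close> are isomorphic: both sides of each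
  naturality square have the same mate.\<close>

lemma natural_iso_if_common_mates:
  assumes s: "\<And>A. A \<in> ob \<C> \<Longrightarrow> paired (fob G A) (fob K A) (s A)"
    and t: "\<And>A. A \<in> ob \<C> \<Longrightarrow> paired (fob H A) (fob K A) (t A)"
    and G: "\<And>A B f. A \<in> ob \<C> \<Longrightarrow> B \<in> ob \<C> \<Longrightarrow> f \<in> arr \<C> A B \<Longrightarrow>
          mates (fob G A) (fob K A) (s A) (fob G B) (fob K B) (s B) (farr G A B f) (farr K A B f)"
    and H: "\<And>A B f. A \<in> ob \<C> \<Longrightarrow> B \<in> ob \<C> \<Longrightarrow> f \<in> arr \<C> A B \<Longrightarrow>
          mates (fob H A) (fob K A) (t A) (fob H B) (fob K B) (t B) (farr H A B f) (farr K A B f)"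
  shows "\<exists>\<eta>. natural_iso \<C> \<A> G H \<eta>"
proof -
  have K: "fob K A \<in> ob \<B>" if "A \<in> ob \<C>" for A using paired_ob[OF s[OF that]] by blast
  define \<eta> where "\<eta> A = (SOME f. mates (fob G A) (fob K A) (s A) (fob H A) (fob K A) (t A) f
    (idt \<B> (fob K A)))" for A
  have \<eta>: "mates (fob G A) (fob K A) (s A) (fob H A) (fob K A) (t A) (\<eta> A) (idt \<B> (fob K A))"
    if A: "A \<in> ob \<C>" for A
    unfolding \<eta>_def by (rule someI_ex) (rule ex_left[OF s[OF A] t[OF A] cat_id[OF cat(2) K[OF A]]])
  have "natural_iso \<C> \<A> G H \<eta>"
    unfolding natural_iso_def
  proof (intro conjI ballI)
    fix A assume A: "A \<in> ob \<C>"
    show "is_iso \<A> (fob G A) (fob H A) (\<eta> A)" by (rule is_iso_mate_of_identity[OF s[OF A] t[OF A] \<eta>[OF A]])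
  next
    fix A B f assume A: "A \<in> ob \<C>" and B: "B \<in> ob \<C>" and f: "f \<in> arr \<C> A B"
    have k: "farr K A B f \<in> arr \<B> (fob K A) (fob K B)" using mates_arr[OF G[OF A B f]] by blast
    show "cmp \<A> (fob G A) (fob G B) (fob H B) (\<eta> B) (farr G A B f) =
        cmp \<A> (fob G A) (fob H A) (fob H B) (farr H A B f) (\<eta> A)"
      by (rule unique_left[OF s[OF A] t[OF B]
            mates_comp[OF s[OF A] s[OF B] t[OF B] G[OF A B f] \<eta>[OF B], unfolded cat_id_left[OF cat(2) K[OF A] K[OF B] k]]
            mates_comp[OF s[OF A] t[OF A] t[OF B] \<eta>[OF A] H[OF A B f], unfolded cat_id_right[OF cat(2) K[OF A] K[OF B] k]]])
  qed
  then show ?thesis by blast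
qed

text \<open>The unit compares two functors that share the mates given by \<open>F\<close>, namely the identity (through
  the pairings \<open>p\<close>) and \<open>G F\<close> (through the pairings \<open>q\<close>); the counit is dual.\<close>

lemma categorical_inverses_if_mates:
  assumes F_ob: "\<And>X. X \<in> ob \<A> \<Longrightarrow> paired X (fob F X) (p X)"
    and G_ob: "\<And>D. D \<in> ob \<B> \<Longrightarrow> paired (fob G D) D (q D)"
    and F_arr: "\<And>X X' f. X \<in> ob \<A> \<Longrightarrow> X' \<in> ob \<A> \<Longrightarrow> f \<in> arr \<A> X X' \<Longrightarrow>
          mates X (fob F X) (p X) X' (fob F X') (p X') f (farr F X X' f)"
    and G_arr: "\<And>D D' g. D \<in> ob \<B> \<Longrightarrow> D' \<in> ob \<B> \<Longrightarrow> g \<in> arr \<B> D D' \<Longrightarrow>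
          mates (fob G D) D (q D) (fob G D') D' (q D') (farr G D D' g) g"
  shows "categorical_inverses \<A> \<B> F G"
  unfolding categorical_inverses_def
proof (intro conjI)
  have F: "fob F X \<in> ob \<B>" if "X \<in> ob \<A>" for X using paired_ob[OF F_ob[OF that]] by blast
  have G: "fob G D \<in> ob \<A>" if "D \<in> ob \<B>" for D using paired_ob[OF G_ob[OF that]] by blast
  have Fa: "farr F X X' f \<in> arr \<B> (fob F X) (fob F X')" if "X \<in> ob \<A>" "X' \<in> ob \<A>" "f \<in> arr \<A> X X'" for X X' f
    using mates_arr[OF F_arr[OF that]] by blast
  have Ga: "farr G D D' g \<in> arr \<A> (fob G D) (fob G D')" if "D \<in> ob \<B>" "D' \<in> ob \<B>" "g \<in> arr \<B> D D'" for D D' g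
    using mates_arr[OF G_arr[OF that]] by blast
  show "is_functor \<A> \<B> F" by (rule functor_if_mates[OF F_ob F_arr])
  show "is_functor \<B> \<A> G" by (rule correspondence.functor_if_mates[OF flip G_ob G_arr])
  show "\<exists>\<eta>. natural_iso \<A> \<A> id_funct (comp_funct G F) \<eta>"
    by (rule natural_iso_if_common_mates[where K = F and s = p and t = "\<lambda>A. q (fob F A)"])
       (simp_all add: F_ob F_arr G_ob G_arr F Fa)
  show "\<exists>\<epsilon>. natural_iso \<B> \<B> (comp_funct F G) id_funct \<epsilon>"
    by (rule correspondence.natural_iso_if_common_mates[OF flip, where K = G and s = "\<lambda>D. p (fob G D)" and t = q])
       (simp_all add: F_ob F_arr G_ob G_arr G Ga)
qed

end

text \<open>Subterminal objects are characterised without mentioning a terminal object, so that an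
  equivalence visibly preserves them.\<close>

definition subterminal :: "('o, 'm) cat \<Rightarrow> 'o \<Rightarrow> bool" where
  "subterminal \<A> A \<longleftrightarrow> A \<in> ob \<A> \<and> (\<forall>Z\<in>ob \<A>. \<forall>f\<in>arr \<A> Z A. \<forall>g\<in>arr \<A> Z A. f = g)"

lemma subterminal_iso:
  assumes cat: "category \<A>" and B: "subterminal \<A> B" and A: "A \<in> ob \<A>"
    and f: "f \<in> arr \<A> A B" and f': "f' \<in> arr \<A> B A" and id: "cmp \<A> A B A f' f = idt \<A> A"
  shows "subterminal \<A> A"
  unfolding subterminal_def
proof (intro conjI A ballI)
  have Bo: "B \<in> ob \<A>" using B by (simp add: subterminal_def)
  fix Z g h assume Z: "Z \<in> ob \<A>" and g: "g \<in> arr \<A> Z A" and h: "h \<in> arr \<A> Z A"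
  have "cmp \<A> Z A B f g = cmp \<A> Z A B f h"
    using B Z cat_comp[OF cat Z A Bo g f] cat_comp[OF cat Z A Bo h f] by (simp add: subterminal_def)
  then have "cmp \<A> Z A A (cmp \<A> A B A f' f) g = cmp \<A> Z A A (cmp \<A> A B A f' f) h"
    using cat_assoc[OF cat Z A Bo A g f f'] cat_assoc[OF cat Z A Bo A h f f'] by simp
  then show "g = h" using cat_id_left[OF cat Z A] g h id by simp
qed

lemma functor_faithful_reflects_subterminal:
  assumes F: "is_functor \<A> \<B> F" and A: "A \<in> ob \<A>" and FA: "subterminal \<B> (fob F A)"
    and faithful: "\<And>Z f g. Z \<in> ob \<A> \<Longrightarrow> f \<in> arr \<A> Z A \<Longrightarrow> g \<in> arr \<A> Z A \<Longrightarrow>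
        farr F Z A f = farr F Z A g \<Longrightarrow> f = g"
  shows "subterminal \<A> A"
  unfolding subterminal_def
proof (intro conjI A ballI)
  fix Z f g assume Z: "Z \<in> ob \<A>" and fg: "f \<in> arr \<A> Z A" "g \<in> arr \<A> Z A"
  have "farr F Z A h \<in> arr \<B> (fob F Z) (fob F A)" if "h \<in> arr \<A> Z A" for h
    using F A Z that unfolding is_functor_def by blast
  moreover have "fob F Z \<in> ob \<B>" using F Z unfolding is_functor_def by blast
  ultimately have "farr F Z A f = farr F Z A g" using FA fg unfolding subterminal_def by blast
  then show "f = g" by (rule faithful[OF Z fg])
qed

text \<open>Both functors of an equivalence are faithful, hence reflect subterminal objects; and they preserve
  them, since the composites are isomorphic to the identity.\<close>

lemma equivalence_subterminals:
  assumes inv: "categorical_inverses \<A> \<B> F G"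
  shows "\<And>A. subterminal \<A> A \<Longrightarrow> subterminal \<B> (fob F A)"
    and "\<And>B. subterminal \<B> B \<Longrightarrow> subterminal \<A> (fob G B)"
    and "\<And>A A'. A \<in> ob \<A> \<Longrightarrow> A' \<in> ob \<A> \<Longrightarrow>
          arr \<A> A A' \<noteq> {} \<longleftrightarrow> arr \<B> (fob F A) (fob F A') \<noteq> {}"
    and "\<And>B. B \<in> ob \<B> \<Longrightarrow> arr \<B> (fob F (fob G B)) B \<noteq> {} \<and> arr \<B> B (fob F (fob G B)) \<noteq> {}"
proof -
  have F: "is_functor \<A> \<B> F" and G: "is_functor \<B> \<A> G"
    using inv by (simp_all add: categorical_inverses_def)
  then have cat: "category \<A>" "category \<B>" by (simp_all add: is_functor_def)
  obtain \<eta> where \<eta>: "natural_iso \<A> \<A> id_funct (comp_funct G F) \<eta>"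
    using inv by (auto simp: categorical_inverses_def)
  obtain \<epsilon> where \<epsilon>: "natural_iso \<B> \<B> (comp_funct F G) id_funct \<epsilon>"
    using inv by (auto simp: categorical_inverses_def)
  have Fo: "fob F A \<in> ob \<B>" if "A \<in> ob \<A>" for A using F that unfolding is_functor_def by blast
  have Go: "fob G B \<in> ob \<A>" if "B \<in> ob \<B>" for B using G that unfolding is_functor_def by blast
  have Fa: "farr F A B f \<in> arr \<B> (fob F A) (fob F B)" if "A \<in> ob \<A>" "B \<in> ob \<A>" "f \<in> arr \<A> A B" for A B f
    using F that unfolding is_functor_def by blast
  have Ga: "farr G A B f \<in> arr \<A> (fob G A) (fob G B)" if "A \<in> ob \<B>" "B \<in> ob \<B>" "f \<in> arr \<B> A B" for A B f
    using G that unfolding is_functor_def by blast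
  have \<eta>i: "is_iso \<A> A (fob G (fob F A)) (\<eta> A)" if "A \<in> ob \<A>" for A
    using \<eta> that unfolding natural_iso_def by simp
  have \<epsilon>i: "is_iso \<B> (fob F (fob G B)) B (\<epsilon> B)" if "B \<in> ob \<B>" for B
    using \<epsilon> that unfolding natural_iso_def by simp
  obtain \<eta>' where \<eta>': "\<And>A. A \<in> ob \<A> \<Longrightarrow> \<eta> A \<in> arr \<A> A (fob G (fob F A)) \<and>
      \<eta>' A \<in> arr \<A> (fob G (fob F A)) A \<and> cmp \<A> A (fob G (fob F A)) A (\<eta>' A) (\<eta> A) = idt \<A> A \<and>
      cmp \<A> (fob G (fob F A)) A (fob G (fob F A)) (\<eta> A) (\<eta>' A) = idt \<A> (fob G (fob F A))"
    using \<eta>i unfolding is_iso_def by metis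
  obtain \<epsilon>' where \<epsilon>': "\<And>B. B \<in> ob \<B> \<Longrightarrow> \<epsilon> B \<in> arr \<B> (fob F (fob G B)) B \<and>
      \<epsilon>' B \<in> arr \<B> B (fob F (fob G B)) \<and> cmp \<B> B (fob F (fob G B)) B (\<epsilon> B) (\<epsilon>' B) = idt \<B> B \<and>
      cmp \<B> (fob F (fob G B)) B (fob F (fob G B)) (\<epsilon>' B) (\<epsilon> B) = idt \<B> (fob F (fob G B))"
    using \<epsilon>i unfolding is_iso_def by metis
  have F_faithful: "f = g" if A: "A \<in> ob \<A>" "B \<in> ob \<A>" and fg: "f \<in> arr \<A> A B" "g \<in> arr \<A> A B"
      "farr F A B f = farr F A B g" for A B f g
  proof -
    note GF = Go[OF Fo[OF A(2)]]
    have nat: "cmp \<A> A B (fob G (fob F B)) (\<eta> B) h =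
        cmp \<A> A (fob G (fob F A)) (fob G (fob F B)) (farr G (fob F A) (fob F B) (farr F A B h)) (\<eta> A)"
      if "h \<in> arr \<A> A B" for h
      using \<eta> that A unfolding natural_iso_def by simp
    have "cmp \<A> A B (fob G (fob F B)) (\<eta> B) f = cmp \<A> A B (fob G (fob F B)) (\<eta> B) g"
      using nat[OF fg(1)] nat[OF fg(2)] fg(3) by simp
    then have "cmp \<A> A B B (idt \<A> B) f = cmp \<A> A B B (idt \<A> B) g"
      using cat_assoc[OF cat(1) A GF A(2) fg(1)] cat_assoc[OF cat(1) A GF A(2) fg(2)] \<eta>'[OF A(2)] by metis
    then show ?thesis using cat_id_left[OF cat(1) A fg(1)] cat_id_left[OF cat(1) A fg(2)] by simp
  qed
  have G_faithful: "f = g" if A: "A \<in> ob \<B>" "B \<in> ob \<B>" and fg: "f \<in> arr \<B> A B" "g \<in> arr \<B> A B"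
      "farr G A B f = farr G A B g" for A B f g
  proof -
    note FG = Fo[OF Go[OF A(1)]]
    have nat: "cmp \<B> (fob F (fob G A)) (fob F (fob G B)) B (\<epsilon> B) (farr F (fob G A) (fob G B) (farr G A B h)) =
        cmp \<B> (fob F (fob G A)) A B h (\<epsilon> A)"
      if "h \<in> arr \<B> A B" for h
      using \<epsilon> that A unfolding natural_iso_def by simp
    have "cmp \<B> (fob F (fob G A)) A B f (\<epsilon> A) = cmp \<B> (fob F (fob G A)) A B g (\<epsilon> A)"
      using nat[OF fg(1)] nat[OF fg(2)] fg(3) by simp
    then have "cmp \<B> A A B f (idt \<B> A) = cmp \<B> A A B g (idt \<B> A)"
      using cat_assoc[OF cat(2) A(1) FG A _ _ fg(1)] cat_assoc[OF cat(2) A(1) FG A _ _ fg(2)] \<epsilon>'[OF A(1)]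
      by metis
    then show ?thesis using cat_id_right[OF cat(2) A fg(1)] cat_id_right[OF cat(2) A fg(2)] by simp
  qed
  show "subterminal \<B> (fob F A)" if A: "subterminal \<A> A" for A
  proof -
    have Ao: "A \<in> ob \<A>" using A by (simp add: subterminal_def)
    have "subterminal \<A> (fob G (fob F A))"
      using subterminal_iso[OF cat(1) A Go[OF Fo[OF Ao]], of "\<eta>' A" "\<eta> A"] \<eta>'[OF Ao] by simp
    then show ?thesis
      by (rule functor_faithful_reflects_subterminal[OF G Fo[OF Ao]]) (rule G_faithful[OF _ Fo[OF Ao]])
  qed
  show "subterminal \<A> (fob G B)" if B: "subterminal \<B> B" for B
  proof -
    have Bo: "B \<in> ob \<B>" using B by (simp add: subterminal_def)
    have "subterminal \<B> (fob F (fob G B))"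
      using subterminal_iso[OF cat(2) B Fo[OF Go[OF Bo]], of "\<epsilon> B" "\<epsilon>' B"] \<epsilon>'[OF Bo] by simp
    then show ?thesis
      by (rule functor_faithful_reflects_subterminal[OF F Go[OF Bo]]) (rule F_faithful[OF _ Go[OF Bo]])
  qed
  show "arr \<B> (fob F (fob G B)) B \<noteq> {} \<and> arr \<B> B (fob F (fob G B)) \<noteq> {}" if "B \<in> ob \<B>" for B
    using \<epsilon>'[OF that] by blast
  show "arr \<A> A A' \<noteq> {} \<longleftrightarrow> arr \<B> (fob F A) (fob F A') \<noteq> {}" if A: "A \<in> ob \<A>" "A' \<in> ob \<A>" for A A'
  proof
    assume "arr \<A> A A' \<noteq> {}"
    then show "arr \<B> (fob F A) (fob F A') \<noteq> {}" using Fa[OF A] by blast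
  next
    assume "arr \<B> (fob F A) (fob F A') \<noteq> {}"
    then obtain g where "g \<in> arr \<B> (fob F A) (fob F A')" by blast
    then have g: "farr G (fob F A) (fob F A') g \<in> arr \<A> (fob G (fob F A)) (fob G (fob F A'))"
      by (rule Ga[OF Fo[OF A(1)] Fo[OF A(2)]])
    have "cmp \<A> A (fob G (fob F A)) (fob G (fob F A')) (farr G (fob F A) (fob F A') g) (\<eta> A)
        \<in> arr \<A> A (fob G (fob F A'))"
      using \<eta>'[OF A(1)] by (intro cat_comp[OF cat(1) A(1) Go[OF Fo[OF A(1)]] Go[OF Fo[OF A(2)]] _ g]) simp
    from cat_comp[OF cat(1) A(1) Go[OF Fo[OF A(2)]] A(2) this, of "\<eta>' A'"]
    show "arr \<A> A A' \<noteq> {}" using \<eta>'[OF A(2)] by blast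
  qed
qed

section \<open>Ideals as subterminal sheaves\<close>

lemma sheaf_cat_simps [simp]:
  "ob (sheaf_cat T C J) = {F. is_sheaf C J F}"
  "arr (sheaf_cat T C J) = presheaf_hom C"
  by (simp_all add: sheaf_cat_def presheaf_cat_def)

lemma is_sheaf_trivial_iff:
  assumes "partial_order D"
  shows "is_sheaf D (trivial_topology D) F \<longleftrightarrow> is_presheaf D F"
proof
  assume F: "is_presheaf D F"
  show "is_sheaf D (trivial_topology D) F"
    unfolding is_sheaf_def
  proof (intro conjI F ballI allI impI)
    fix c S x
    assume c: "c \<in> carrier D" "S \<in> trivial_topology D c" "matching_family D F S x"
    then have S: "S = down D c" by (simp add: trivial_topology_def)
    have cS: "c \<in> S" using c S self_mem_down[OF assms] by simp
    have m: "\<forall>d\<in>S. x d \<in> sec F d" "\<forall>d\<in>S. \<forall>e\<in>down D d. res F d e (x d) = x e"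
      using c(3) unfolding matching_family_def by blast+
    show "\<exists>!s. s \<in> sec F c \<and> (\<forall>d\<in>S. res F c d s = x d)"
    proof (rule ex1I[of _ "x c"])
      show "x c \<in> sec F c \<and> (\<forall>d\<in>S. res F c d (x c) = x d)" using m cS S by blast
      fix s assume s: "s \<in> sec F c \<and> (\<forall>d\<in>S. res F c d s = x d)"
      then have "res F c c s = x c" using cS by blast
      moreover have "res F c c s = s" using F c(1) s unfolding is_presheaf_def by blast
      ultimately show "s = x c" by simp
    qed
  qed
qed (simp add: is_sheaf_def)

lemma presheaf_cat_eq_sheaf_cat:
  "partial_order D \<Longrightarrow> presheaf_cat T D = sheaf_cat T D (trivial_topology D)"
  by (simp add: presheaf_cat_def sheaf_cat_def is_sheaf_trivial_iff)

text \<open>The subsheaf of the terminal sheaf that is inhabited over \<open>I\<close>; for \<open>I = down C c\<close> it is the sheaf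
  represented by \<open>c\<close>.  The value \<open>undefined\<close> serves as its only section, so that every universe of
  sets will do.\<close>

definition ideal_sheaf :: "'a set \<Rightarrow> ('a, 's) presheaf" where
  "ideal_sheaf I = \<lparr>sec = (\<lambda>c. if c \<in> I then {undefined} else {}), res = (\<lambda>_ _ _. undefined)\<rparr>"

definition support :: "'a gorder \<Rightarrow> ('a, 's) presheaf \<Rightarrow> 'a set" where
  "support C F = {c \<in> carrier C. sec F c \<noteq> {}}"

lemma ideal_sheaf_simps [simp]:
  "sec (ideal_sheaf I) c = (if c \<in> I then {undefined} else {})"
  "res (ideal_sheaf I) c d x = undefined"
  by (simp_all add: ideal_sheaf_def)

lemma support_ideal_sheaf: "I \<subseteq> carrier C \<Longrightarrow> support C (ideal_sheaf I) = I"
  by (auto simp: support_def)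

lemma is_sheaf_ideal_sheaf:
  assumes I: "J_ideal C J I"
  shows "is_sheaf C J (ideal_sheaf I)"
  unfolding is_sheaf_def
proof (intro conjI ballI allI impI)
  show "is_presheaf C (ideal_sheaf I)"
    using lower_setD[OF J_ideal_lower[OF I]] by (auto simp: is_presheaf_def mem_down)
  fix c S x assume c: "c \<in> carrier C" "S \<in> J c" and m: "matching_family C (ideal_sheaf I) S x"
  have x: "d \<in> I \<and> x d = undefined" if "d \<in> S" for d
    using m that by (force simp: matching_family_def split: if_splits)
  then have "c \<in> I" using J_idealD[OF I c] by blast
  then show "\<exists>!s. s \<in> sec (ideal_sheaf I) c \<and> (\<forall>d\<in>S. res (ideal_sheaf I) c d s = x d)"
    using x by auto
qed

lemma presheaf_hom_thin_unique:
  assumes thin: "\<And>c x y. c \<in> carrier C \<Longrightarrow> x \<in> sec F c \<Longrightarrow> y \<in> sec F c \<Longrightarrow> x = y"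
    and f: "f \<in> presheaf_hom C Z F" and g: "g \<in> presheaf_hom C Z F"
  shows "f = g"
proof (rule PiE_ext)
  show "f \<in> (\<Pi>\<^sub>E c\<in>carrier C. sec Z c \<rightarrow>\<^sub>E sec F c)" "g \<in> (\<Pi>\<^sub>E c\<in>carrier C. sec Z c \<rightarrow>\<^sub>E sec F c)"
    using f g unfolding presheaf_hom_def by simp_all
  fix c assume c: "c \<in> carrier C"
  show "f c = g c"
  proof (rule PiE_ext)
    show fc: "f c \<in> sec Z c \<rightarrow>\<^sub>E sec F c" and gc: "g c \<in> sec Z c \<rightarrow>\<^sub>E sec F c"
      using f g c unfolding presheaf_hom_def by auto
    fix x assume "x \<in> sec Z c"
    then show "f c x = g c x" using thin[OF c] PiE_mem[OF fc] PiE_mem[OF gc] by blast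
  qed
qed

text \<open>The representable sheaves of a subcanonical site separate sections; hence the subterminal
  sheaves are those with at most one section over each element, as for sheaves on a space.\<close>

lemma (in subcanonical_site) subterminal_sheaf_iff:
  "subterminal (sheaf_cat T C J) F \<longleftrightarrow>
     is_sheaf C J F \<and> (\<forall>c\<in>carrier C. \<forall>x\<in>sec F c. \<forall>y\<in>sec F c. x = y)"
proof
  assume F: "subterminal (sheaf_cat T C J) F"
  then have sheaf: "is_sheaf C J F" by (simp add: subterminal_def)
  then have pre: "is_presheaf C F" by (simp add: is_sheaf_def)
  have "x = y" if c: "c \<in> carrier C" and xy: "x \<in> sec F c" "y \<in> sec F c" for c x y
  proof -
    let ?Y = "ideal_sheaf (down C c) :: ('a, 'b) presheaf"
    define \<alpha> where "\<alpha> s = (\<lambda>d\<in>carrier C. \<lambda>z\<in>sec ?Y d. res F c d s)" for s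
    have \<alpha>: "\<alpha> s \<in> presheaf_hom C ?Y F" if s: "s \<in> sec F c" for s
    proof -
      have "res F c d s \<in> sec F d" if "d \<in> down C c" for d
        using pre c s that unfolding is_presheaf_def by blast
      moreover have "res F c e s = res F d e (res F c d s)" if "d \<in> down C c" "e \<in> down C d" for d e
        using pre c s that unfolding is_presheaf_def by metis
      moreover have "e \<in> down C c" if "d \<in> down C c" "e \<in> down C d" for d e
        using that c po_trans[OF po] by (auto simp: mem_down)
      ultimately show ?thesis
        unfolding presheaf_hom_def \<alpha>_def by (auto simp: mem_down)
    qed
    have "?Y \<in> ob (sheaf_cat T C J)" using is_sheaf_ideal_sheaf[OF J_ideal_down[OF c]] by simp
    then have "\<alpha> x = \<alpha> y" using F \<alpha>[OF xy(1)] \<alpha>[OF xy(2)] unfolding subterminal_def by simp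
    then have "\<alpha> x c undefined = \<alpha> y c undefined" by simp
    then have "res F c c x = res F c c y" using c self_mem_down[OF po c] by (simp add: \<alpha>_def)
    then show ?thesis using pre c xy unfolding is_presheaf_def by metis
  qed
  then show "is_sheaf C J F \<and> (\<forall>c\<in>carrier C. \<forall>x\<in>sec F c. \<forall>y\<in>sec F c. x = y)"
    using sheaf by blast
next
  assume F: "is_sheaf C J F \<and> (\<forall>c\<in>carrier C. \<forall>x\<in>sec F c. \<forall>y\<in>sec F c. x = y)"
  show "subterminal (sheaf_cat T C J) F"
    unfolding subterminal_def sheaf_cat_simps
  proof (intro conjI ballI)
    show "F \<in> {F. is_sheaf C J F}" using F by simp
    fix Z f g assume "f \<in> presheaf_hom C Z F" "g \<in> presheaf_hom C Z F"
    then show "f = g" using F by (intro presheaf_hom_thin_unique) blast+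
  qed
qed

lemma (in subcanonical_site) subterminal_ideal_sheaf:
  "J_ideal C J I \<Longrightarrow> subterminal (sheaf_cat T C J) (ideal_sheaf I)"
  by (simp add: subterminal_sheaf_iff is_sheaf_ideal_sheaf)

lemma (in subcanonical_site) J_ideal_support:
  assumes F: "subterminal (sheaf_cat T C J) F"
  shows "J_ideal C J (support C F)"
proof -
  have sheaf: "is_sheaf C J F" and thin: "\<And>c x y. c \<in> carrier C \<Longrightarrow> x \<in> sec F c \<Longrightarrow> y \<in> sec F c \<Longrightarrow> x = y"
    using F by (auto simp: subterminal_sheaf_iff)
  have res: "res F c d x \<in> sec F d" if "c \<in> carrier C" "d \<in> down C c" "x \<in> sec F c" for c d x
    using sheaf that unfolding is_sheaf_def is_presheaf_def by blast
  show ?thesis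
    unfolding J_ideal_def lower_set_def
  proof (intro conjI ballI impI)
    show "support C F \<subseteq> carrier C" by (auto simp: support_def)
    fix x y assume x: "x \<in> support C F" and y: "y \<in> carrier C" "y \<sqsubseteq>\<^bsub>C\<^esub> x"
    obtain s where "s \<in> sec F x" "x \<in> carrier C" using x by (auto simp: support_def)
    then have "res F x y s \<in> sec F y" using res y by (simp add: mem_down)
    then show "y \<in> support C F" using y by (auto simp: support_def)
  next
    fix c S assume c: "c \<in> carrier C" "S \<in> J c" "S \<subseteq> support C F"
    define x where "x d = (SOME s. s \<in> sec F d)" for d
    have x: "x d \<in> sec F d" if "d \<in> S" for d
      using c(3) that unfolding x_def by (auto simp: support_def some_in_eq)
    have low: "e \<in> S" if "d \<in> S" "e \<in> down C d" for d e
      using cover_sieve[OF c(1,2)] that lower_setD by (metis mem_down)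
    have Sc: "d \<in> carrier C" if "d \<in> S" for d using c(3) that by (auto simp: support_def)
    have "matching_family C F S x"
      unfolding matching_family_def
    proof (intro conjI ballI)
      fix d e assume d: "d \<in> S" and e: "e \<in> down C d"
      show "res F d e (x d) = x e"
        by (rule thin[OF Sc[OF low[OF d e]] res[OF Sc[OF d] e x[OF d]] x[OF low[OF d e]]])
    qed (rule x)
    then have "\<exists>s. s \<in> sec F c" using sheaf c unfolding is_sheaf_def by blast
    then show "c \<in> support C F" using c by (auto simp: support_def)
  qed
qed

lemma (in subcanonical_site) hom_nonempty_iff_support:
  assumes F: "subterminal (sheaf_cat T C J) F" and G: "subterminal (sheaf_cat T C J) G"
  shows "presheaf_hom C F G \<noteq> {} \<longleftrightarrow> support C F \<subseteq> support C G"
proof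
  assume "presheaf_hom C F G \<noteq> {}"
  then obtain f where f: "f \<in> presheaf_hom C F G" by blast
  show "support C F \<subseteq> support C G"
  proof
    fix c assume "c \<in> support C F"
    then obtain x where c: "c \<in> carrier C" "x \<in> sec F c" by (auto simp: support_def)
    then have "f c \<in> sec F c \<rightarrow>\<^sub>E sec G c" using f unfolding presheaf_hom_def by auto
    then have "f c x \<in> sec G c" using c by auto
    then show "c \<in> support C G" using c by (auto simp: support_def)
  qed
next
  assume sub: "support C F \<subseteq> support C G"
  define f where "f = (\<lambda>c\<in>carrier C. \<lambda>x\<in>sec F c. SOME y. y \<in> sec G c)"
  have some: "(SOME y. y \<in> sec G c) \<in> sec G c" if "c \<in> carrier C" "x \<in> sec F c" for c x
    using sub that by (auto simp: support_def some_in_eq)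
  have pre: "is_presheaf C F" "is_presheaf C G" using F G by (auto simp: subterminal_sheaf_iff is_sheaf_def)
  have thin: "x = y" if "c \<in> carrier C" "x \<in> sec G c" "y \<in> sec G c" for c x y
    using G that by (auto simp: subterminal_sheaf_iff)
  have "f \<in> presheaf_hom C F G"
    unfolding presheaf_hom_def
  proof (intro CollectI conjI ballI)
    show "f \<in> (\<Pi>\<^sub>E c\<in>carrier C. sec F c \<rightarrow>\<^sub>E sec G c)" using some by (auto simp: f_def)
    fix c d x assume c: "c \<in> carrier C" and d: "d \<in> down C c" and x: "x \<in> sec F c"
    have dc: "d \<in> carrier C" using d by (simp add: mem_down)
    have r: "res F c d x \<in> sec F d" using pre(1) c d x unfolding is_presheaf_def by blast
    have "res G c d (SOME y. y \<in> sec G c) \<in> sec G d"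
      using pre(2) c d some[OF c x] unfolding is_presheaf_def by blast
    from thin[OF dc some[OF dc r] this]
    show "f d (res F c d x) = res G c d (f c x)" using c dc x r by (simp add: f_def)
  qed
  then show "presheaf_hom C F G \<noteq> {}" by blast
qed

text \<open>Supports identify the preorder of subterminal sheaves with the frame of ideals, so equivalent
  categories of sheaves have isomorphic frames of ideals.\<close>

lemma isomorphic_J_ideal_frames:
  assumes C: "subcanonical_site C J" and D: "subcanonical_site D J'"
    and equiv: "equivalent_categories (sheaf_cat T C J) (sheaf_cat T' D J')"
  shows "isomorphic_posets (J_ideal_frame C J) (J_ideal_frame D J')"
proof -
  interpret C: subcanonical_site C J by (rule C)
  interpret D: subcanonical_site D J' by (rule D)
  let ?A = "sheaf_cat T C J" and ?B = "sheaf_cat T' D J'"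
  obtain F G where inv: "categorical_inverses ?A ?B F G"
    using equiv unfolding equivalent_categories_def by blast
  note eq = equivalence_subterminals[OF inv]
  have ob: "X \<in> ob ?A" if "subterminal ?A X" for X using that by (simp add: subterminal_def)
  have supp: "support D (fob F X) \<subseteq> support D (fob F Y) \<longleftrightarrow> support C X \<subseteq> support C Y"
    if "subterminal ?A X" "subterminal ?A Y" for X Y
    using eq(3)[OF ob ob, OF that] C.hom_nonempty_iff_support[OF that]
      D.hom_nonempty_iff_support[OF eq(1)[OF that(1)] eq(1)[OF that(2)]] by simp
  define \<phi> where "\<phi> I = support D (fob F (ideal_sheaf I))" for I
  have le: "\<phi> I \<subseteq> \<phi> K \<longleftrightarrow> I \<subseteq> K" if "J_ideal C J I" "J_ideal C J K" for I K
    using supp[OF C.subterminal_ideal_sheaf[OF that(1)] C.subterminal_ideal_sheaf[OF that(2)]]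
    by (simp add: \<phi>_def support_ideal_sheaf[OF J_ideal_subset_carrier[OF that(1)]]
        support_ideal_sheaf[OF J_ideal_subset_carrier[OF that(2)]])
  have closed: "J_ideal D J' (\<phi> I)" if "J_ideal C J I" for I
    unfolding \<phi>_def by (rule D.J_ideal_support[OF eq(1)[OF C.subterminal_ideal_sheaf[OF that]]])
  have surj: "\<exists>I. J_ideal C J I \<and> V = \<phi> I" if V: "J_ideal D J' V" for V
  proof -
    note sV = D.subterminal_ideal_sheaf[OF V, of T']
    note sG = eq(2)[OF sV]
    let ?I = "support C (fob G (ideal_sheaf V))"
    have I: "J_ideal C J ?I" by (rule C.J_ideal_support[OF sG])
    note sI = C.subterminal_ideal_sheaf[OF I, of T]
    have "support C (ideal_sheaf ?I :: ('a, 'c) presheaf) = ?I"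
      by (rule support_ideal_sheaf[OF J_ideal_subset_carrier[OF I]])
    then have "\<phi> ?I = support D (fob F (fob G (ideal_sheaf V)))"
      using supp[OF sI sG] supp[OF sG sI] unfolding \<phi>_def by blast
    also have "\<dots> = support D (ideal_sheaf V :: ('b, 'd) presheaf)"
      using eq(4)[of "ideal_sheaf V"] sV D.hom_nonempty_iff_support[OF eq(1)[OF sG] sV]
        D.hom_nonempty_iff_support[OF sV eq(1)[OF sG]]
      by (simp add: subterminal_def subset_antisym)
    also have "\<dots> = V" by (rule support_ideal_sheaf[OF J_ideal_subset_carrier[OF V]])
    finally show ?thesis using I by blast
  qed
  have "poset_iso (J_ideal_frame C J) (J_ideal_frame D J') \<phi>"
  proof (rule poset_isoI)
    show "\<phi> ` carrier (J_ideal_frame C J) = carrier (J_ideal_frame D J')"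
      using closed surj by auto
  qed (use le in \<open>auto simp: partial_order_J_ideal_frame\<close>)
  then show ?thesis unfolding isomorphic_posets_def by blast
qed

section \<open>Compact elements of the frame of ideals\<close>

text \<open>
  The canonical embedding of \<open>C\<close> into its frame of ideals is one of those to which the definition
  of a \<open>U\<close>-induced topology applies.  It turns covering into the existence of refinements by
  principal ideals, and the hypothesis \<open>principal\<close> replaces these by arbitrary refinements, which is what
  compactness is about.
\<close>

lemma (in subcanonical_site) U_compact_iff_principal:
  assumes P: "P (J_ideal_frame C J) (down C ` carrier C)"
    and induced: "U_induced_rel U P C J"
    and principal: "\<And>F. F \<subseteq> down C ` carrier C \<Longrightarrow>
          (\<exists>B. refines (J_ideal_frame C J) B F \<and> U (J_ideal_frame C J) B) \<Longrightarrow>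
          (\<exists>B\<subseteq>down C ` carrier C. refines (J_ideal_frame C J) B F \<and> U (J_ideal_frame C J) B)"
  shows "U_compact U (J_ideal_frame C J) u \<longleftrightarrow> (\<exists>c\<in>carrier C. u = down C c)"
proof -
  let ?L = "J_ideal_frame C J"
  have basis: "is_basis ?L (down C ` carrier C)"
    unfolding is_basis_def
  proof (intro conjI ballI)
    show "down C ` carrier C \<subseteq> carrier ?L" using J_ideal_down by auto
    fix I assume "I \<in> carrier ?L"
    then have I: "J_ideal C J I" by simp
    then have "\<Squnion>\<^bsub>?L\<^esub> (down C ` I) = I"
      using sup_down_image[OF J_ideal_subset_carrier[OF I]] gen_J_ideal_ideal by simp
    moreover have "down C ` I \<subseteq> down C ` carrier C" by (rule image_mono[OF J_ideal_subset_carrier[OF I]])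
    ultimately show "\<exists>A\<subseteq>down C ` carrier C. \<Squnion>\<^bsub>?L\<^esub> A = I"
      by (intro exI[of _ "down C ` I"] conjI)
  qed
  have covers: "\<Squnion>\<^bsub>?L\<^esub> (down C ` S) = down C c" if "c \<in> carrier C" "S \<in> J c" for c S
  proof -
    have "S \<subseteq> carrier C" using cover_sieve[OF that] lower_set_subset_carrier by blast
    then show ?thesis using sup_down_image gen_cover[OF that] by simp
  qed
  have embedding: "\<forall>c\<in>carrier C. \<forall>d\<in>carrier C. down C c \<sqsubseteq>\<^bsub>?L\<^esub> down C d \<longleftrightarrow> c \<sqsubseteq>\<^bsub>C\<^esub> d"
    using down_subset_down_iff[OF po] by simp
  have cover_iff_refinement: "(\<exists>c\<in>carrier C. (\<forall>a\<in>A. a \<sqsubseteq>\<^bsub>C\<^esub> c) \<and> gen_sieve C A \<in> J c) \<longleftrightarrow>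
      (\<exists>B. refines ?L B (down C ` A) \<and> U ?L B)" if A: "A \<subseteq> carrier C" for A
  proof -
    have "(\<exists>c\<in>carrier C. (\<forall>a\<in>A. a \<sqsubseteq>\<^bsub>C\<^esub> c) \<and> gen_sieve C A \<in> J c) \<longleftrightarrow>
        (\<exists>B\<subseteq>down C ` carrier C. refines ?L B (down C ` A) \<and> U ?L B)"
      using induced[unfolded U_induced_rel_def, rule_format, of ?L "down C" A]
        is_frame_J_ideal_frame embedding basis P covers J_ideal_down A by simp
    also have "\<dots> \<longleftrightarrow> (\<exists>B. refines ?L B (down C ` A) \<and> U ?L B)"
    proof
      show "\<exists>B. refines ?L B (down C ` A) \<and> U ?L B"
        if "\<exists>B\<subseteq>down C ` carrier C. refines ?L B (down C ` A) \<and> U ?L B"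
        using that by (elim exE conjE) (intro exI conjI)
    qed (rule principal[OF image_mono[OF A]])
    finally show ?thesis .
  qed
  show ?thesis
  proof
    assume u: "U_compact U ?L u"
    then have I: "J_ideal C J u" by (simp add: U_compact_def)
    note uc = J_ideal_subset_carrier[OF I]
    have "\<Squnion>\<^bsub>?L\<^esub> (down C ` u) = u" using sup_down_image[OF uc] gen_J_ideal_ideal[OF I] by simp
    moreover have "down C ` u \<subseteq> carrier ?L" using uc J_ideal_down by auto
    ultimately have "\<exists>B. refines ?L B (down C ` u) \<and> U ?L B" using u by (simp add: U_compact_def)
    then obtain c where c: "c \<in> carrier C" "\<forall>a\<in>u. a \<sqsubseteq>\<^bsub>C\<^esub> c" "gen_sieve C u \<in> J c"
      using cover_iff_refinement[OF uc] by blast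
    have "u \<in> J c" using c(3) gen_sieve_lower[OF po J_ideal_lower[OF I]] by simp
    then have "u = down C c" using gen_cover[OF c(1)] gen_J_ideal_ideal[OF I] by simp
    then show "\<exists>c\<in>carrier C. u = down C c" using c by blast
  next
    assume "\<exists>c\<in>carrier C. u = down C c"
    then obtain c where c: "c \<in> carrier C" "u = down C c" by blast
    show "U_compact U ?L u"
      unfolding U_compact_def
    proof (intro conjI allI impI)
      show "u \<in> carrier ?L" using c J_ideal_down by simp
      fix \<A> assume A: "\<A> \<subseteq> carrier ?L" and sup: "\<Squnion>\<^bsub>?L\<^esub> \<A> = u"
      let ?A = "\<Union>\<A>"
      have ideal: "J_ideal C J I" if "I \<in> \<A>" for I using A that by auto
      have low: "lower_set C ?A" by (rule lower_set_Union) (rule J_ideal_lower[OF ideal])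
      note Ac = lower_set_subset_carrier[OF low]
      have gen: "gen_J_ideal C J ?A = down C c" using A sup c by (simp add: sup_J_ideal_frame)
      then have "?A \<in> J c" using cover_iff[OF c(1) low] by simp
      moreover have "\<forall>a\<in>?A. a \<sqsubseteq>\<^bsub>C\<^esub> c"
        using gen gen_J_ideal_superset[of ?A C J] by (auto simp: mem_down)
      ultimately have "\<exists>c\<in>carrier C. (\<forall>a\<in>?A. a \<sqsubseteq>\<^bsub>C\<^esub> c) \<and> gen_sieve C ?A \<in> J c"
        using c(1) gen_sieve_lower[OF po low] by auto
      then obtain B where B: "refines ?L B (down C ` ?A)" "U ?L B"
        using cover_iff_refinement[OF Ac] by blast
      have "refines ?L B \<A>"
        unfolding refines_def
      proof (intro conjI ballI)
        show "B \<subseteq> carrier ?L" using B by (simp add: refines_def)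
        show "\<Squnion>\<^bsub>?L\<^esub> B = \<Squnion>\<^bsub>?L\<^esub> \<A>"
          using B sup_down_image[OF Ac] gen sup c by (simp add: refines_def)
        fix b assume "b \<in> B"
        then obtain a I where a: "b \<subseteq> down C a" "a \<in> I" "I \<in> \<A>"
          using B unfolding refines_def by auto
        then have "down C a \<subseteq> I"
          using down_subset_iff[OF po J_ideal_lower[OF ideal]] J_ideal_subset_carrier[OF ideal] by blast
        then show "\<exists>I\<in>\<A>. b \<sqsubseteq>\<^bsub>?L\<^esub> I" using a by auto
      qed
      then show "\<exists>B. refines ?L B \<A> \<and> U ?L B" using B by blast
    qed
  qed
qed

section \<open>Morphisms of sites\<close>

lemma site_morphismD:
  assumes "site_morphism C J C' J' h"
  shows "\<And>c. c \<in> carrier C \<Longrightarrow> h c \<in> carrier C'"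
    and "\<And>x y. x \<in> carrier C \<Longrightarrow> y \<in> carrier C \<Longrightarrow> x \<sqsubseteq>\<^bsub>C\<^esub> y \<Longrightarrow> h x \<sqsubseteq>\<^bsub>C'\<^esub> h y"
    and "filtering C C' h"
    and "\<And>c S. c \<in> carrier C \<Longrightarrow> S \<in> J c \<Longrightarrow> gen_sieve C' (h ` S) \<in> J' (h c)"
  using assms by (auto simp: site_morphism_def isotone_def)

lemma inv_image_map_subset_iff:
  "I \<subseteq> carrier C \<Longrightarrow> I \<subseteq> inv_image_map C h K \<longleftrightarrow> h ` I \<subseteq> K"
  by (auto simp: inv_image_map_def)

text \<open>Preservation of covers says that preimages of ideals are ideals; this makes the preimage a
  right adjoint of \<open>A(h)\<close>, and so determines \<open>A(h)\<close> and its effect on joins.\<close>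

lemma J_ideal_inv_image:
  assumes h: "site_morphism C J C' J' h" and K: "J_ideal C' J' K"
  shows "J_ideal C J (inv_image_map C h K)"
  unfolding J_ideal_def lower_set_def
proof (intro conjI ballI impI)
  show "inv_image_map C h K \<subseteq> carrier C" by (auto simp: inv_image_map_def)
  fix x y assume x: "x \<in> inv_image_map C h K" and y: "y \<in> carrier C" "y \<sqsubseteq>\<^bsub>C\<^esub> x"
  then have "h y \<sqsubseteq>\<^bsub>C'\<^esub> h x" "h y \<in> carrier C'" "h x \<in> K"
    using site_morphismD(1,2)[OF h] by (auto simp: inv_image_map_def)
  then have "h y \<in> K" using lower_setD[OF J_ideal_lower[OF K]] by blast
  then show "y \<in> inv_image_map C h K" using y by (simp add: inv_image_map_def)
next
  fix c S assume c: "c \<in> carrier C" "S \<in> J c" "S \<subseteq> inv_image_map C h K"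
  then have "h ` S \<subseteq> K" by (auto simp: inv_image_map_def)
  then have "gen_sieve C' (h ` S) \<subseteq> K"
    using lower_setD[OF J_ideal_lower[OF K]] unfolding gen_sieve_def by blast
  then have "h c \<in> K"
    using J_idealD[OF K site_morphismD(1)[OF h c(1)] site_morphismD(4)[OF h c(1,2)]] by simp
  then show "c \<in> inv_image_map C h K" using c by (simp add: inv_image_map_def)
qed

lemma A_map_subset_iff:
  assumes "I \<subseteq> carrier C" "J_ideal C' J' K"
  shows "A_map C' J' h I \<subseteq> K \<longleftrightarrow> I \<subseteq> inv_image_map C h K"
  using assms by (simp add: A_map_def gen_J_ideal_subset_iff inv_image_map_subset_iff)

lemma J_ideal_A_map:
  assumes "\<And>c. c \<in> carrier C \<Longrightarrow> h c \<in> carrier C'" "I \<subseteq> carrier C"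
  shows "J_ideal C' J' (A_map C' J' h I)"
  unfolding A_map_def by (rule J_ideal_gen) (use assms in blast)

lemma ideal_eqI:
  assumes "J_ideal C J I" "J_ideal C J K" "\<And>M. J_ideal C J M \<Longrightarrow> I \<subseteq> M \<longleftrightarrow> K \<subseteq> M"
  shows "I = K"
  using assms by blast

lemma A_map_gen:
  assumes h: "site_morphism C J C' J' h" and X: "X \<subseteq> carrier C"
  shows "A_map C' J' h (gen_J_ideal C J X) = gen_J_ideal C' J' (h ` X)"
proof (rule ideal_eqI)
  have gen: "gen_J_ideal C J X \<subseteq> carrier C" by (rule J_ideal_subset_carrier[OF J_ideal_gen[OF X]])
  show "J_ideal C' J' (A_map C' J' h (gen_J_ideal C J X))"
    by (rule J_ideal_A_map[OF site_morphismD(1)[OF h] gen])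
  show "J_ideal C' J' (gen_J_ideal C' J' (h ` X))"
    using X site_morphismD(1)[OF h] by (intro J_ideal_gen) blast
  fix M assume M: "J_ideal C' J' M"
  show "A_map C' J' h (gen_J_ideal C J X) \<subseteq> M \<longleftrightarrow> gen_J_ideal C' J' (h ` X) \<subseteq> M"
    using X by (simp add: A_map_subset_iff[OF gen M] gen_J_ideal_subset_iff[OF M]
        gen_J_ideal_subset_iff[OF J_ideal_inv_image[OF h M]] inv_image_map_subset_iff)
qed

lemma A_map_down:
  assumes h: "site_morphism C J C' J' h" and J: "subcanonical_site C J" and J': "subcanonical_site C' J'"
    and c: "c \<in> carrier C"
  shows "A_map C' J' h (down C c) = down C' (h c)"
  using A_map_gen[OF h, of "{c}"] c site_morphismD(1)[OF h c]
  by (simp add: subcanonical_site.gen_J_ideal_singleton[OF J] subcanonical_site.gen_J_ideal_singleton[OF J'])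

lemma A_map_comp:
  assumes f: "site_morphism C J C' J' f" and g: "site_morphism C' J' C'' J'' g"
    and I: "I \<subseteq> carrier C"
  shows "A_map C'' J'' (compose (carrier C) g f) I = A_map C'' J'' g (A_map C' J' f I)"
proof -
  have fI: "f ` I \<subseteq> carrier C'" using I site_morphismD(1)[OF f] by blast
  have "compose (carrier C) g f ` I = g ` f ` I" using I by (auto simp: compose_def image_image)
  then show ?thesis using A_map_gen[OF g fI] by (simp add: A_map_def[of C'] A_map_def[of C'' J'' "compose _ _ _"])
qed

lemma A_map_identity: "J_ideal C J I \<Longrightarrow> A_map C J (\<lambda>x\<in>carrier C. x) I = I"
proof -
  assume I: "J_ideal C J I"
  then have "(\<lambda>x\<in>carrier C. x) ` I = I" using J_ideal_subset_carrier[OF I] by force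
  then show ?thesis using gen_J_ideal_ideal[OF I] by (simp add: A_map_def)
qed

lemma filtering_comp:
  assumes f: "filtering C C' f" and g: "filtering C' C'' g"
    and po: "partial_order C''"
    and fc: "\<And>c. c \<in> carrier C \<Longrightarrow> f c \<in> carrier C'" and gc: "\<And>c. c \<in> carrier C' \<Longrightarrow> g c \<in> carrier C''"
    and mono: "\<And>x y. x \<in> carrier C' \<Longrightarrow> y \<in> carrier C' \<Longrightarrow> x \<sqsubseteq>\<^bsub>C'\<^esub> y \<Longrightarrow> g x \<sqsubseteq>\<^bsub>C''\<^esub> g y"
  shows "filtering C C'' (compose (carrier C) g f)"
  unfolding filtering_def
proof (intro conjI ballI impI)
  fix d assume d: "d \<in> carrier C''"
  obtain c' where c': "c' \<in> carrier C'" "d \<sqsubseteq>\<^bsub>C''\<^esub> g c'" using g d unfolding filtering_def by blast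
  obtain c where c: "c \<in> carrier C" "c' \<sqsubseteq>\<^bsub>C'\<^esub> f c" using f c' unfolding filtering_def by blast
  have "d \<sqsubseteq>\<^bsub>C''\<^esub> g (f c)"
    using po_trans[OF po c'(2) mono[OF c'(1) fc[OF c(1)] c(2)] d gc[OF c'(1)] gc[OF fc[OF c(1)]]] .
  then show "\<exists>c\<in>carrier C. d \<sqsubseteq>\<^bsub>C''\<^esub> compose (carrier C) g f c" using c by (auto simp: compose_eq)
next
  fix d a b assume d: "d \<in> carrier C''" and a: "a \<in> carrier C" and b: "b \<in> carrier C"
    and le: "d \<sqsubseteq>\<^bsub>C''\<^esub> compose (carrier C) g f a \<and> d \<sqsubseteq>\<^bsub>C''\<^esub> compose (carrier C) g f b"
  then have "d \<sqsubseteq>\<^bsub>C''\<^esub> g (f a) \<and> d \<sqsubseteq>\<^bsub>C''\<^esub> g (f b)" by (simp add: compose_eq)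
  then obtain e where e: "e \<in> carrier C'" "e \<sqsubseteq>\<^bsub>C'\<^esub> f a" "e \<sqsubseteq>\<^bsub>C'\<^esub> f b" "d \<sqsubseteq>\<^bsub>C''\<^esub> g e"
    using g d fc[OF a] fc[OF b] unfolding filtering_def by blast
  then obtain c where c: "c \<in> carrier C" "c \<sqsubseteq>\<^bsub>C\<^esub> a" "c \<sqsubseteq>\<^bsub>C\<^esub> b" "e \<sqsubseteq>\<^bsub>C'\<^esub> f c"
    using f a b unfolding filtering_def by blast
  have "d \<sqsubseteq>\<^bsub>C''\<^esub> g (f c)"
    using po_trans[OF po e(4) mono[OF e(1) fc[OF c(1)] c(4)] d gc[OF e(1)] gc[OF fc[OF c(1)]]] .
  then show "\<exists>c\<in>carrier C. c \<sqsubseteq>\<^bsub>C\<^esub> a \<and> c \<sqsubseteq>\<^bsub>C\<^esub> b \<and> d \<sqsubseteq>\<^bsub>C''\<^esub> compose (carrier C) g f c"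
    using c by (auto simp: compose_eq)
qed

lemma gen_sieve_mono: "X \<subseteq> Y \<Longrightarrow> gen_sieve C X \<subseteq> gen_sieve C Y"
  by (auto simp: gen_sieve_def)

lemma site_morphism_comp:
  assumes f: "site_morphism C J C' J' f" and g: "site_morphism C' J' C'' J'' g"
    and C: "site C J" and C': "site C' J'" and C'': "site C'' J''"
  shows "site_morphism C J C'' J'' (compose (carrier C) g f)"
proof -
  interpret C: site C J by (rule C)
  interpret C': site C' J' by (rule C')
  interpret C'': site C'' J'' by (rule C'')
  note fc = site_morphismD(1)[OF f] and gc = site_morphismD(1)[OF g]
  show ?thesis
    unfolding site_morphism_def
  proof (intro conjI ballI)
    show "compose (carrier C) g f \<in> carrier C \<rightarrow> carrier C''" using fc gc by (auto simp: compose_eq)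
    show "isotone C C'' (compose (carrier C) g f)"
      using C.po C''.po site_morphismD(2)[OF f] site_morphismD(2)[OF g] fc
      by (simp add: isotone_def partial_order.axioms(1) compose_eq)
    show "filtering C C'' (compose (carrier C) g f)"
      by (rule filtering_comp[OF site_morphismD(3)[OF f] site_morphismD(3)[OF g] C''.po fc gc
            site_morphismD(2)[OF g]])
    fix c S assume c: "c \<in> carrier C" "S \<in> J c"
    have Sc: "S \<subseteq> carrier C" using C.cover_sieve[OF c] lower_set_subset_carrier by blast
    have fS: "f ` S \<subseteq> carrier C'" using Sc fc by blast
    have gfS: "g ` f ` S \<subseteq> carrier C''" using fS gc by blast
    have cov: "gen_sieve C'' (g ` gen_sieve C' (f ` S)) \<in> J'' (g (f c))"
      using site_morphismD(4)[OF g fc[OF c(1)] site_morphismD(4)[OF f c]] .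
    have "gen_sieve C'' (g ` gen_sieve C' (f ` S)) \<subseteq> gen_sieve C'' (g ` f ` S)"
    proof
      fix x assume "x \<in> gen_sieve C'' (g ` gen_sieve C' (f ` S))"
      then obtain y s where x: "x \<in> carrier C''" and y: "y \<in> carrier C'" "x \<sqsubseteq>\<^bsub>C''\<^esub> g y"
        and s: "s \<in> f ` S" "y \<sqsubseteq>\<^bsub>C'\<^esub> s"
        by (auto simp: gen_sieve_def)
      have sc: "s \<in> carrier C'" using s fS by blast
      have "x \<sqsubseteq>\<^bsub>C''\<^esub> g s"
        using po_trans[OF C''.po y(2) site_morphismD(2)[OF g y(1) sc s(2)] x gc[OF y(1)] gc[OF sc]] .
      then show "x \<in> gen_sieve C'' (g ` f ` S)" using x s by (auto simp: gen_sieve_def)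
    qed
    moreover have "gen_sieve C'' (g ` f ` S) \<subseteq> gen_sieve C'' (g ` gen_sieve C' (f ` S))"
      by (intro gen_sieve_mono image_mono gen_sieve_superset[OF C'.po fS])
    moreover have "compose (carrier C) g f ` S = g ` f ` S" using Sc by (auto simp: compose_def image_image)
    ultimately show "gen_sieve C'' (compose (carrier C) g f ` S) \<in> J'' (compose (carrier C) g f c)"
      using cov c(1) by (simp add: compose_eq)
  qed
qed

lemma site_morphism_identity:
  assumes "site C J"
  shows "site_morphism C J C J (\<lambda>x\<in>carrier C. x)"
proof -
  interpret site C J by (rule assms)
  show ?thesis
    unfolding site_morphism_def
  proof (intro conjI ballI)
    show "isotone C C (\<lambda>x\<in>carrier C. x)" using po by (simp add: isotone_def partial_order.axioms(1))
    show "filtering C C (\<lambda>x\<in>carrier C. x)"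
      unfolding filtering_def using po_refl[OF po] by auto
    fix c S assume c: "c \<in> carrier C" "S \<in> J c"
    then have S: "lower_set C S" using cover_sieve by blast
    then have "(\<lambda>x\<in>carrier C. x) ` S = S" using lower_set_subset_carrier[OF S] by force
    then show "gen_sieve C ((\<lambda>x\<in>carrier C. x) ` S) \<in> J ((\<lambda>x\<in>carrier C. x) c)"
      using c gen_sieve_lower[OF po S] by simp
  qed auto
qed

lemma inf_pres_A_map_iff:
  assumes h: "\<And>c. c \<in> carrier C \<Longrightarrow> h c \<in> carrier C'"
  shows "inf_pres (J_ideal_frame C J) (J_ideal_frame C' J') (A_map C' J' h) \<longleftrightarrow>
    (\<forall>\<A>\<subseteq>{I. J_ideal C J I}. A_map C' J' h (carrier C \<inter> \<Inter>\<A>) = carrier C' \<inter> \<Inter>(A_map C' J' h ` \<A>))"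
proof -
  have "\<Sqinter>\<^bsub>J_ideal_frame C' J'\<^esub> (A_map C' J' h ` \<A>) = carrier C' \<inter> \<Inter>(A_map C' J' h ` \<A>)"
    if "\<A> \<subseteq> {I. J_ideal C J I}" for \<A>
  proof (rule inf_J_ideal_frame)
    show "A_map C' J' h ` \<A> \<subseteq> {I. J_ideal C' J' I}"
      using that J_ideal_A_map[where h = h, OF h J_ideal_subset_carrier] by blast
  qed
  then show ?thesis
    unfolding inf_pres_def
    by (auto simp: complete_lattice_J_ideal_frame inf_J_ideal_frame)
qed

section \<open>The two categories\<close>

lemma ExtK_arrD:
  assumes "h \<in> ExtK_arr (C, J) (C', J')"
  shows "h \<in> carrier C \<rightarrow>\<^sub>E carrier C'" "site_morphism C J C' J' h"
    "inf_pres (J_ideal_frame C J) (J_ideal_frame C' J') (A_map C' J' h)"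
  using assms by (simp_all add: ExtK_arr_def)

lemma ExtK_arr_identity:
  assumes "site C J"
  shows "(\<lambda>x\<in>carrier C. x) \<in> ExtK_arr (C, J) (C, J)"
proof -
  have "inf_pres (J_ideal_frame C J) (J_ideal_frame C J) (A_map C J (\<lambda>x\<in>carrier C. x))"
  proof (subst inf_pres_A_map_iff)
    show "\<forall>\<A>\<subseteq>{I. J_ideal C J I}. A_map C J (\<lambda>x\<in>carrier C. x) (carrier C \<inter> \<Inter>\<A>) =
        carrier C \<inter> \<Inter>(A_map C J (\<lambda>x\<in>carrier C. x) ` \<A>)"
    proof (intro allI impI)
      fix \<A> assume A: "\<A> \<subseteq> {I. J_ideal C J I}"
      have "A_map C J (\<lambda>x\<in>carrier C. x) ` \<A> = (\<lambda>I. I) ` \<A>"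
        by (rule image_cong[OF refl]) (use A A_map_identity in blast)
      moreover have "J_ideal C J (carrier C \<inter> \<Inter>\<A>)" using A by (intro J_ideal_Inter) blast
      ultimately show "A_map C J (\<lambda>x\<in>carrier C. x) (carrier C \<inter> \<Inter>\<A>) =
          carrier C \<inter> \<Inter>(A_map C J (\<lambda>x\<in>carrier C. x) ` \<A>)"
        using A_map_identity by simp
    qed
  qed simp
  then show ?thesis using site_morphism_identity[OF assms] by (simp add: ExtK_arr_def)
qed

lemma ExtK_arr_comp:
  assumes f: "f \<in> ExtK_arr (C, J) (C', J')" and g: "g \<in> ExtK_arr (C', J') (C'', J'')"
    and C: "site C J" and C': "site C' J'" and C'': "site C'' J''"
  shows "compose (carrier C) g f \<in> ExtK_arr (C, J) (C'', J'')"
proof -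
  note fm = ExtK_arrD(2)[OF f] and gm = ExtK_arrD(2)[OF g]
  note fc = site_morphismD(1)[OF fm] and gc = site_morphismD(1)[OF gm]
  have gf: "site_morphism C J C'' J'' (compose (carrier C) g f)"
    by (rule site_morphism_comp[OF fm gm C C' C''])
  have comp: "A_map C'' J'' (compose (carrier C) g f) I = A_map C'' J'' g (A_map C' J' f I)"
    if "I \<subseteq> carrier C" for I
    by (rule A_map_comp[OF fm gm that])
  have "inf_pres (J_ideal_frame C J) (J_ideal_frame C'' J'') (A_map C'' J'' (compose (carrier C) g f))"
  proof (rule iffD2[OF inf_pres_A_map_iff], erule site_morphismD(1)[OF gf], intro allI impI)
    fix \<A> assume A: "\<A> \<subseteq> {I. J_ideal C J I}"
    have Af: "A_map C' J' f ` \<A> \<subseteq> {I. J_ideal C' J' I}"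
      using A J_ideal_A_map[where h = f, OF fc J_ideal_subset_carrier] by blast
    have "A_map C'' J'' (compose (carrier C) g f) ` \<A> = A_map C'' J'' g ` A_map C' J' f ` \<A>"
      unfolding image_image by (rule image_cong[OF refl]) (use A comp J_ideal_subset_carrier in blast)
    moreover have "A_map C' J' f (carrier C \<inter> \<Inter>\<A>) = carrier C' \<inter> \<Inter>(A_map C' J' f ` \<A>)"
      using ExtK_arrD(3)[OF f] A inf_pres_A_map_iff[where h = f, OF fc] by simp
    moreover have "A_map C'' J'' g (carrier C' \<inter> \<Inter>(A_map C' J' f ` \<A>)) =
        carrier C'' \<inter> \<Inter>(A_map C'' J'' g ` A_map C' J' f ` \<A>)"
      using ExtK_arrD(3)[OF g] Af inf_pres_A_map_iff[where h = g, OF gc] by simp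
    ultimately show "A_map C'' J'' (compose (carrier C) g f) (carrier C \<inter> \<Inter>\<A>) =
        carrier C'' \<inter> \<Inter>(A_map C'' J'' (compose (carrier C) g f) ` \<A>)"
      using comp[of "carrier C \<inter> \<Inter>\<A>"] by simp
  qed
  moreover have "compose (carrier C) g f \<in> carrier C \<rightarrow>\<^sub>E carrier C''"
    using fc gc by (auto simp: compose_def)
  ultimately show ?thesis using gf by (simp add: ExtK_arr_def)
qed

lemma ExtK_simps [simp]:
  "ob (ExtK \<K> J) = ExtK_ob \<K> J" "arr (ExtK \<K> J) = ExtK_arr"
  "idt (ExtK \<K> J) X = (\<lambda>x\<in>carrier (fst X). x)"
  "cmp (ExtK \<K> J) A B C g f = compose (carrier (fst A)) g f"
  by (simp_all add: ExtK_def)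

lemma ExtK_ob_site: "X \<in> ExtK_ob \<K> J \<Longrightarrow> site (fst X) (snd X)"
  by (auto simp: ExtK_ob_def site_def)

lemma ExtK_obI:
  assumes "partial_order (fst X)" "grothendieck_topology (fst X) (snd X)" "C \<in> \<K>"
    and "site_iso (fst X) (snd X) C (J C) \<phi>"
  shows "X \<in> ExtK_ob \<K> J"
proof -
  have "\<exists>C\<in>\<K>. \<exists>\<phi>. site_iso (fst X) (snd X) C (J C) \<phi>" using assms(3,4) by blast
  then show ?thesis using assms(1,2) by (simp add: ExtK_ob_def split_def)
qed

lemma category_ExtK: "category (ExtK \<K> J)"
  unfolding category_def ExtK_simps
proof (intro conjI ballI)
  fix X assume "X \<in> ExtK_ob \<K> J"
  from ExtK_arr_identity[OF ExtK_ob_site[OF this]]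
  show "(\<lambda>x\<in>carrier (fst X). x) \<in> ExtK_arr X X" by simp
next
  fix X Y Z f g
  assume X: "X \<in> ExtK_ob \<K> J" and Y: "Y \<in> ExtK_ob \<K> J" and Z: "Z \<in> ExtK_ob \<K> J"
    and "f \<in> ExtK_arr X Y" "g \<in> ExtK_arr Y Z"
  then show "compose (carrier (fst X)) g f \<in> ExtK_arr X Z"
    using ExtK_arr_comp[of f "fst X" "snd X" "fst Y" "snd Y" g "fst Z" "snd Z"]
      ExtK_ob_site[OF X] ExtK_ob_site[OF Y] ExtK_ob_site[OF Z] by simp
next
  fix X Y f assume "f \<in> ExtK_arr X Y"
  then have f: "f \<in> carrier (fst X) \<rightarrow>\<^sub>E carrier (fst Y)"
    using ExtK_arrD(1)[of f "fst X" "snd X" "fst Y" "snd Y"] by simp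
  show "compose (carrier (fst X)) f (\<lambda>x\<in>carrier (fst X). x) = f"
    using f by (intro extensionalityI[of _ "carrier (fst X)"]) (auto simp: compose_eq PiE_def)
  show "compose (carrier (fst X)) (\<lambda>x\<in>carrier (fst Y). x) f = f"
    using f by (intro extensionalityI[of _ "carrier (fst X)"]) (auto simp: compose_eq PiE_def)
next
  fix W X Y Z f g h assume "f \<in> ExtK_arr W X"
  then have "f \<in> carrier (fst W) \<rightarrow>\<^sub>E carrier (fst X)"
    using ExtK_arrD(1)[of f "fst W" "snd W" "fst X" "snd X"] by simp
  then have "f \<in> carrier (fst W) \<rightarrow> carrier (fst X)" by (simp add: PiE_def)
  then show "compose (carrier (fst W)) h (compose (carrier (fst W)) g f) =
      compose (carrier (fst W)) (compose (carrier (fst X)) h g) f"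
    by (rule compose_assoc)
qed

lemma ExtH_simps [simp]:
  "ob (ExtH \<H> U) = {D. \<exists>D\<^sub>0\<in>\<H>. isomorphic_posets D D\<^sub>0}"
  "arr (ExtH \<H> U) D D' = {h \<in> carrier D \<rightarrow>\<^sub>E carrier D'. isotone D D' h \<and>
     (\<forall>u. U_compact U (lower_set_frame D') u \<longrightarrow> U_compact U (lower_set_frame D) (inv_image_map D h u))}"
  "idt (ExtH \<H> U) D = (\<lambda>x\<in>carrier D. x)"
  "cmp (ExtH \<H> U) A B C g f = compose (carrier A) g f"
  by (simp_all add: ExtH_def)

lemma ExtH_ob_po: "D \<in> ob (ExtH \<H> U) \<Longrightarrow> partial_order D"
  by (auto simp: isomorphic_posets_def poset_iso_def)

lemma inv_image_identity: "lower_set D V \<Longrightarrow> inv_image_map D (\<lambda>x\<in>carrier D. x) V = V"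
  by (auto simp: inv_image_map_def dest: lower_set_carrierD)

lemma inv_image_compose:
  assumes "f \<in> carrier D \<rightarrow> carrier D'"
  shows "inv_image_map D (compose (carrier D) g f) V = inv_image_map D f (inv_image_map D' g V)"
  using assms by (auto simp: inv_image_map_def compose_eq)

lemma category_ExtH: "category (ExtH \<H> U)"
  unfolding category_def
proof (intro conjI ballI)
  fix D assume "D \<in> ob (ExtH \<H> U)"
  then have "partial_order D" by (rule ExtH_ob_po)
  then have "isotone D D (\<lambda>x\<in>carrier D. x)" by (simp add: isotone_def partial_order.axioms(1))
  moreover have "U_compact U (lower_set_frame D) (inv_image_map D (\<lambda>x\<in>carrier D. x) u)"
    if "U_compact U (lower_set_frame D) u" for u
  proof -
    have "lower_set D u" using that by (simp add: U_compact_def)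
    then show ?thesis using that inv_image_identity by metis
  qed
  ultimately show "idt (ExtH \<H> U) D \<in> arr (ExtH \<H> U) D D" by simp
next
  fix X Y Z f g assume X: "X \<in> ob (ExtH \<H> U)" and Z: "Z \<in> ob (ExtH \<H> U)"
    and f: "f \<in> arr (ExtH \<H> U) X Y" and g: "g \<in> arr (ExtH \<H> U) Y Z"
  have fc: "f \<in> carrier X \<rightarrow> carrier Y" and gc: "g \<in> carrier Y \<rightarrow> carrier Z"
    using f g by (auto simp: PiE_def)
  have "isotone X Z (compose (carrier X) g f)"
    using f g fc unfolding ExtH_simps isotone_def by (simp add: compose_eq Pi_iff)
  moreover have "compose (carrier X) g f \<in> carrier X \<rightarrow>\<^sub>E carrier Z"
    using fc gc by (auto simp: compose_def)
  moreover have "U_compact U (lower_set_frame X) (inv_image_map X (compose (carrier X) g f) u)"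
    if "U_compact U (lower_set_frame Z) u" for u
    unfolding inv_image_compose[OF fc] using f g that by simp
  ultimately show "cmp (ExtH \<H> U) X Y Z g f \<in> arr (ExtH \<H> U) X Z" by simp
next
  fix X Y f assume "f \<in> arr (ExtH \<H> U) X Y"
  then have f: "f \<in> carrier X \<rightarrow>\<^sub>E carrier Y" by simp
  show "cmp (ExtH \<H> U) X X Y f (idt (ExtH \<H> U) X) = f"
    using f unfolding ExtH_simps
    by (intro extensionalityI[of _ "carrier X"]) (auto simp: compose_eq PiE_def)
  show "cmp (ExtH \<H> U) X Y Y (idt (ExtH \<H> U) Y) f = f"
    using f unfolding ExtH_simps
    by (intro extensionalityI[of _ "carrier X"]) (auto simp: compose_eq PiE_def)
next
  fix W X Y Z f g h assume "f \<in> arr (ExtH \<H> U) W X"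
  then have "f \<in> carrier W \<rightarrow> carrier X" by (simp add: PiE_def)
  then show "cmp (ExtH \<H> U) W Y Z h (cmp (ExtH \<H> U) W X Y g f) =
      cmp (ExtH \<H> U) W X Z (cmp (ExtH \<H> U) X Y Z h g) f"
    unfolding ExtH_simps by (rule compose_assoc)
qed

section \<open>Mates\<close>

text \<open>Preservation of intersections gives each \<open>d\<close> a least lower set whose image contains it, and
  preservation of unions makes that lower set principal; its generator is the image of \<open>d\<close>.\<close>

lemma complete_hom_eq_inv_image:
  assumes po: "partial_order D'"
    and sup: "\<And>\<V>. \<V> \<subseteq> {V. lower_set D' V} \<Longrightarrow> B (\<Union>\<V>) = \<Union>(B ` \<V>)"
    and inf: "\<And>\<V>. \<V> \<subseteq> {V. lower_set D' V} \<Longrightarrow> B (carrier D' \<inter> \<Inter>\<V>) = carrier D \<inter> \<Inter>(B ` \<V>)"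
    and closed: "\<And>V. lower_set D' V \<Longrightarrow> B V \<subseteq> carrier D"
  obtains k where "k \<in> carrier D \<rightarrow>\<^sub>E carrier D'" "\<And>V. lower_set D' V \<Longrightarrow> B V = inv_image_map D k V"
proof -
  have mono: "B V \<subseteq> B W" if "lower_set D' V" "lower_set D' W" "V \<subseteq> W" for V W
    using sup[of "{V, W}"] that by (auto simp: Un_absorb1)
  have "\<exists>w\<in>carrier D'. \<forall>V. lower_set D' V \<longrightarrow> (d \<in> B V \<longleftrightarrow> w \<in> V)" if d: "d \<in> carrier D" for d
  proof -
    define W where "W = carrier D' \<inter> \<Inter>{V. lower_set D' V \<and> d \<in> B V}"
    have "B W = carrier D \<inter> \<Inter>(B ` {V. lower_set D' V \<and> d \<in> B V})"
      unfolding W_def by (rule inf) blast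
    then have dW: "d \<in> B W" using d by blast
    have W: "lower_set D' W" unfolding W_def lower_set_def by blast
    have downs: "down D' ` W \<subseteq> {V. lower_set D' V}"
      using lower_set_down[OF po] lower_set_carrierD[OF W] by blast
    have "B W = \<Union>(B ` down D' ` W)"
      using sup[OF downs] lower_set_eq_Union_down[OF po W] by simp
    then obtain w where w: "w \<in> W" "d \<in> B (down D' w)" using dW by blast
    then have wc: "w \<in> carrier D'" using lower_set_carrierD[OF W] by blast
    have "d \<in> B V \<longleftrightarrow> w \<in> V" if V: "lower_set D' V" for V
    proof
      assume "d \<in> B V"
      then show "w \<in> V" using w(1) V unfolding W_def by blast
    next
      assume "w \<in> V"
      then have "down D' w \<subseteq> V" using down_subset_iff[OF po V wc] by simp
      then show "d \<in> B V" using mono[OF lower_set_down[OF po wc] V] w(2) by blast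
    qed
    then show ?thesis using wc by blast
  qed
  then obtain k where k: "\<And>d. d \<in> carrier D \<Longrightarrow>
      k d \<in> carrier D' \<and> (\<forall>V. lower_set D' V \<longrightarrow> (d \<in> B V \<longleftrightarrow> k d \<in> V))"
    by metis
  show thesis
  proof (rule that)
    show "restrict k (carrier D) \<in> carrier D \<rightarrow>\<^sub>E carrier D'" using k by auto
    fix V assume V: "lower_set D' V"
    then show "B V = inv_image_map D (restrict k (carrier D)) V"
      using k closed[OF V] by (auto simp: inv_image_map_def)
  qed
qed

text \<open>
  A pairing of a site with a poset \<open>D\<close> is an isomorphism between the frame of ideals of the site and
  the frame of lower sets of \<open>D\<close>.  It presents the elements of \<open>D\<close> as the supercompact ideals and
  the elements of the site as the \<open>U\<close>-compact lower sets.
\<close>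

locale pairing = subcanonical_site C J
  for U :: "'a set gorder \<Rightarrow> 'a set set \<Rightarrow> bool" and C :: "'a gorder" and J
    and D :: "'a gorder" and \<theta> :: "'a set \<Rightarrow> 'a set" +
  assumes U_invariant: "invariant_of_families U"
    and compact: "\<And>u. U_compact U (J_ideal_frame C J) u \<longleftrightarrow> (\<exists>c\<in>carrier C. u = down C c)"
    and D_po: "partial_order D"
    and iso: "poset_iso (J_ideal_frame C J) (lower_set_frame D) \<theta>"
begin

lemma \<theta>_lower: "J_ideal C J I \<Longrightarrow> lower_set D (\<theta> I)"
  using poset_iso_closed[OF iso, of I] by simp

lemma \<theta>_subset_iff: "J_ideal C J I \<Longrightarrow> J_ideal C J K \<Longrightarrow> \<theta> I \<subseteq> \<theta> K \<longleftrightarrow> I \<subseteq> K"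
  using poset_iso_le_iff[OF iso, of I K] by simp

lemma \<theta>_eq_iff: "J_ideal C J I \<Longrightarrow> J_ideal C J K \<Longrightarrow> \<theta> I = \<theta> K \<longleftrightarrow> I = K"
  using poset_iso_eq_iff[OF iso, of I K] by simp

lemma \<theta>_surj:
  assumes "lower_set D V"
  obtains I where "J_ideal C J I" "V = \<theta> I"
  using poset_iso_surj[OF iso, of V] assms by auto

lemma \<theta>_sup:
  assumes A: "\<A> \<subseteq> {I. J_ideal C J I}"
  shows "\<theta> (gen_J_ideal C J (\<Union>\<A>)) = \<Union>(\<theta> ` \<A>)"
proof -
  have "\<theta> ` \<A> \<subseteq> {V. lower_set D V}" using A \<theta>_lower by blast
  then show ?thesis
    using poset_iso_sup[OF iso complete_lattice_J_ideal_frame, of \<A>] A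
    by (simp add: sup_J_ideal_frame sup_lower_set_frame)
qed

lemma \<theta>_inf:
  assumes A: "\<A> \<subseteq> {I. J_ideal C J I}"
  shows "\<theta> (carrier C \<inter> \<Inter>\<A>) = carrier D \<inter> \<Inter>(\<theta> ` \<A>)"
proof -
  have "\<theta> ` \<A> \<subseteq> {V. lower_set D V}" using A \<theta>_lower by blast
  then show ?thesis
    using poset_iso_inf[OF iso complete_lattice_J_ideal_frame, of \<A>] A
    by (simp add: inf_J_ideal_frame inf_lower_set_frame[OF D_po])
qed

lemma \<theta>_gen:
  assumes "X \<subseteq> carrier C"
  shows "\<theta> (gen_J_ideal C J X) = (\<Union>c\<in>X. \<theta> (down C c))"
proof -
  have "down C ` X \<subseteq> {I. J_ideal C J I}" using assms J_ideal_down by blast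
  from \<theta>_sup[OF this] show ?thesis using gen_J_ideal_down_image[OF assms] by (simp add: image_image)
qed

lemma U_compact_lower_set_iff:
  "U_compact U (lower_set_frame D) v \<longleftrightarrow> (\<exists>c\<in>carrier C. v = \<theta> (down C c))"
proof -
  have "{u. U_compact U (J_ideal_frame C J) u} = down C ` carrier C"
    unfolding compact by blast
  then have "{v. U_compact U (lower_set_frame D) v} = \<theta> ` down C ` carrier C"
    using U_compact_image[OF U_invariant is_frame_J_ideal_frame is_frame_lower_set_frame[OF D_po] iso] by simp
  then have "U_compact U (lower_set_frame D) v \<longleftrightarrow> v \<in> \<theta> ` down C ` carrier C" by blast
  then show ?thesis by (simp add: image_iff)
qed

end

text \<open>
  Arrows \<open>h\<close> from \<open>C'\<close> to \<open>C\<close> and \<open>k\<close> from \<open>D\<close> to \<open>D'\<close> are mates if the two pairings identify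
  the frame homomorphism \<open>A(h)\<close> with the inverse image along \<open>k\<close>.
\<close>

locale two_pairings = P: pairing U C J D \<theta> + P': pairing U C' J' D' \<theta>'
  for U :: "'a set gorder \<Rightarrow> 'a set set \<Rightarrow> bool" and C J D \<theta> C' J' D' \<theta>'
begin

definition mate :: "('a \<Rightarrow> 'a) \<Rightarrow> ('a \<Rightarrow> 'a) \<Rightarrow> bool" where
  "mate h k \<longleftrightarrow> (\<forall>I. J_ideal C' J' I \<longrightarrow> \<theta> (A_map C J h I) = inv_image_map D k (\<theta>' I))"

lemma mateD: "mate h k \<Longrightarrow> J_ideal C' J' I \<Longrightarrow> \<theta> (A_map C J h I) = inv_image_map D k (\<theta>' I)"
  by (simp add: mate_def)

lemma mate_down:
  assumes h: "site_morphism C' J' C J h" and m: "mate h k" and c: "c \<in> carrier C'"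
  shows "\<theta> (down C (h c)) = inv_image_map D k (\<theta>' (down C' c))"
  using mateD[OF m P'.J_ideal_down[OF c]]
  unfolding A_map_down[OF h P'.subcanonical_site_axioms P.subcanonical_site_axioms c] .

lemma mate_unique_left:
  assumes h: "site_morphism C' J' C J h" "h \<in> carrier C' \<rightarrow>\<^sub>E carrier C" "mate h k"
    and h': "site_morphism C' J' C J h'" "h' \<in> carrier C' \<rightarrow>\<^sub>E carrier C" "mate h' k"
  shows "h = h'"
proof (rule PiE_ext[OF h(2) h'(2)])
  fix c assume c: "c \<in> carrier C'"
  have hc: "h c \<in> carrier C" "h' c \<in> carrier C"
    using site_morphismD(1)[OF h(1) c] site_morphismD(1)[OF h'(1) c] .
  have "\<theta> (down C (h c)) = \<theta> (down C (h' c))"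
    using mate_down[OF h(1,3) c] mate_down[OF h'(1,3) c] by simp
  then have "down C (h c) = down C (h' c)"
    using P.\<theta>_eq_iff[OF P.J_ideal_down[OF hc(1)] P.J_ideal_down[OF hc(2)]] by simp
  then show "h c = h' c" using down_inject[OF P.po hc] by simp
qed

lemma mate_inv_image:
  assumes "mate h k" "lower_set D' V"
  obtains I where "J_ideal C' J' I" "V = \<theta>' I" "inv_image_map D k V = \<theta> (A_map C J h I)"
proof -
  obtain I where I: "J_ideal C' J' I" "V = \<theta>' I" using P'.\<theta>_surj[OF assms(2)] .
  show thesis by (rule that[OF I]) (simp add: I(2) mateD[OF assms(1) I(1)])
qed

lemma mate_unique_right:
  assumes k: "k \<in> carrier D \<rightarrow>\<^sub>E carrier D'" "mate h k" and k': "k' \<in> carrier D \<rightarrow>\<^sub>E carrier D'" "mate h k'"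
  shows "k = k'"
proof (rule PiE_ext[OF k(1) k'(1)])
  fix d assume d: "d \<in> carrier D"
  have kd: "k d \<in> carrier D'" "k' d \<in> carrier D'" using PiE_mem[OF k(1) d] PiE_mem[OF k'(1) d] .
  have "k d \<in> V \<longleftrightarrow> k' d \<in> V" if V: "lower_set D' V" for V
  proof -
    obtain I where "J_ideal C' J' I" "V = \<theta>' I" using P'.\<theta>_surj[OF V] .
    then have "inv_image_map D k V = inv_image_map D k' V" using k(2) k'(2) by (simp add: mate_def)
    then show ?thesis using d unfolding inv_image_map_def by blast
  qed
  from this[OF lower_set_down[OF P'.D_po kd(1)]] this[OF lower_set_down[OF P'.D_po kd(2)]]
  have "k d \<sqsubseteq>\<^bsub>D'\<^esub> k' d" "k' d \<sqsubseteq>\<^bsub>D'\<^esub> k d"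
    using self_mem_down[OF P'.D_po kd(1)] self_mem_down[OF P'.D_po kd(2)] by (simp_all add: mem_down)
  then show "k d = k' d" using po_antisym[OF P'.D_po _ _ kd] by simp
qed

lemma A_map_ideal:
  assumes "site_morphism C' J' C J h" "J_ideal C' J' I"
  shows "J_ideal C J (A_map C J h I)"
  by (rule J_ideal_A_map[OF site_morphismD(1)[OF assms(1)] J_ideal_subset_carrier[OF assms(2)]])

lemma mate_isotone:
  assumes h: "site_morphism C' J' C J h" and k: "k \<in> carrier D \<rightarrow>\<^sub>E carrier D'" and m: "mate h k"
  shows "isotone D D' k"
  unfolding isotone_def
proof (intro conjI ballI impI)
  show "weak_partial_order D" "weak_partial_order D'"
    using P.D_po P'.D_po by (simp_all add: partial_order.axioms(1))
  fix x y assume xy: "x \<in> carrier D" "y \<in> carrier D" "x \<sqsubseteq>\<^bsub>D\<^esub> y"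
  have ky: "k y \<in> carrier D'" by (rule PiE_mem[OF k xy(2)])
  obtain I where I: "J_ideal C' J' I" "down D' (k y) = \<theta>' I"
    "inv_image_map D k (down D' (k y)) = \<theta> (A_map C J h I)"
    using mate_inv_image[OF m lower_set_down[OF P'.D_po ky]] .
  have "lower_set D (inv_image_map D k (down D' (k y)))"
    unfolding I(3) by (rule P.\<theta>_lower[OF A_map_ideal[OF h I(1)]])
  moreover have "y \<in> inv_image_map D k (down D' (k y))"
    using xy self_mem_down[OF P'.D_po ky] by (simp add: inv_image_map_def)
  ultimately have "x \<in> inv_image_map D k (down D' (k y))" using lower_setD xy by metis
  then show "k x \<sqsubseteq>\<^bsub>D'\<^esub> k y" by (simp add: inv_image_map_def mem_down)
qed

lemma mate_compact:
  assumes h: "site_morphism C' J' C J h" and m: "mate h k" and u: "U_compact U (lower_set_frame D') u"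
  shows "U_compact U (lower_set_frame D) (inv_image_map D k u)"
proof -
  obtain c where c: "c \<in> carrier C'" "u = \<theta>' (down C' c)"
    using u unfolding P'.U_compact_lower_set_iff by (elim bexE)
  have "inv_image_map D k u = \<theta> (down C (h c))" unfolding c(2) mate_down[OF h m c(1)] ..
  then show ?thesis
    using site_morphismD(1)[OF h c(1)] unfolding P.U_compact_lower_set_iff by (rule bexI)
qed

lemma mate_ex_right:
  assumes h: "h \<in> ExtK_arr (C', J') (C, J)"
  obtains k where "k \<in> carrier D \<rightarrow>\<^sub>E carrier D'" "mate h k"
proof -
  note hm = ExtK_arrD(2)[OF h]
  note hc = site_morphismD(1)[OF hm]
  define \<iota> where "\<iota> V = (SOME I. J_ideal C' J' I \<and> V = \<theta>' I)" for V
  have \<iota>: "J_ideal C' J' (\<iota> V) \<and> V = \<theta>' (\<iota> V)" if "lower_set D' V" for V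
    unfolding \<iota>_def by (rule someI_ex) (use P'.\<theta>_surj[OF that] in blast)
  have \<iota>_\<theta>: "\<iota> (\<theta>' I) = I" if "J_ideal C' J' I" for I
    using \<iota>[OF P'.\<theta>_lower[OF that]] P'.\<theta>_eq_iff[OF that] by metis
  define B where "B V = \<theta> (A_map C J h (\<iota> V))" for V
  have B\<theta>: "B (\<theta>' I) = \<theta> (A_map C J h I)" if "J_ideal C' J' I" for I
    by (simp add: B_def \<iota>_\<theta>[OF that])
  \<comment> \<open>Families of lower sets are written as images of families of ideals, where \<open>B\<close> is \<open>A(h)\<close>.\<close>
  have family: "\<exists>\<A>\<subseteq>{I. J_ideal C' J' I}. \<V> = \<theta>' ` \<A>" if V: "\<V> \<subseteq> {V. lower_set D' V}" for \<V>
  proof (intro exI conjI)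
    show "\<iota> ` \<V> \<subseteq> {I. J_ideal C' J' I}" using V \<iota> by blast
    have "(\<lambda>V. \<theta>' (\<iota> V)) ` \<V> = (\<lambda>V. V) ` \<V>"
      by (rule image_cong[OF refl]) (use V \<iota> in \<open>metis mem_Collect_eq subsetD\<close>)
    then show "\<V> = \<theta>' ` \<iota> ` \<V>" by (simp add: image_image)
  qed
  have A_image: "A_map C J h ` \<A> \<subseteq> {I. J_ideal C J I}" "B ` \<theta>' ` \<A> = \<theta> ` A_map C J h ` \<A>"
    if "\<A> \<subseteq> {I. J_ideal C' J' I}" for \<A>
  proof -
    show "A_map C J h ` \<A> \<subseteq> {I. J_ideal C J I}" using that A_map_ideal[OF hm] by blast
    show "B ` \<theta>' ` \<A> = \<theta> ` A_map C J h ` \<A>"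
      unfolding image_image by (rule image_cong[OF refl]) (use that B\<theta> in blast)
  qed
  have sup: "B (\<Union>\<V>) = \<Union>(B ` \<V>)" if V: "\<V> \<subseteq> {V. lower_set D' V}" for \<V>
  proof -
    obtain \<A> where A: "\<A> \<subseteq> {I. J_ideal C' J' I}" "\<V> = \<theta>' ` \<A>" using family[OF V] by blast
    have Ac: "\<Union>\<A> \<subseteq> carrier C'" using A(1) J_ideal_subset_carrier by blast
    have "A_map C J h (gen_J_ideal C' J' (\<Union>\<A>)) = gen_J_ideal C J (h ` \<Union>\<A>)"
      by (rule A_map_gen[OF hm Ac])
    also have "\<dots> = gen_J_ideal C J (\<Union>(A_map C J h ` \<A>))"
    proof (rule gen_J_ideal_eqI)
      show "h ` \<Union>\<A> \<subseteq> carrier C" using Ac hc by blast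
      have AA: "\<Union>(A_map C J h ` \<A>) \<subseteq> carrier C"
        using A_image(1)[OF A(1)] J_ideal_subset_carrier by blast
      then show "J_ideal C J (gen_J_ideal C J (\<Union>(A_map C J h ` \<A>)))" by (rule J_ideal_gen)
      fix M assume M: "J_ideal C J M"
      have "A_map C J h I \<subseteq> M \<longleftrightarrow> h ` I \<subseteq> M" for I
        unfolding A_map_def by (rule gen_J_ideal_subset_iff[OF M])
      then show "h ` \<Union>\<A> \<subseteq> M \<longleftrightarrow> gen_J_ideal C J (\<Union>(A_map C J h ` \<A>)) \<subseteq> M"
        by (simp add: gen_J_ideal_subset_iff[OF M] image_Union UN_subset_iff)
    qed
    finally have "\<theta> (A_map C J h (gen_J_ideal C' J' (\<Union>\<A>))) = \<Union>(\<theta> ` A_map C J h ` \<A>)"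
      using P.\<theta>_sup[OF A_image(1)[OF A(1)]] by simp
    then show ?thesis
      using P'.\<theta>_sup[OF A(1)] B\<theta>[OF J_ideal_gen[OF Ac]] A_image(2)[OF A(1)] A(2) by simp
  qed
  have inf: "B (carrier D' \<inter> \<Inter>\<V>) = carrier D \<inter> \<Inter>(B ` \<V>)" if V: "\<V> \<subseteq> {V. lower_set D' V}" for \<V>
  proof -
    obtain \<A> where A: "\<A> \<subseteq> {I. J_ideal C' J' I}" "\<V> = \<theta>' ` \<A>" using family[OF V] by blast
    have "A_map C J h (carrier C' \<inter> \<Inter>\<A>) = carrier C \<inter> \<Inter>(A_map C J h ` \<A>)"
      using ExtK_arrD(3)[OF h] A(1) inf_pres_A_map_iff[where h = h, OF hc] by simp
    moreover have "J_ideal C' J' (carrier C' \<inter> \<Inter>\<A>)" using A(1) by (intro J_ideal_Inter) blast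
    ultimately show ?thesis
      using P.\<theta>_inf[OF A_image(1)[OF A(1)]] P'.\<theta>_inf[OF A(1)] B\<theta> A_image(2)[OF A(1)] A(2) by metis
  qed
  have closed: "B V \<subseteq> carrier D" if "lower_set D' V" for V
    unfolding B_def using \<iota>[OF that] A_map_ideal[OF hm] P.\<theta>_lower lower_set_subset_carrier by blast
  obtain k where k: "k \<in> carrier D \<rightarrow>\<^sub>E carrier D'" "\<And>V. lower_set D' V \<Longrightarrow> B V = inv_image_map D k V"
    using complete_hom_eq_inv_image[OF P'.D_po sup inf closed] by blast
  have "mate h k" unfolding mate_def using k(2)[OF P'.\<theta>_lower] B\<theta> by simp
  then show thesis using that k(1) by blast
qed

text \<open>
  The left adjoint of \<open>A(h)\<close> exists because inverse image along the mate \<open>k\<close> has the left adjoint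
  that generates a lower set from the image under \<open>k\<close>; this takes principal lower sets to principal
  lower sets, and is given on them by \<open>k\<close>.
\<close>

lemma mate_shriek:
  assumes hm: "site_morphism C' J' C J h" and k: "k \<in> carrier D \<rightarrow>\<^sub>E carrier D'" and m: "mate h k"
    and I: "J_ideal C J I" and d: "d \<in> carrier D" and Id: "\<theta> I = down D d"
  shows "J_ideal C' J' (A_shriek C' J' C J h I)" "\<theta>' (A_shriek C' J' C J h I) = down D' (k d)"
proof -
  have kc: "k x \<in> carrier D'" if "x \<in> carrier D" for x using PiE_mem[OF k that] .
  have Ai: "J_ideal C J (A_map C J h K)" if "J_ideal C' J' K" for K by (rule A_map_ideal[OF hm that])
  have adj: "L \<subseteq> A_map C J h K \<longleftrightarrow> k ` \<theta> L \<subseteq> \<theta>' K" if L: "J_ideal C J L" and K: "J_ideal C' J' K" for L K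
  proof -
    have "L \<subseteq> A_map C J h K \<longleftrightarrow> \<theta> L \<subseteq> inv_image_map D k (\<theta>' K)"
      using P.\<theta>_subset_iff[OF L Ai[OF K]] m K by (simp add: mate_def)
    then show ?thesis
      using inv_image_map_subset_iff[OF lower_set_subset_carrier[OF P.\<theta>_lower[OF L]]] by simp
  qed
  let ?G = "\<lambda>l. \<lparr>orderA = J_ideal_frame C J, orderB = J_ideal_frame C' J', lower = l, upper = A_map C J h\<rparr>"
  have "\<exists>K. J_ideal C' J' K \<and> \<theta>' K = gen_sieve D' (k ` \<theta> L)" if L: "J_ideal C J L" for L
  proof -
    have "k ` \<theta> L \<subseteq> carrier D'" using kc lower_set_carrierD[OF P.\<theta>_lower[OF L]] by blast
    then have "lower_set D' (gen_sieve D' (k ` \<theta> L))" by (rule lower_set_gen_sieve[OF P'.D_po])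
    then show ?thesis using P'.\<theta>_surj by metis
  qed
  then obtain l where l: "\<And>L. J_ideal C J L \<Longrightarrow> J_ideal C' J' (l L) \<and> \<theta>' (l L) = gen_sieve D' (k ` \<theta> L)"
    by metis
  have "galois_connection (?G l)"
  proof (intro galois_connection.intro connection.intro galois_connection_axioms.intro)
    fix L K assume "L \<in> carrier (orderA (?G l))" "K \<in> carrier (orderB (?G l))"
    then have L: "J_ideal C J L" and K: "J_ideal C' J' K" by simp_all
    have "k ` \<theta> L \<subseteq> carrier D'" using kc lower_set_carrierD[OF P.\<theta>_lower[OF L]] by blast
    then have "l L \<subseteq> K \<longleftrightarrow> L \<subseteq> A_map C J h K"
      using adj[OF L K] l[OF L] P'.\<theta>_subset_iff[of "l L" K] K
        gen_sieve_subset_iff[OF P'.D_po _ P'.\<theta>_lower[OF K]] by simp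
    then show "lower (?G l) L \<sqsubseteq>\<^bsub>orderB (?G l)\<^esub> K \<longleftrightarrow> L \<sqsubseteq>\<^bsub>orderA (?G l)\<^esub> upper (?G l) K" by simp
  qed (use l Ai in \<open>auto simp: partial_order_J_ideal_frame\<close>)
  then have gc: "galois_connection (?G (A_shriek C' J' C J h))"
    unfolding A_shriek_def by (rule someI[of "\<lambda>l. galois_connection (?G l)"])
  let ?K = "A_shriek C' J' C J h I"
  have "?K \<in> carrier (J_ideal_frame C' J')"
    using connection.lower_closed[OF galois_connection.axioms(1)[OF gc]] I by simp
  then show K: "J_ideal C' J' ?K" by simp
  have K_le: "?K \<subseteq> M \<longleftrightarrow> k ` \<theta> I \<subseteq> \<theta>' M" if M: "J_ideal C' J' M" for M
    using galois_connection.galois_property[OF gc] adj[OF I M] I M by simp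
  have below: "\<theta>' ?K \<subseteq> V \<longleftrightarrow> k d \<in> V" if V: "lower_set D' V" for V
  proof -
    obtain M where M: "J_ideal C' J' M" "V = \<theta>' M" using P'.\<theta>_surj[OF V] .
    obtain N where N: "J_ideal C' J' N" "V = \<theta>' N" "inv_image_map D k V = \<theta> (A_map C J h N)"
      using mate_inv_image[OF m V] .
    have low: "lower_set D (inv_image_map D k V)" unfolding N(3) by (rule P.\<theta>_lower[OF Ai[OF N(1)]])
    have "\<theta>' ?K \<subseteq> V \<longleftrightarrow> down D d \<subseteq> inv_image_map D k V"
      using P'.\<theta>_subset_iff[OF K M(1)] K_le[OF M(1)] M(2) Id
      by (simp add: inv_image_map_subset_iff[OF lower_set_subset_carrier[OF lower_set_down[OF P.D_po d]]])
    also have "\<dots> \<longleftrightarrow> d \<in> inv_image_map D k V" by (rule down_subset_iff[OF P.D_po low d])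
    finally show ?thesis using d by (simp add: inv_image_map_def)
  qed
  show "\<theta>' ?K = down D' (k d)"
  proof
    show "\<theta>' ?K \<subseteq> down D' (k d)"
      using below[OF lower_set_down[OF P'.D_po kc[OF d]]] self_mem_down[OF P'.D_po kc[OF d]] by simp
    show "down D' (k d) \<subseteq> \<theta>' ?K"
      using below[OF P'.\<theta>_lower[OF K]] down_subset_iff[OF P'.D_po P'.\<theta>_lower[OF K] kc[OF d]] by simp
  qed
qed

text \<open>In the other direction \<open>h\<close> is the restriction of the inverse image to compact elements; the
  filtering condition is the only part of being a morphism of sites that this does not supply.\<close>

lemma mate_left:
  assumes k: "k \<in> carrier D \<rightarrow>\<^sub>E carrier D'"
    and filt: "filtering (U_compact_poset U D') (U_compact_poset U D) (inv_image_map D k)"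
    and hc: "h \<in> carrier C' \<rightarrow>\<^sub>E carrier C"
    and h: "\<And>c. c \<in> carrier C' \<Longrightarrow> \<theta> (down C (h c)) = inv_image_map D k (\<theta>' (down C' c))"
  shows "h \<in> ExtK_arr (C', J') (C, J)" "mate h k"
proof -
  have hcl: "h c \<in> carrier C" if "c \<in> carrier C'" for c by (rule PiE_mem[OF hc that])
  have inv_UN: "inv_image_map D k (\<Union>c\<in>X. F c) = (\<Union>c\<in>X. inv_image_map D k (F c))" for X and F :: "'a \<Rightarrow> 'a set"
    by (auto simp: inv_image_map_def)
  have le_iff: "c \<sqsubseteq>\<^bsub>C\<^esub> e \<longleftrightarrow> \<theta> (down C c) \<subseteq> \<theta> (down C e)" if "c \<in> carrier C" "e \<in> carrier C" for c e
    using P.\<theta>_subset_iff[OF P.J_ideal_down[OF that(1)] P.J_ideal_down[OF that(2)]]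
      down_subset_down_iff[OF P.po that] by simp
  have le_iff': "c \<sqsubseteq>\<^bsub>C'\<^esub> e \<longleftrightarrow> \<theta>' (down C' c) \<subseteq> \<theta>' (down C' e)" if "c \<in> carrier C'" "e \<in> carrier C'" for c e
    using P'.\<theta>_subset_iff[OF P'.J_ideal_down[OF that(1)] P'.J_ideal_down[OF that(2)]]
      down_subset_down_iff[OF P'.po that] by simp
  have gen: "\<theta> (gen_J_ideal C J (h ` X)) = inv_image_map D k (\<theta>' (gen_J_ideal C' J' X))"
    if X: "X \<subseteq> carrier C'" for X
  proof -
    have hX: "h ` X \<subseteq> carrier C" using X hcl by blast
    have "\<theta> (gen_J_ideal C J (h ` X)) = (\<Union>c\<in>X. \<theta> (down C (h c)))"
      using P.\<theta>_gen[OF hX] by simp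
    also have "\<dots> = (\<Union>c\<in>X. inv_image_map D k (\<theta>' (down C' c)))"
      using h X by (intro SUP_cong) auto
    also have "\<dots> = inv_image_map D k (\<theta>' (gen_J_ideal C' J' X))"
      unfolding P'.\<theta>_gen[OF X] inv_UN ..
    finally show ?thesis .
  qed
  show m: "mate h k"
    unfolding mate_def A_map_def using gen[OF J_ideal_subset_carrier] gen_J_ideal_ideal by metis
  have UC: "carrier (U_compact_poset U D) = (\<lambda>c. \<theta> (down C c)) ` carrier C"
    "carrier (U_compact_poset U D') = (\<lambda>c. \<theta>' (down C' c)) ` carrier C'"
    "le (U_compact_poset U D) = (\<subseteq>)" "le (U_compact_poset U D') = (\<subseteq>)"
    unfolding U_compact_poset_def using P.U_compact_lower_set_iff P'.U_compact_lower_set_iff by auto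
  have sm: "site_morphism C' J' C J h"
    unfolding site_morphism_def
  proof (intro conjI ballI)
    show "h \<in> carrier C' \<rightarrow> carrier C" using hcl by blast
    have "h x \<sqsubseteq>\<^bsub>C\<^esub> h y" if xy: "x \<in> carrier C'" "y \<in> carrier C'" "x \<sqsubseteq>\<^bsub>C'\<^esub> y" for x y
      using xy le_iff[OF hcl hcl, of x y] le_iff'[of x y] h by (auto simp: inv_image_map_def)
    then show "isotone C' C h"
      using P.po P'.po by (simp add: isotone_def partial_order.axioms(1))
    show "filtering C' C h"
      unfolding filtering_def
    proof (intro conjI ballI impI)
      fix d assume d: "d \<in> carrier C"
      from filt[unfolded filtering_def UC, THEN conjunct1, rule_format, OF imageI[OF d]]
      obtain c where c: "c \<in> carrier C'" "\<theta> (down C d) \<subseteq> inv_image_map D k (\<theta>' (down C' c))"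
        by (elim bexE imageE) simp
      have "d \<sqsubseteq>\<^bsub>C\<^esub> h c" using c(2) le_iff[OF d hcl[OF c(1)]] h[OF c(1)] by simp
      then show "\<exists>c\<in>carrier C'. d \<sqsubseteq>\<^bsub>C\<^esub> h c" using c(1) by (rule bexI)
    next
      fix d a b assume d: "d \<in> carrier C" and a: "a \<in> carrier C'" and b: "b \<in> carrier C'"
        and "d \<sqsubseteq>\<^bsub>C\<^esub> h a \<and> d \<sqsubseteq>\<^bsub>C\<^esub> h b"
      then have le: "\<theta> (down C d) \<subseteq> inv_image_map D k (\<theta>' (down C' a)) \<and>
          \<theta> (down C d) \<subseteq> inv_image_map D k (\<theta>' (down C' b))"
        using le_iff[OF d hcl[OF a]] le_iff[OF d hcl[OF b]] h[OF a] h[OF b] by simp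
      from filt[unfolded filtering_def UC, THEN conjunct2, rule_format,
          OF imageI[OF d] imageI[OF a] imageI[OF b] le]
      obtain c where c: "c \<in> carrier C'" "\<theta>' (down C' c) \<subseteq> \<theta>' (down C' a)"
        "\<theta>' (down C' c) \<subseteq> \<theta>' (down C' b)" "\<theta> (down C d) \<subseteq> inv_image_map D k (\<theta>' (down C' c))"
        by (elim bexE imageE conjE) simp
      have "c \<sqsubseteq>\<^bsub>C'\<^esub> a \<and> c \<sqsubseteq>\<^bsub>C'\<^esub> b \<and> d \<sqsubseteq>\<^bsub>C\<^esub> h c"
        using c le_iff[OF d hcl[OF c(1)]] le_iff'[OF c(1) a] le_iff'[OF c(1) b] h[OF c(1)] by simp
      then show "\<exists>c\<in>carrier C'. c \<sqsubseteq>\<^bsub>C'\<^esub> a \<and> c \<sqsubseteq>\<^bsub>C'\<^esub> b \<and> d \<sqsubseteq>\<^bsub>C\<^esub> h c"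
        using c(1) by (rule bexI)
    qed
    fix c S assume c: "c \<in> carrier C'" "S \<in> J' c"
    have Sc: "S \<subseteq> carrier C'" using P'.cover_sieve[OF c] lower_set_subset_carrier by blast
    have hS: "h ` S \<subseteq> carrier C" using Sc hcl by blast
    have "\<theta> (gen_J_ideal C J (h ` S)) = \<theta> (down C (h c))"
      using gen[OF Sc] P'.gen_cover[OF c] h[OF c(1)] by simp
    then have "gen_J_ideal C J (h ` S) = down C (h c)"
      using P.\<theta>_eq_iff[OF J_ideal_gen[OF hS] P.J_ideal_down[OF hcl[OF c(1)]]] by simp
    then show "gen_sieve C (h ` S) \<in> J (h c)"
      using P.cover_iff[OF hcl[OF c(1)] lower_set_gen_sieve[OF P.po hS]] gen_J_ideal_gen_sieve[OF P.po hS]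
      by simp
  qed
  have "inf_pres (J_ideal_frame C' J') (J_ideal_frame C J) (A_map C J h)"
  proof (rule iffD2[OF inf_pres_A_map_iff], erule hcl, intro allI impI)
    fix \<A> assume A: "\<A> \<subseteq> {I. J_ideal C' J' I}"
    have AA: "A_map C J h ` \<A> \<subseteq> {I. J_ideal C J I}" using A A_map_ideal[OF sm] by blast
    have I: "J_ideal C' J' (carrier C' \<inter> \<Inter>\<A>)" using A by (intro J_ideal_Inter) blast
    have "\<theta> (A_map C J h (carrier C' \<inter> \<Inter>\<A>)) = inv_image_map D k (carrier D' \<inter> \<Inter>(\<theta>' ` \<A>))"
      using m I P'.\<theta>_inf[OF A] by (simp add: mate_def)
    also have "\<dots> = carrier D \<inter> (\<Inter>I\<in>\<A>. inv_image_map D k (\<theta>' I))"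
      using PiE_mem[OF k] by (auto simp: inv_image_map_def)
    also have "(\<Inter>I\<in>\<A>. inv_image_map D k (\<theta>' I)) = (\<Inter>I\<in>\<A>. \<theta> (A_map C J h I))"
      by (rule INF_cong[OF refl]) (use m A in \<open>auto simp: mate_def\<close>)
    also have "carrier D \<inter> (\<Inter>I\<in>\<A>. \<theta> (A_map C J h I)) = \<theta> (carrier C \<inter> \<Inter>(A_map C J h ` \<A>))"
      using P.\<theta>_inf[OF AA] by (simp add: image_image)
    finally show "A_map C J h (carrier C' \<inter> \<Inter>\<A>) = carrier C \<inter> \<Inter>(A_map C J h ` \<A>)"
      using P.\<theta>_eq_iff[OF A_map_ideal[OF sm I] J_ideal_Inter, of "A_map C J h ` \<A>"] AA by blast
  qed
  then show "h \<in> ExtK_arr (C', J') (C, J)" using hc sm by (simp add: ExtK_arr_def)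
qed

lemma mate_ex_left:
  assumes k: "k \<in> carrier D \<rightarrow>\<^sub>E carrier D'"
    and compact: "\<And>u. U_compact U (lower_set_frame D') u \<Longrightarrow> U_compact U (lower_set_frame D) (inv_image_map D k u)"
    and filt: "filtering (U_compact_poset U D') (U_compact_poset U D) (inv_image_map D k)"
  obtains h where "h \<in> ExtK_arr (C', J') (C, J)" "mate h k"
proof -
  have "\<exists>b\<in>carrier C. \<theta> (down C b) = inv_image_map D k (\<theta>' (down C' c))" if "c \<in> carrier C'" for c
  proof -
    have "U_compact U (lower_set_frame D') (\<theta>' (down C' c))"
      unfolding P'.U_compact_lower_set_iff using that by (intro bexI[of _ c]) simp_all
    then have "U_compact U (lower_set_frame D) (inv_image_map D k (\<theta>' (down C' c)))" by (rule compact)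
    then obtain b where "b \<in> carrier C" "inv_image_map D k (\<theta>' (down C' c)) = \<theta> (down C b)"
      unfolding P.U_compact_lower_set_iff by (elim bexE)
    then show ?thesis by (intro bexI[of _ b]) simp_all
  qed
  then obtain h where h: "\<And>c. c \<in> carrier C' \<Longrightarrow>
      h c \<in> carrier C \<and> \<theta> (down C (h c)) = inv_image_map D k (\<theta>' (down C' c))"
    by metis
  have r: "restrict h (carrier C') \<in> carrier C' \<rightarrow>\<^sub>E carrier C" using h by auto
  have "\<theta> (down C (restrict h (carrier C') c)) = inv_image_map D k (\<theta>' (down C' c))"
    if "c \<in> carrier C'" for c using h[OF that] that by simp
  from mate_left[OF k filt r this] show thesis by (rule that)
qed

end

section \<open>The functors and the duality\<close>

lemma poset_iso_copy:
  fixes P :: "'a set gorder" and Q :: "'a gorder"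
  assumes "isomorphic_posets Q P"
  shows "poset_iso (copy P) P (copy_iso P)"
proof -
  have "isomorphic_posets (copy P) P" unfolding copy_def using assms by (rule someI)
  then have "\<exists>\<phi>. poset_iso (copy P) P \<phi>" by (simp add: isomorphic_posets_def)
  then show ?thesis unfolding copy_iso_def by (rule someI_ex)
qed

lemma copy_map_eqI:
  assumes Q: "poset_iso (copy Q) Q (copy_iso Q)" and x: "x \<in> carrier (copy P)"
    and y: "y \<in> carrier (copy Q)" "copy_iso Q y = h (copy_iso P x)"
  shows "copy_map P Q h x = y"
  using x y(1) poset_iso_inj[OF Q] by (simp add: copy_map_def y(2)[symmetric])

lemma supercompact_poset_simps:
  "carrier (supercompact_poset X) = {I. supercompact (J_ideal_frame (fst X) (snd X)) I}"
  "le (supercompact_poset X) = (\<subseteq>)"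
  "partial_order (supercompact_poset X)"
  by (simp_all add: supercompact_poset_def split_def J_ideal_frame_def partial_order_subset_order)

lemma U_compact_poset_simps:
  "carrier (U_compact_poset U D) = {V. U_compact U (lower_set_frame D) V}"
  "le (U_compact_poset U D) = (\<subseteq>)"
  "partial_order (U_compact_poset U D)"
  by (simp_all add: U_compact_poset_def lower_set_frame_def partial_order_subset_order)

text \<open>What the hypotheses of the duality theorem provide, freed from sheaves and from the details of
  \<open>U\<close>-induced topologies.\<close>

locale duality =
  fixes \<K> \<H> :: "'a gorder set" and J :: "'a gorder \<Rightarrow> 'a \<Rightarrow> 'a set set"
    and U :: "'a set gorder \<Rightarrow> 'a set set \<Rightarrow> bool"
  assumes K_site: "\<And>C. C \<in> \<K> \<Longrightarrow> subcanonical_site C (J C)"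
    and K_compact: "\<And>C u. C \<in> \<K> \<Longrightarrow>
          U_compact U (J_ideal_frame C (J C)) u \<longleftrightarrow> (\<exists>c\<in>carrier C. u = down C c)"
    and K_to_H: "\<And>C. C \<in> \<K> \<Longrightarrow>
          \<exists>D\<in>\<H>. isomorphic_posets (J_ideal_frame C (J C)) (lower_set_frame D)"
    and H_to_K: "\<And>D. D \<in> \<H> \<Longrightarrow>
          \<exists>C\<in>\<K>. isomorphic_posets (J_ideal_frame C (J C)) (lower_set_frame D)"
    and H_po: "\<And>D. D \<in> \<H> \<Longrightarrow> partial_order D"
    and U_inv: "invariant_of_families U"
    and E_filtering: "\<And>D D' h. D \<in> ob (ExtH \<H> U) \<Longrightarrow> D' \<in> ob (ExtH \<H> U) \<Longrightarrow>
          h \<in> arr (ExtH \<H> U) D D' \<Longrightarrow>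
          filtering (U_compact_poset U D') (U_compact_poset U D) (inv_image_map D h)"
begin

abbreviation frame :: "'a site \<Rightarrow> 'a set gorder" where
  "frame X \<equiv> J_ideal_frame (fst X) (snd X)"

lemma ExtK_ob_base:
  assumes X: "X \<in> ExtK_ob \<K> J"
  obtains C \<phi> where "C \<in> \<K>" "site_iso (fst X) (snd X) C (J C) \<phi>"
    "poset_iso (fst X) C \<phi>" "poset_iso (frame X) (J_ideal_frame C (J C)) ((`) \<phi>)"
proof -
  interpret X: site "fst X" "snd X" by (rule ExtK_ob_site[OF X])
  obtain C \<phi> where C: "C \<in> \<K>" "site_iso (fst X) (snd X) C (J C) \<phi>"
    using X by (auto simp: ExtK_ob_def)
  interpret C: subcanonical_site C "J C" by (rule K_site[OF C(1)])
  have frames: "poset_iso (frame X) (J_ideal_frame C (J C)) ((`) \<phi>)"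
  proof (rule J_ideal_frame_iso[OF C(2)])
    show "S \<subseteq> carrier (fst X)" if "c \<in> carrier (fst X)" "S \<in> snd X c" for c S
      using X.cover_sieve[OF that] lower_set_subset_carrier by blast
    show "S \<subseteq> carrier C" if "c \<in> carrier C" "S \<in> J C c" for c S
      using C.cover_sieve[OF that] lower_set_subset_carrier by blast
  qed
  have "poset_iso (fst X) C \<phi>" using C(2) by (simp add: site_iso_def)
  then show thesis by (rule that[OF C _ frames])
qed

lemma ExtK_ob_subcanonical:
  assumes X: "X \<in> ExtK_ob \<K> J"
  shows "subcanonical_site (fst X) (snd X)"
proof -
  interpret X: site "fst X" "snd X" by (rule ExtK_ob_site[OF X])
  obtain C \<phi> where C: "C \<in> \<K>" "site_iso (fst X) (snd X) C (J C) \<phi>"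
    using ExtK_ob_base[OF X] by metis
  have "subcanonical (fst X) (snd X)"
  proof (rule site_iso_subcanonical[OF C(2)])
    show "subcanonical C (J C)" using K_site[OF C(1)] by (simp add: subcanonical_site_def subcanonical_site_axioms_def)
    show "S \<subseteq> carrier (fst X)" if "x \<in> carrier (fst X)" "S \<in> snd X x" for x S
      using X.cover_sieve[OF that] lower_set_subset_carrier by blast
  qed
  then show ?thesis by unfold_locales
qed

lemma ExtK_ob_compact:
  assumes X: "X \<in> ExtK_ob \<K> J"
  shows "U_compact U (frame X) u \<longleftrightarrow> (\<exists>c\<in>carrier (fst X). u = down (fst X) c)"
proof -
  interpret X: subcanonical_site "fst X" "snd X" by (rule ExtK_ob_subcanonical[OF X])
  obtain C \<phi> where C: "C \<in> \<K>" and \<phi>: "poset_iso (fst X) C \<phi>"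
    and iso: "poset_iso (frame X) (J_ideal_frame C (J C)) ((`) \<phi>)"
    using ExtK_ob_base[OF X] by metis
  interpret C: subcanonical_site C "J C" by (rule K_site[OF C])
  have "(`) \<phi> ` {u. U_compact U (frame X) u} = {v. U_compact U (J_ideal_frame C (J C)) v}"
    using U_compact_image[OF U_inv X.is_frame_J_ideal_frame C.is_frame_J_ideal_frame iso] by simp
  also have "\<dots> = down C ` \<phi> ` carrier (fst X)"
    unfolding K_compact[OF C] poset_iso_image[OF \<phi>] by blast
  also have "\<dots> = (`) \<phi> ` down (fst X) ` carrier (fst X)"
    unfolding image_image by (rule image_cong[OF refl]) (simp add: poset_iso_image_down[OF \<phi>])
  finally have images: "(`) \<phi> ` {u. U_compact U (frame X) u} = (`) \<phi> ` down (fst X) ` carrier (fst X)" .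
  have "{u. U_compact U (frame X) u} = down (fst X) ` carrier (fst X)"
  proof (rule iffD1[OF inj_on_image_eq_iff[OF poset_iso_inj[OF iso]] images])
    show "{u. U_compact U (frame X) u} \<subseteq> carrier (frame X)" by (auto simp: U_compact_def)
    show "down (fst X) ` carrier (fst X) \<subseteq> carrier (frame X)" using X.J_ideal_down by auto
  qed
  then have "U_compact U (frame X) u \<longleftrightarrow> u \<in> down (fst X) ` carrier (fst X)" by blast
  then show ?thesis by (simp add: image_iff)
qed

definition paired :: "'a site \<Rightarrow> 'a gorder \<Rightarrow> ('a set \<Rightarrow> 'a set) \<Rightarrow> bool" where
  "paired X D \<theta> \<longleftrightarrow> X \<in> ExtK_ob \<K> J \<and> D \<in> ob (ExtH \<H> U) \<and> poset_iso (frame X) (lower_set_frame D) \<theta>"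

text \<open>The arrow \<open>h\<close> goes from \<open>X'\<close> to \<open>X\<close>: it is an arrow from \<open>X\<close> to \<open>X'\<close> in the opposite
  category.\<close>

definition mates :: "'a site \<Rightarrow> 'a gorder \<Rightarrow> ('a set \<Rightarrow> 'a set) \<Rightarrow> 'a site \<Rightarrow> 'a gorder
    \<Rightarrow> ('a set \<Rightarrow> 'a set) \<Rightarrow> ('a \<Rightarrow> 'a) \<Rightarrow> ('a \<Rightarrow> 'a) \<Rightarrow> bool" where
  "mates X D \<theta> X' D' \<theta>' h k \<longleftrightarrow> h \<in> ExtK_arr X' X \<and> k \<in> arr (ExtH \<H> U) D D' \<and>
     (\<forall>I. J_ideal (fst X') (snd X') I \<longrightarrow> \<theta> (A_map (fst X) (snd X) h I) = inv_image_map D k (\<theta>' I))"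

lemma pairing:
  assumes P: "paired X D \<theta>"
  shows "pairing U (fst X) (snd X) D \<theta>"
proof -
  have X: "X \<in> ExtK_ob \<K> J" and D: "D \<in> ob (ExtH \<H> U)" and iso: "poset_iso (frame X) (lower_set_frame D) \<theta>"
    using P unfolding paired_def by blast+
  show ?thesis
    by (intro pairing.intro pairing_axioms.intro ExtK_ob_subcanonical[OF X] U_inv ExtK_ob_compact[OF X]
        ExtH_ob_po[OF D] iso)
qed

lemma two_pairings: "paired X D \<theta> \<Longrightarrow> paired X' D' \<theta>' \<Longrightarrow> two_pairings U (fst X) (snd X) D \<theta> (fst X') (snd X') D' \<theta>'"
  by (simp add: two_pairings_def pairing)

lemma mates_iff:
  assumes "paired X D \<theta>" "paired X' D' \<theta>'"
  shows "mates X D \<theta> X' D' \<theta>' h k \<longleftrightarrow> h \<in> ExtK_arr X' X \<and> k \<in> arr (ExtH \<H> U) D D' \<and>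
     two_pairings.mate (fst X) (snd X) D \<theta> (fst X') (snd X') \<theta>' h k"
  by (simp add: mates_def two_pairings.mate_def[OF two_pairings[OF assms]])

lemma ExtK_arr_components: "h \<in> ExtK_arr X' X \<Longrightarrow> h \<in> ExtK_arr (fst X', snd X') (fst X, snd X)"
  by simp

lemma mates_if_mate:
  assumes P: "paired X D \<theta>" "paired X' D' \<theta>'" and h: "h \<in> ExtK_arr X' X"
    and k: "k \<in> carrier D \<rightarrow>\<^sub>E carrier D'"
    and m: "two_pairings.mate (fst X) (snd X) D \<theta> (fst X') (snd X') \<theta>' h k"
  shows "mates X D \<theta> X' D' \<theta>' h k"
proof -
  interpret two_pairings U "fst X" "snd X" D \<theta> "fst X'" "snd X'" D' \<theta>' by (rule two_pairings[OF P])
  note hm = ExtK_arrD(2)[OF ExtK_arr_components[OF h]]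
  have "k \<in> arr (ExtH \<H> U) D D'"
    using k mate_isotone[OF hm k m] mate_compact[OF hm m] by simp
  then show ?thesis using h m mates_iff[OF P] by blast
qed

lemma mates_ex_right:
  assumes P: "paired X D \<theta>" "paired X' D' \<theta>'" and h: "h \<in> ExtK_arr X' X"
  shows "\<exists>k. mates X D \<theta> X' D' \<theta>' h k"
proof -
  interpret two_pairings U "fst X" "snd X" D \<theta> "fst X'" "snd X'" D' \<theta>' by (rule two_pairings[OF P])
  obtain k where k: "k \<in> carrier D \<rightarrow>\<^sub>E carrier D'" "mate h k"
    using mate_ex_right[OF ExtK_arr_components[OF h]] .
  from mates_if_mate[OF P h this] show ?thesis by blast
qed

lemma mates_ex_left:
  assumes P: "paired X D \<theta>" "paired X' D' \<theta>'" and k: "k \<in> arr (ExtH \<H> U) D D'"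
  shows "\<exists>h. mates X D \<theta> X' D' \<theta>' h k"
proof -
  interpret two_pairings U "fst X" "snd X" D \<theta> "fst X'" "snd X'" D' \<theta>' by (rule two_pairings[OF P])
  have filt: "filtering (U_compact_poset U D') (U_compact_poset U D) (inv_image_map D k)"
    using P k by (intro E_filtering) (simp_all add: paired_def)
  have k': "k \<in> carrier D \<rightarrow>\<^sub>E carrier D'"
    "\<And>u. U_compact U (lower_set_frame D') u \<Longrightarrow> U_compact U (lower_set_frame D) (inv_image_map D k u)"
    using k by simp_all
  obtain h where "h \<in> ExtK_arr (fst X', snd X') (fst X, snd X)" "mate h k"
    using mate_ex_left[OF k' filt] .
  then show ?thesis using mates_iff[OF P] k by auto
qed

lemma mates_unique_left:
  assumes P: "paired X D \<theta>" "paired X' D' \<theta>'"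
    and h: "mates X D \<theta> X' D' \<theta>' h k" and h': "mates X D \<theta> X' D' \<theta>' h' k"
  shows "h = h'"
proof -
  interpret two_pairings U "fst X" "snd X" D \<theta> "fst X'" "snd X'" D' \<theta>' by (rule two_pairings[OF P])
  have ha: "h \<in> ExtK_arr (fst X', snd X') (fst X, snd X)" "mate h k"
    and ha': "h' \<in> ExtK_arr (fst X', snd X') (fst X, snd X)" "mate h' k"
    using h h' by (simp_all add: mates_iff[OF P])
  show ?thesis
    by (rule mate_unique_left[OF ExtK_arrD(2,1)[OF ha(1)] ha(2) ExtK_arrD(2,1)[OF ha'(1)] ha'(2)])
qed

lemma mates_unique_right:
  assumes P: "paired X D \<theta>" "paired X' D' \<theta>'"
    and k: "mates X D \<theta> X' D' \<theta>' h k" and k': "mates X D \<theta> X' D' \<theta>' h k'"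
  shows "k = k'"
proof -
  interpret two_pairings U "fst X" "snd X" D \<theta> "fst X'" "snd X'" D' \<theta>' by (rule two_pairings[OF P])
  show ?thesis by (rule mate_unique_right[where h = h]) (use k k' in \<open>simp_all add: mates_iff[OF P]\<close>)
qed

lemma mates_identity:
  assumes P: "paired X D \<theta>"
  shows "mates X D \<theta> X D \<theta> (\<lambda>x\<in>carrier (fst X). x) (\<lambda>x\<in>carrier D. x)"
proof -
  interpret pairing U "fst X" "snd X" D \<theta> by (rule pairing[OF P])
  have "(\<lambda>x\<in>carrier (fst X). x) \<in> ExtK_arr X X"
    using ExtK_arr_identity[OF site_axioms] by simp
  moreover have "(\<lambda>x\<in>carrier D. x) \<in> arr (ExtH \<H> U) D D"
    using cat_id[OF category_ExtH, of D \<H> U] P by (simp add: paired_def)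
  ultimately show ?thesis
    by (simp add: mates_def A_map_identity inv_image_identity[OF \<theta>_lower])
qed

lemma mates_comp:
  assumes P: "paired X D \<theta>" "paired X' D' \<theta>'" "paired X'' D'' \<theta>''"
    and m: "mates X D \<theta> X' D' \<theta>' h k" and m': "mates X' D' \<theta>' X'' D'' \<theta>'' h' k'"
  shows "mates X D \<theta> X'' D'' \<theta>'' (compose (carrier (fst X'')) h h') (compose (carrier D) k' k)"
proof -
  interpret X: pairing U "fst X" "snd X" D \<theta> by (rule pairing[OF P(1)])
  interpret X': pairing U "fst X'" "snd X'" D' \<theta>' by (rule pairing[OF P(2)])
  interpret X'': pairing U "fst X''" "snd X''" D'' \<theta>'' by (rule pairing[OF P(3)])
  have h: "h \<in> ExtK_arr (fst X', snd X') (fst X, snd X)" and h': "h' \<in> ExtK_arr (fst X'', snd X'') (fst X', snd X')"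
    and k: "k \<in> arr (ExtH \<H> U) D D'" and k': "k' \<in> arr (ExtH \<H> U) D' D''"
    using m m' by (simp_all add: mates_def)
  note hm = ExtK_arrD(2)[OF h] and hm' = ExtK_arrD(2)[OF h']
  have "compose (carrier (fst X'')) h h' \<in> ExtK_arr X'' X"
    using ExtK_arr_comp[OF h' h X''.site_axioms X'.site_axioms X.site_axioms] by simp
  moreover have "compose (carrier D) k' k \<in> arr (ExtH \<H> U) D D''"
    using cat_comp[OF category_ExtH _ _ _ k k'] P by (simp add: paired_def)
  moreover have "\<theta> (A_map (fst X) (snd X) (compose (carrier (fst X'')) h h') I) =
      inv_image_map D (compose (carrier D) k' k) (\<theta>'' I)" if I: "J_ideal (fst X'') (snd X'') I" for I
  proof -
    have "J_ideal (fst X') (snd X') (A_map (fst X') (snd X') h' I)"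
      by (rule J_ideal_A_map[OF site_morphismD(1)[OF hm'] J_ideal_subset_carrier[OF I]])
    moreover have "k \<in> carrier D \<rightarrow> carrier D'" using k by (simp add: PiE_def)
    ultimately show ?thesis
      using m m' I A_map_comp[OF hm' hm J_ideal_subset_carrier[OF I]]
      by (simp add: mates_def inv_image_compose)
  qed
  ultimately show ?thesis unfolding mates_def by blast
qed

lemma correspondence_ExtK_ExtH: "correspondence (op_cat (ExtK \<K> J)) (ExtH \<H> U) paired mates"
proof (rule correspondence.intro)
  show "category (op_cat (ExtK \<K> J))" by (rule category_op[OF category_ExtK])
  show "category (ExtH \<H> U)" by (rule category_ExtH)
next
  fix X D \<theta> assume P: "paired X D \<theta>"
  then show "X \<in> ob (op_cat (ExtK \<K> J)) \<and> D \<in> ob (ExtH \<H> U)" by (simp add: paired_def)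
  from mates_identity[OF P]
  show "mates X D \<theta> X D \<theta> (idt (op_cat (ExtK \<K> J)) X) (idt (ExtH \<H> U) D)" by simp
next
  fix X D s X' D' t f g assume "mates X D s X' D' t f g"
  then show "f \<in> arr (op_cat (ExtK \<K> J)) X X' \<and> g \<in> arr (ExtH \<H> U) D D'" by (simp add: mates_def)
next
  fix X D s X' D' t X'' D'' u f g f' g'
  assume "paired X D s" "paired X' D' t" "paired X'' D'' u" "mates X D s X' D' t f g"
    "mates X' D' t X'' D'' u f' g'"
  from mates_comp[OF this]
  show "mates X D s X'' D'' u (cmp (op_cat (ExtK \<K> J)) X X' X'' f' f) (cmp (ExtH \<H> U) D D' D'' g' g)"
    by simp
next
  fix X D s X' D' t g assume "paired X D s" "paired X' D' t" "g \<in> arr (ExtH \<H> U) D D'"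
  then show "\<exists>f. mates X D s X' D' t f g" by (rule mates_ex_left)
next
  fix X D s X' D' t f assume "paired X D s" "paired X' D' t" "f \<in> arr (op_cat (ExtK \<K> J)) X X'"
  then show "\<exists>g. mates X D s X' D' t f g" by (intro mates_ex_right) simp_all
next
  fix X D s X' D' t f f' g
  assume "paired X D s" "paired X' D' t" "mates X D s X' D' t f g" "mates X D s X' D' t f' g"
  then show "f = f'" by (rule mates_unique_left)
next
  fix X D s X' D' t f g g'
  assume "paired X D s" "paired X' D' t" "mates X D s X' D' t f g" "mates X D s X' D' t f g'"
  then show "g = g'" by (rule mates_unique_right)
qed

text \<open>Under an isomorphism from the frame of a site to the frame of lower sets of some poset, the
  supercompact ideals correspond to the principal lower sets, hence to the elements of the poset.
  Replacing these by the supercompact ideals themselves gives a pairing that takes each supercompact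
  ideal to the principal lower set it generates.\<close>

lemma functor_D_pairing:
  assumes X: "X \<in> ExtK_ob \<K> J"
  shows "poset_iso (copy (supercompact_poset X)) (supercompact_poset X) (copy_iso (supercompact_poset X))"
    and "\<exists>\<theta>. paired X (copy (supercompact_poset X)) \<theta> \<and>
           (\<forall>x\<in>carrier (copy (supercompact_poset X)).
              J_ideal (fst X) (snd X) (copy_iso (supercompact_poset X) x) \<and>
              \<theta> (copy_iso (supercompact_poset X) x) = down (copy (supercompact_poset X)) x)"
proof -
  let ?P = "supercompact_poset X"
  let ?Q = "copy ?P" and ?\<sigma> = "copy_iso ?P"
  obtain C \<phi> where C: "C \<in> \<K>" "poset_iso (frame X) (J_ideal_frame C (J C)) ((`) \<phi>)"
    using ExtK_ob_base[OF X] by metis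
  obtain D \<psi> where D: "D \<in> \<H>" "poset_iso (J_ideal_frame C (J C)) (lower_set_frame D) \<psi>"
    using K_to_H[OF C(1)] unfolding isomorphic_posets_def by blast
  obtain \<tau> where \<tau>: "poset_iso (frame X) (lower_set_frame D) \<tau>" using poset_iso_trans[OF C(2) D(2)] by blast
  have \<tau>': "poset_iso (lower_set_frame D) (frame X) (inv_into (carrier (frame X)) \<tau>)"
    by (rule poset_iso_inv_into[OF \<tau>])
  define \<gamma> where "\<gamma> d = inv_into (carrier (frame X)) \<tau> (down D d)" for d
  have \<gamma>: "J_ideal (fst X) (snd X) (\<gamma> d) \<and> \<tau> (\<gamma> d) = down D d" if "d \<in> carrier D" for d
    unfolding \<gamma>_def
    using lower_set_down[OF H_po[OF D(1)] that] poset_iso_closed[OF \<tau>', of "down D d"] poset_iso_image[OF \<tau>]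
    by (simp add: f_inv_into_f)
  have \<gamma>_iso: "poset_iso D ?P \<gamma>"
  proof (rule poset_isoI[OF H_po[OF D(1)] supercompact_poset_simps(3)])
    have "{V. supercompact (lower_set_frame D) V} = down D ` carrier D"
      unfolding supercompact_lower_set_iff[OF H_po[OF D(1)]] by blast
    then show "\<gamma> ` carrier D = carrier ?P"
      using supercompact_image[OF \<tau>' _ complete_lattice_J_ideal_frame]
        is_frame_lower_set_frame[OF H_po[OF D(1)]]
      by (simp add: supercompact_poset_simps \<gamma>_def image_image is_frame_def)
    fix x y assume xy: "x \<in> carrier D" "y \<in> carrier D"
    show "x \<sqsubseteq>\<^bsub>D\<^esub> y \<longleftrightarrow> \<gamma> x \<sqsubseteq>\<^bsub>?P\<^esub> \<gamma> y"
      using poset_iso_le_iff[OF \<tau>, of "\<gamma> x" "\<gamma> y"] \<gamma>[OF xy(1)] \<gamma>[OF xy(2)]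
        down_subset_down_iff[OF H_po[OF D(1)] xy]
      by (simp add: supercompact_poset_simps)
  qed
  then have "isomorphic_posets D ?P" by (rule isomorphic_posetsI)
  then show \<sigma>: "poset_iso ?Q ?P ?\<sigma>" by (rule poset_iso_copy)
  define \<alpha> where "\<alpha> x = inv_into (carrier D) \<gamma> (?\<sigma> x)" for x
  have \<alpha>: "poset_iso ?Q D \<alpha>"
    unfolding \<alpha>_def by (rule poset_iso_trans[OF \<sigma> poset_iso_inv_into[OF \<gamma>_iso]])
  have \<gamma>\<alpha>: "\<gamma> (\<alpha> x) = ?\<sigma> x" if "x \<in> carrier ?Q" for x
    unfolding \<alpha>_def using poset_iso_closed[OF \<sigma> that] poset_iso_image[OF \<gamma>_iso] by (simp add: f_inv_into_f)
  define \<theta> where "\<theta> I = inv_image_map ?Q \<alpha> (\<tau> I)" for I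
  have \<theta>: "poset_iso (frame X) (lower_set_frame ?Q) \<theta>"
    unfolding \<theta>_def by (rule poset_iso_trans[OF \<tau> lower_set_frame_iso[OF \<alpha>]])
  have "isomorphic_posets ?Q D" using \<alpha> by (rule isomorphic_posetsI)
  then have "?Q \<in> ob (ExtH \<H> U)" using D(1) by auto
  then have "paired X ?Q \<theta>" using X \<theta> by (simp add: paired_def)
  moreover have "J_ideal (fst X) (snd X) (?\<sigma> x) \<and> \<theta> (?\<sigma> x) = down ?Q x" if x: "x \<in> carrier ?Q" for x
  proof
    have \<alpha>x: "\<alpha> x \<in> carrier D" by (rule poset_iso_closed[OF \<alpha> x])
    show "J_ideal (fst X) (snd X) (?\<sigma> x)" using \<gamma>[OF \<alpha>x] \<gamma>\<alpha>[OF x] by simp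
    have "\<theta> (?\<sigma> x) = inv_image_map ?Q \<alpha> (down D (\<alpha> x))" using \<gamma>[OF \<alpha>x] \<gamma>\<alpha>[OF x] by (simp add: \<theta>_def)
    also have "\<dots> = down ?Q x"
      using poset_iso_closed[OF \<alpha>] poset_iso_le_iff[OF \<alpha> _ x] by (auto simp: inv_image_map_def mem_down)
    finally show "\<theta> (?\<sigma> x) = down ?Q x" .
  qed
  ultimately show "\<exists>\<theta>. paired X ?Q \<theta> \<and> (\<forall>x\<in>carrier ?Q. J_ideal (fst X) (snd X) (?\<sigma> x) \<and> \<theta> (?\<sigma> x) = down ?Q x)"
    by (intro exI[of _ \<theta>]) simp
qed

lemma fob_functor_E:
  "fst (fob (functor_E U) D) = copy (U_compact_poset U D)"
  "snd (fob (functor_E U) D) x = {S. S \<subseteq> carrier (copy (U_compact_poset U D)) \<and>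
     copy_iso (U_compact_poset U D) ` S \<in> U_compact_topology U D (copy_iso (U_compact_poset U D) x)}"
  by (simp_all add: functor_E_def Let_def)

text \<open>Likewise any presentation of the frame of lower sets of \<open>D\<close> by a site identifies the elements of the
  site with the \<open>U\<close>-compact lower sets.  It identifies the topologies as well, since in both a sieve
  covers if its join in the frame is the given element.\<close>

lemma functor_E_pairing:
  assumes D: "D \<in> ob (ExtH \<H> U)"
  shows "poset_iso (copy (U_compact_poset U D)) (U_compact_poset U D) (copy_iso (U_compact_poset U D))"
    and "\<exists>\<theta>. paired (fob (functor_E U) D) D \<theta> \<and>
           (\<forall>x\<in>carrier (copy (U_compact_poset U D)).
              \<theta> (down (copy (U_compact_poset U D)) x) = copy_iso (U_compact_poset U D) x)"
proof -
  let ?P = "U_compact_poset U D"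
  let ?Q = "copy ?P" and ?\<sigma> = "copy_iso ?P" and ?X = "fob (functor_E U) D"
  obtain D\<^sub>0 where D\<^sub>0: "D\<^sub>0 \<in> \<H>" "isomorphic_posets D D\<^sub>0" using D by auto
  obtain C where C: "C \<in> \<K>" "isomorphic_posets (J_ideal_frame C (J C)) (lower_set_frame D\<^sub>0)"
    using H_to_K[OF D\<^sub>0(1)] by (elim bexE)
  have "isomorphic_posets (J_ideal_frame C (J C)) (lower_set_frame D)"
    by (rule isomorphic_posets_trans[OF C(2) isomorphic_lower_set_frames[OF isomorphic_posets_sym[OF D\<^sub>0(2)]]])
  then obtain \<tau> where \<tau>: "poset_iso (J_ideal_frame C (J C)) (lower_set_frame D) \<tau>"
    unfolding isomorphic_posets_def by (elim exE)
  interpret C: subcanonical_site C "J C" by (rule K_site[OF C(1)])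
  interpret C: pairing U C "J C" D \<tau>
    by (intro pairing.intro pairing_axioms.intro C.subcanonical_site_axioms U_inv K_compact[OF C(1)]
        ExtH_ob_po[OF D] \<tau>)
  define \<gamma> where "\<gamma> c = \<tau> (down C c)" for c
  have \<gamma>_iso: "poset_iso C ?P \<gamma>"
  proof (rule poset_isoI[OF C.po U_compact_poset_simps(3)])
    show "\<gamma> ` carrier C = carrier ?P"
      unfolding U_compact_poset_simps C.U_compact_lower_set_iff \<gamma>_def by blast
    fix x y assume xy: "x \<in> carrier C" "y \<in> carrier C"
    show "x \<sqsubseteq>\<^bsub>C\<^esub> y \<longleftrightarrow> \<gamma> x \<sqsubseteq>\<^bsub>?P\<^esub> \<gamma> y"
      unfolding U_compact_poset_simps \<gamma>_def
      using C.\<theta>_subset_iff[OF C.J_ideal_down[OF xy(1)] C.J_ideal_down[OF xy(2)]]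
        down_subset_down_iff[OF C.po xy] by simp
  qed
  then have "isomorphic_posets C ?P" by (rule isomorphic_posetsI)
  then show \<sigma>: "poset_iso ?Q ?P ?\<sigma>" by (rule poset_iso_copy)
  define \<beta> where "\<beta> x = inv_into (carrier C) \<gamma> (?\<sigma> x)" for x
  have \<beta>: "poset_iso ?Q C \<beta>"
    unfolding \<beta>_def by (rule poset_iso_trans[OF \<sigma> poset_iso_inv_into[OF \<gamma>_iso]])
  have \<gamma>\<beta>: "\<gamma> (\<beta> x) = ?\<sigma> x" if "x \<in> carrier ?Q" for x
    unfolding \<beta>_def using poset_iso_closed[OF \<sigma> that] poset_iso_image[OF \<gamma>_iso] by (simp add: f_inv_into_f)
  have cover: "S \<in> snd ?X x \<longleftrightarrow> \<beta> ` S \<in> J C (\<beta> x)" if x: "x \<in> carrier ?Q" and S: "S \<subseteq> carrier ?Q" for x S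
  proof -
    have \<beta>x: "\<beta> x \<in> carrier C" by (rule poset_iso_closed[OF \<beta> x])
    have \<beta>S: "\<beta> ` S \<subseteq> carrier C" using S poset_iso_closed[OF \<beta>] by blast
    have \<sigma>S: "?\<sigma> ` S = \<gamma> ` \<beta> ` S"
      unfolding image_image using \<gamma>\<beta> S by (intro image_cong) (auto dest: subsetD)
    have \<gamma>\<beta>S: "\<gamma> ` \<beta> ` S \<subseteq> {V. lower_set D V}"
      using \<beta>S C.\<theta>_lower[OF C.J_ideal_down] unfolding \<gamma>_def by blast
    have "S \<in> snd ?X x \<longleftrightarrow> is_sieve ?P (\<gamma> (\<beta> x)) (\<gamma> ` \<beta> ` S) \<and> \<Union>(\<gamma> ` \<beta> ` S) = \<gamma> (\<beta> x)"
      using S \<gamma>\<beta>[OF x] \<sigma>S sup_lower_set_frame[OF \<gamma>\<beta>S]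
      by (simp add: fob_functor_E U_compact_topology_def)
    also have "is_sieve ?P (\<gamma> (\<beta> x)) (\<gamma> ` \<beta> ` S) \<longleftrightarrow> is_sieve C (\<beta> x) (\<beta> ` S)"
    proof -
      have "down C (\<beta> x) \<subseteq> carrier C" by (auto simp: mem_down)
      from poset_iso_image_subset_iff[OF \<gamma>_iso \<beta>S this]
      show ?thesis
        unfolding is_sieve_def
        by (simp add: poset_iso_lower_set_image_iff[OF \<gamma>_iso \<beta>S] poset_iso_image_down[OF \<gamma>_iso \<beta>x])
    qed
    also have "\<Union>(\<gamma> ` \<beta> ` S) = \<gamma> (\<beta> x) \<longleftrightarrow> gen_J_ideal C (J C) (\<beta> ` S) = down C (\<beta> x)"
      using C.\<theta>_gen[OF \<beta>S] C.\<theta>_eq_iff[OF J_ideal_gen[OF \<beta>S] C.J_ideal_down[OF \<beta>x]]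
      by (simp add: \<gamma>_def)
    also have "is_sieve C (\<beta> x) (\<beta> ` S) \<and> gen_J_ideal C (J C) (\<beta> ` S) = down C (\<beta> x) \<longleftrightarrow> \<beta> ` S \<in> J C (\<beta> x)"
      using C.cover_iff[OF \<beta>x, of "\<beta> ` S"] C.cover_sieve[OF \<beta>x, of "\<beta> ` S"] by (auto simp: is_sieve_def)
    finally show ?thesis .
  qed
  have site_iso: "site_iso ?Q (snd ?X) C (J C) \<beta>"
    unfolding site_iso_def using \<beta> cover by blast
  have subset: "S \<subseteq> carrier ?Q" if "S \<in> snd ?X x" for x S using that by (simp add: fob_functor_E)
  have "grothendieck_topology ?Q (snd ?X)"
    by (rule site_iso_topology[OF site_iso C.site_axioms subset])
  moreover have "partial_order ?Q" using poset_iso_po[OF \<beta>] by blast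
  ultimately have X: "?X \<in> ExtK_ob \<K> J"
    using site_iso C(1) by (intro ExtK_obI[of ?X C]) (simp_all add: fob_functor_E(1))
  have image: "poset_iso (J_ideal_frame ?Q (snd ?X)) (J_ideal_frame C (J C)) ((`) \<beta>)"
  proof (rule J_ideal_frame_iso[OF site_iso subset])
    show "S \<subseteq> carrier C" if "c \<in> carrier C" "S \<in> J C c" for c S
      using C.cover_sieve[OF that] lower_set_subset_carrier by blast
  qed
  define \<theta> where "\<theta> I = \<tau> (\<beta> ` I)" for I
  have "poset_iso (frame ?X) (lower_set_frame D) \<theta>"
    unfolding \<theta>_def fob_functor_E(1) by (rule poset_iso_trans[OF image \<tau>])
  then have "paired ?X D \<theta>" using X D by (simp add: paired_def)
  moreover have "\<theta> (down ?Q x) = ?\<sigma> x" if x: "x \<in> carrier ?Q" for x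
    using poset_iso_image_down[OF \<beta> x] \<gamma>\<beta>[OF x] by (simp add: \<theta>_def \<gamma>_def)
  ultimately show "\<exists>\<theta>. paired ?X D \<theta> \<and> (\<forall>x\<in>carrier ?Q. \<theta> (down ?Q x) = ?\<sigma> x)"
    by (intro exI[of _ \<theta>]) simp
qed

text \<open>Both functors send an arrow to its mate: restricted to supercompact elements the left adjoint of
  \<open>A(h)\<close> is the mate of \<open>h\<close>, and restricted to compact elements the inverse image along \<open>k\<close> is the
  mate of \<open>k\<close>.\<close>

theorem duality:
  shows "categorical_inverses (op_cat (ExtK \<K> J)) (ExtH \<H> U) functor_D (functor_E U)"
proof -
  have fob_D: "fob functor_D X = copy (supercompact_poset X)" for X :: "'a site"
    by (simp add: functor_D_def)
  have "\<exists>p. \<forall>X\<in>ExtK_ob \<K> J. paired X (fob functor_D X) (p X) \<and>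
      (\<forall>x\<in>carrier (fob functor_D X). J_ideal (fst X) (snd X) (copy_iso (supercompact_poset X) x) \<and>
         p X (copy_iso (supercompact_poset X) x) = down (fob functor_D X) x)"
    unfolding fob_D by (rule bchoice) (intro ballI functor_D_pairing(2))
  then obtain p where p: "\<And>X. X \<in> ExtK_ob \<K> J \<Longrightarrow> paired X (fob functor_D X) (p X)"
    and p_\<sigma>: "\<And>X x. X \<in> ExtK_ob \<K> J \<Longrightarrow> x \<in> carrier (fob functor_D X) \<Longrightarrow>
      J_ideal (fst X) (snd X) (copy_iso (supercompact_poset X) x) \<and>
      p X (copy_iso (supercompact_poset X) x) = down (fob functor_D X) x"
    by metis
  have "\<exists>q. \<forall>D\<in>ob (ExtH \<H> U). paired (fob (functor_E U) D) D (q D) \<and>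
      (\<forall>x\<in>carrier (copy (U_compact_poset U D)).
         q D (down (copy (U_compact_poset U D)) x) = copy_iso (U_compact_poset U D) x)"
    by (rule bchoice) (intro ballI functor_E_pairing(2))
  then obtain q where q: "\<And>D. D \<in> ob (ExtH \<H> U) \<Longrightarrow> paired (fob (functor_E U) D) D (q D)"
    and q_\<sigma>: "\<And>D x. D \<in> ob (ExtH \<H> U) \<Longrightarrow> x \<in> carrier (copy (U_compact_poset U D)) \<Longrightarrow>
      q D (down (copy (U_compact_poset U D)) x) = copy_iso (U_compact_poset U D) x"
    by metis
  have D_arr: "mates X (fob functor_D X) (p X) X' (fob functor_D X') (p X') h (farr functor_D X X' h)"
    if X: "X \<in> ExtK_ob \<K> J" and X': "X' \<in> ExtK_ob \<K> J" and h: "h \<in> ExtK_arr X' X" for X X' h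
  proof -
    let ?P = "supercompact_poset X" and ?P' = "supercompact_poset X'"
    note P = p[OF X] p[OF X']
    interpret two_pairings U "fst X" "snd X" "fob functor_D X" "p X" "fst X'" "snd X'" "fob functor_D X'" "p X'"
      by (rule two_pairings[OF P])
    obtain k where k: "k \<in> carrier (fob functor_D X) \<rightarrow>\<^sub>E carrier (fob functor_D X')" "mate h k"
      using mate_ex_right[OF ExtK_arr_components[OF h]] .
    have "copy_map ?P ?P' (A_shriek (fst X') (snd X') (fst X) (snd X) h) x = k x"
      if x: "x \<in> carrier (fob functor_D X)" for x
    proof (rule copy_map_eqI[OF functor_D_pairing(1)[OF X']])
      have kx: "k x \<in> carrier (fob functor_D X')" by (rule PiE_mem[OF k(1) x])
      show "x \<in> carrier (copy ?P)" "k x \<in> carrier (copy ?P')" using x kx unfolding fob_D .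
      note shriek = mate_shriek[OF ExtK_arrD(2)[OF ExtK_arr_components[OF h]] k
          conjunct1[OF p_\<sigma>[OF X x]] x conjunct2[OF p_\<sigma>[OF X x]]]
      show "copy_iso ?P' (k x) = A_shriek (fst X') (snd X') (fst X) (snd X) h (copy_iso ?P x)"
        using P'.\<theta>_eq_iff[OF conjunct1[OF p_\<sigma>[OF X' kx]] shriek(1)] shriek(2) p_\<sigma>[OF X' kx] by simp
    qed
    then have "copy_map ?P ?P' (A_shriek (fst X') (snd X') (fst X) (snd X) h) = k"
      using k(1) unfolding fob_D
      by (intro extensionalityI[of _ "carrier (copy ?P)"]) (simp_all add: copy_map_def PiE_def)
    then have "farr functor_D X X' h = k" by (simp add: functor_D_def)
    then show ?thesis using mates_if_mate[OF P h k] by simp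
  qed
  have E_arr: "mates (fob (functor_E U) D) D (q D) (fob (functor_E U) D') D' (q D') (farr (functor_E U) D D' k) k"
    if D: "D \<in> ob (ExtH \<H> U)" and D': "D' \<in> ob (ExtH \<H> U)" and k: "k \<in> arr (ExtH \<H> U) D D'" for D D' k
  proof -
    let ?X = "fob (functor_E U) D" and ?X' = "fob (functor_E U) D'"
    let ?P = "U_compact_poset U D" and ?P' = "U_compact_poset U D'"
    note P = q[OF D] q[OF D']
    obtain h where h: "mates ?X D (q D) ?X' D' (q D') h k" using mates_ex_left[OF P k] by (elim exE)
    interpret two_pairings U "fst ?X" "snd ?X" D "q D" "fst ?X'" "snd ?X'" D' "q D'"
      by (rule two_pairings[OF P])
    have ha: "h \<in> ExtK_arr (fst ?X', snd ?X') (fst ?X, snd ?X)" and m: "mate h k"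
      using h by (simp_all add: mates_iff[OF P])
    have hc: "h \<in> carrier (copy ?P') \<rightarrow>\<^sub>E carrier (copy ?P)"
      using ExtK_arrD(1)[OF ha] unfolding fob_functor_E(1) .
    have "copy_map ?P' ?P (inv_image_map D k) x = h x" if x: "x \<in> carrier (copy ?P')" for x
    proof (rule copy_map_eqI[OF functor_E_pairing(1)[OF D] x])
      show hx: "h x \<in> carrier (copy ?P)" by (rule PiE_mem[OF hc x])
      show "copy_iso ?P (h x) = inv_image_map D k (copy_iso ?P' x)"
        using mate_down[OF ExtK_arrD(2)[OF ha] m, unfolded fob_functor_E(1), OF x]
        unfolding q_\<sigma>[OF D hx] q_\<sigma>[OF D' x] .
    qed
    then have "copy_map ?P' ?P (inv_image_map D k) = h"
      using hc by (intro extensionalityI[of _ "carrier (copy ?P')"]) (simp_all add: copy_map_def PiE_def)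
    then have "farr (functor_E U) D D' k = h" by (simp add: functor_E_def)
    then show ?thesis using h by simp
  qed
  interpret correspondence "op_cat (ExtK \<K> J)" "ExtH \<H> U" paired mates
    by (rule correspondence_ExtK_ExtH)
  show ?thesis
    by (rule categorical_inverses_if_mates[where p = p and q = q]) (use p q D_arr E_arr in simp_all)
qed

end

theorem theorem5p3:
  fixes \<K> \<H> :: "'a gorder set"
    and J :: "'a gorder \<Rightarrow> 'a \<Rightarrow> 'a set set"
    and f g :: "'a gorder \<Rightarrow> 'a gorder"
    and U :: "'a set gorder \<Rightarrow> 'a set set \<Rightarrow> bool"
  assumes K_posets: "\<And>C. C \<in> \<K> \<Longrightarrow> partial_order C"
    and K_topologies: "\<And>C. C \<in> \<K> \<Longrightarrow> grothendieck_topology C (J C)"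
    and K_subcanonical: "\<And>C. C \<in> \<K> \<Longrightarrow> subcanonical C (J C)"
    and H_posets: "\<And>D. D \<in> \<H> \<Longrightarrow> partial_order D"
    and f_maps: "f \<in> \<K> \<rightarrow> \<H>"
    and g_maps: "g \<in> \<H> \<rightarrow> \<K>"
    and gf: "\<And>C. C \<in> \<K> \<Longrightarrow> isomorphic_posets (g (f C)) C"
    and fg: "\<And>D. D \<in> \<H> \<Longrightarrow> isomorphic_posets (f (g D)) D"
    and Sh_equiv: "\<And>C. C \<in> \<K> \<Longrightarrow>
          equivalent_categories (sheaf_cat TYPE('s) C (J C)) (presheaf_cat TYPE('s) (f C))"
    and U_invariant: "invariant_of_families U"
    and J_induced: "\<And>C. C \<in> \<K> \<Longrightarrow> U_induced \<K> J U C"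
    and U_principal: "\<And>C F. C \<in> \<K> \<Longrightarrow> F \<subseteq> principal_J_ideals C (J C) \<Longrightarrow>
          (\<exists>B. refines (J_ideal_frame C (J C)) B F \<and> U (J_ideal_frame C (J C)) B) \<longleftrightarrow>
          (\<exists>B\<subseteq>principal_J_ideals C (J C).
             refines (J_ideal_frame C (J C)) B F \<and> U (J_ideal_frame C (J C)) B)"
    \<comment> \<open>presupposition that \<open>E\<close> is well-defined on arrows: \<open>E(h)\<close> satisfies the filtering conditions required of a
       morphism of sites; this is not implied by the other hypotheses\<close>
    and E_well_defined: "\<And>D D' h. D \<in> ob (ExtH \<H> U) \<Longrightarrow> D' \<in> ob (ExtH \<H> U) \<Longrightarrow>
          h \<in> arr (ExtH \<H> U) D D' \<Longrightarrow>
          filtering (U_compact_poset U D') (U_compact_poset U D) (inv_image_map D h)"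
  shows "(\<forall>C\<in>ob (ExtK \<K> J). isomorphic_posets (fob functor_D C) (supercompact_poset C)) \<and>
         (\<forall>D\<in>ob (ExtH \<H> U). isomorphic_posets (fst (fob (functor_E U) D)) (U_compact_poset U D)) \<and>
         categorical_inverses (op_cat (ExtK \<K> J)) (ExtH \<H> U) functor_D (functor_E U)"
proof -
  have f: "f C \<in> \<H>" if "C \<in> \<K>" for C using f_maps that by blast
  have site: "subcanonical_site C (J C)" if "C \<in> \<K>" for C
    by (intro subcanonical_site.intro site.intro subcanonical_site_axioms.intro
        K_posets[OF that] K_topologies[OF that] K_subcanonical[OF that])
  have frames: "isomorphic_posets (J_ideal_frame C (J C)) (lower_set_frame (f C))" if C: "C \<in> \<K>" for C
  proof -
    note fC = H_posets[OF f[OF C]]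
    show ?thesis
      using isomorphic_J_ideal_frames[OF site[OF C] trivial_site[OF fC]]
        Sh_equiv[OF C, unfolded presheaf_cat_eq_sheaf_cat[OF fC]]
      by (simp add: lower_set_frame_eq[OF fC])
  qed
  have compact: "U_compact U (J_ideal_frame C (J C)) u \<longleftrightarrow> (\<exists>c\<in>carrier C. u = down C c)" if C: "C \<in> \<K>" for C u
  proof -
    interpret subcanonical_site C "J C" by (rule site[OF C])
    obtain P where P: "P (J_ideal_frame C (J C)) (down C ` carrier C)" "U_induced_rel U P C (J C)"
      using J_induced[OF C] C unfolding U_induced_def by blast
    have "principal_J_ideals C (J C) = down C ` carrier C"
      unfolding principal_J_ideals_def by (rule image_cong[OF refl]) (rule gen_J_ideal_singleton)
    with U_principal[OF C] have principal:
      "(\<exists>B. refines (J_ideal_frame C (J C)) B F \<and> U (J_ideal_frame C (J C)) B) \<longleftrightarrow>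
       (\<exists>B\<subseteq>down C ` carrier C. refines (J_ideal_frame C (J C)) B F \<and> U (J_ideal_frame C (J C)) B)"
      if "F \<subseteq> down C ` carrier C" for F
      using that by simp
    show ?thesis by (rule U_compact_iff_principal[where P = P, OF P]) (simp only: principal)
  qed
  interpret duality \<K> \<H> J U
  proof (rule duality.intro)
    fix D assume D: "D \<in> \<H>"
    have gD: "g D \<in> \<K>" using g_maps D by blast
    have "isomorphic_posets (J_ideal_frame (g D) (J (g D))) (lower_set_frame D)"
      by (rule isomorphic_posets_trans[OF frames[OF gD] isomorphic_lower_set_frames[OF fg[OF D]]])
    then show "\<exists>C\<in>\<K>. isomorphic_posets (J_ideal_frame C (J C)) (lower_set_frame D)" using gD by (rule bexI)
    show "partial_order D" by (rule H_posets[OF D])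
  next
    fix C assume C: "C \<in> \<K>"
    show "subcanonical_site C (J C)" by (rule site[OF C])
    show "U_compact U (J_ideal_frame C (J C)) u \<longleftrightarrow> (\<exists>c\<in>carrier C. u = down C c)" for u by (rule compact[OF C])
    show "\<exists>D\<in>\<H>. isomorphic_posets (J_ideal_frame C (J C)) (lower_set_frame D)"
      using frames[OF C] f[OF C] by (rule bexI)
  qed (rule U_invariant, rule E_well_defined)
  have "isomorphic_posets (fob functor_D X) (supercompact_poset X)" if "X \<in> ob (ExtK \<K> J)" for X
    using isomorphic_posetsI[OF functor_D_pairing(1)[of X]] that by (simp add: functor_D_def)
  moreover have "isomorphic_posets (fst (fob (functor_E U) D)) (U_compact_poset U D)" if "D \<in> ob (ExtH \<H> U)" for D
    unfolding fob_functor_E(1) by (rule isomorphic_posetsI[OF functor_E_pairing(1)[OF that]])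
  ultimately show ?thesis using duality by blast
qed

end
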